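(* Let $\varepsilon>0$, let $G$ be a graph on $n$ vertices with minimum degree $\delta(G)\geq(1+\varepsilon)n/2$, and let $p=\omega(\log n/n)$. Then there exist functions $c=O(n)$ and $t=\Theta(np)$ such that w.h.p. a random edge-colored graph $H\sim\mathcal G_c(G,p)$ contains at least $t$ edge-disjoint rainbow Hamilton cycles.
   Context: Asymptotic notation is as $n\to\infty$: $\varepsilon$ is a fixed constant, $G=G_n$ and $p=p(n)\in[0,1]$ form sequences indexed by $n$, and the functions $c,t$ and the implied constants in $O(n)$ and $\Theta(np)$ may depend on $\varepsilon$. $p=\omega(\log n/n)$ means $pn/\log n\to\infty$. "W.h.p." means with probability tending to $1$ as $n\to\infty$. For a graph $G$, $p\in[0,1]$ and a positive integer $c$, $\mathcal G_c(G,p)$ is the probability space of edge-colored graphs obtained by keeping each edge of $G$ independently with probability $p$ and then coloring each kept edge independently and uniformly at random with a color from $[c]=\{1,\dots,c\}$. A subgraph is rainbow if all of its edges have distinct colors. *)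

theory Defs
  imports "HOL-Probability.Probability" "HOL-Library.Landau_Symbols"
begin

(* A graph is a pair (vertex set, edge set); edges are two-element sets of vertices. *)
type_synonym 'a graph = "'a set \<times> 'a set set"

abbreviation verts :: "'a graph \<Rightarrow> 'a set" where
  "verts G \<equiv> fst G"

abbreviation edges :: "'a graph \<Rightarrow> 'a set set" where
  "edges G \<equiv> snd G"

definition finite_simple_graph :: "'a graph \<Rightarrow> bool" where
  "finite_simple_graph G \<longleftrightarrow>
     finite (verts G) \<and> edges G \<subseteq> {e. e \<subseteq> verts G \<and> card e = 2}"

definition degree :: "'a graph \<Rightarrow> 'a \<Rightarrow> nat" where
  "degree G v = card {e \<in> edges G. v \<in> e}"

(* Only meaningful for a finite nonempty vertex set, since Min {} is unspecified. *)
definition min_degree :: "'a graph \<Rightarrow> nat" where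
  "min_degree G = Min (degree G ` verts G)"

definition cycle_edges :: "'a list \<Rightarrow> 'a set set" where
  "cycle_edges vs = {{vs ! i, vs ! (Suc i mod length vs)} | i. i < length vs}"

(* A Hamilton cycle is identified with its edge set, so that rotations and
   reversals of a vertex ordering give the same cycle. *)
definition hamilton_cycle :: "'a graph \<Rightarrow> 'a set set \<Rightarrow> bool" where
  "hamilton_cycle G F \<longleftrightarrow>
     F \<subseteq> edges G \<and>
     (\<exists>vs. distinct vs \<and> set vs = verts G \<and> 3 \<le> length vs \<and> F = cycle_edges vs)"

(* The edge coloring of an edge-colored graph is a partial map whose domain is
   the edge set. *)
type_synonym 'a edge_coloring = "'a set \<Rightarrow> nat option"

definition rainbow :: "'a edge_coloring \<Rightarrow> 'a set set \<Rightarrow> bool" where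
  "rainbow H F \<longleftrightarrow> F \<subseteq> dom H \<and> inj_on H F"

definition has_disjoint_rainbow_hamilton_cycles ::
    "'a set \<Rightarrow> 'a edge_coloring \<Rightarrow> nat \<Rightarrow> bool" where
  "has_disjoint_rainbow_hamilton_cycles V H t \<longleftrightarrow>
     (\<exists>\<F>. finite \<F> \<and> t \<le> card \<F> \<and> pairwise disjnt \<F> \<and>
          (\<forall>F\<in>\<F>. hamilton_cycle (V, dom H) F \<and> rainbow H F))"

definition random_edges :: "'a graph \<Rightarrow> real \<Rightarrow> 'a set set pmf" where
  "random_edges G p =
     map_pmf (\<lambda>keep. {e \<in> edges G. keep e})
       (Pi_pmf (edges G) False (\<lambda>_. bernoulli_pmf p))"

(* The vertex set of the random graph is that of G and is not recorded in the
   outcome.  Requires edges G finite, 0 <= p <= 1 and c > 0. *)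
definition random_colored_graph ::
    "nat \<Rightarrow> 'a graph \<Rightarrow> real \<Rightarrow> 'a edge_coloring pmf" where
  "random_colored_graph c G p =
     bind_pmf (random_edges G p)
       (\<lambda>K. Pi_pmf K None (\<lambda>_. map_pmf Some (pmf_of_set {1..c})))"

end

theory Submission
  imports Defs "HOL-Real_Asymp.Real_Asymp"
begin

text \<open>
  Call a set \<open>F\<close> of edges of \<open>H\<close> rainbow if its colours are distinct. A union bound over all
  \<open>O(n)\<close>-subsets \<open>M\<close> of \<open>H\<close> shows that w.h.p. every family of \<open>\<Omega>(n\<^sup>2)\<close> edges of \<open>G\<close> that is
  determined by \<open>M\<close> has \<open>\<Omega>(n\<^sup>2 p)\<close> members in \<open>H\<close> whose colours do not occur on \<open>M\<close>: the number
  of sets \<open>M\<close> is outweighed because \<open>n p \<rightarrow> \<infinity>\<close>. Such families can therefore be hit one edge after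
  another, always with a new colour and avoiding the \<open>O(n\<^sup>2 p)\<close> edges of the cycles already chosen.

  Hitting first the edges between all large pairs of vertex sets produces a rainbow set of \<open>O(n)\<close>
  edges that expands outside a small set \<open>L\<close> of vertices. The vertices of \<open>L\<close> receive disjoint
  rainbow stars in colours reserved for this purpose, so that the whole graph becomes a connected
  expander. By Posa's lemma many pairs of vertices are joined by longest paths. The Dirac condition
  gives a quadratic number of ways to rotate or extend such a path by one edge and then to close it
  by a second one; since the first edges alone are too few per pair, linearly many of them are
  chosen as temporary helpers before the closing edge is selected. Every such pair of edges
  lengthens the longest path or closes a Hamilton cycle.
\<close>

section \<open>Independent transversals and hitting sets\<close>

text \<open>The obstacle is that every choice is made by looking at \<open>H\<close>, so no
  randomness stays fresh. \<open>rich\<close> removes the dependence: target families are functions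
  of the exposed edges alone, the union bound covers every possible exposed set, and afterwards the
  construction is deterministic, so one \<open>H\<close> serves all cycles. The price is a number of
  cases exponential in \<open>n\<close>, which only families of quadratic size can pay for. Two
  ingredients are too small for this. A single pair of path ends has only about \<open>n\<close>
  useful first edges; they are replaced by edges that serve many pairs at once. A single vertex has
  only about \<open>n * p\<close> edges; the stars therefore come from a local argument in colours
  of their own, and only there, in union bounds over vertices and small sets of vertices, does
  \<open>n * p\<close> have to beat \<open>ln n\<close>. The set that needs stars depends on
  \<open>H\<close> as well, so the property behind the stars is required of all small sets.\<close>

definition indep_choices ::
    "('j \<Rightarrow> 'a set) \<Rightarrow> ('j \<times> 'a \<Rightarrow> 'j \<times> 'a \<Rightarrow> bool) \<Rightarrow> 'j set \<Rightarrow> ('j \<Rightarrow> 'a) set" where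
  "indep_choices A cf S =
     {f \<in> PiE S A. \<forall>j\<in>S. \<forall>j'\<in>S. j \<noteq> j' \<longrightarrow> \<not> cf (j, f j) (j', f j')}"

lemma finite_indep_choices:
  assumes "finite S" "\<And>j. j \<in> S \<Longrightarrow> finite (A j)"
  shows "finite (indep_choices A cf S)"
proof (rule finite_subset)
  show "indep_choices A cf S \<subseteq> PiE S A" by (auto simp: indep_choices_def)
  show "finite (PiE S A)" using assms by (intro finite_PiE) auto
qed

text \<open>Rosenfeld's counting argument replaces the local lemma.\<close>
lemma card_indep_choices_step:
  fixes s :: real
  assumes J: "finite J" and A: "\<And>j. j \<in> J \<Longrightarrow> finite (A j)" "\<And>j. j \<in> J \<Longrightarrow> s \<le> card (A j)"
    and s: "s > 0"
    and cf: "\<And>j a. j \<in> J \<Longrightarrow> a \<in> A j \<Longrightarrow> card {x \<in> Sigma J A. cf (j, a) x} \<le> s / 4"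
    and sym: "\<And>x y. cf x y \<Longrightarrow> cf y x"
    and S: "S \<subseteq> J" "j \<in> J - S"
  shows "s * card (indep_choices A cf S) \<le> 2 * card (indep_choices A cf (insert j S))"
  using S
proof (induction "card S" arbitrary: S j rule: less_induct)
  case less
  define T where "T = indep_choices A cf"
  have finS: "finite S" using less.prems J finite_subset by blast
  have finT: "finite (T R)" if "R \<subseteq> J" for R
    unfolding T_def using that J A finite_subset by (intro finite_indep_choices) auto
  define X where "X = T S \<times> A j"
  define bad where "bad = {(f, a) \<in> X. \<exists>j'\<in>S. cf (j, a) (j', f j')}"
  define C where "C a = {x \<in> Sigma J A. cf (j, a) x}" for a
  have finC: "finite (C a)" for a unfolding C_def using J A by auto
  have finX: "finite X" unfolding X_def using finT less.prems A by auto
  \<comment> \<open>Deleting \<open>j'\<close> from a choice with \<open>f j' = a'\<close> is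
    injective, and by induction the choices on \<open>S - {j'}\<close> number at most
    \<open>2 / s\<close> times those on \<open>S\<close>. So a single option occurs in at most a
    \<open>2 / s\<close> share of the choices.\<close>
  have fibre: "s * card {f \<in> T S. f j' = a'} \<le> 2 * card (T S)" if j': "j' \<in> S" for j' a'
  proof -
    have "s * card {f \<in> T S. f j' = a'} \<le> s * card (T (S - {j'}))"
    proof (intro mult_left_mono, unfold of_nat_le_iff, rule card_inj_on_le)
      show "inj_on (\<lambda>f. restrict f (S - {j'})) {f \<in> T S. f j' = a'}"
      proof (rule inj_onI)
        fix f g assume f: "f \<in> {f \<in> T S. f j' = a'}" and g: "g \<in> {f \<in> T S. f j' = a'}"
          and eq: "restrict f (S - {j'}) = restrict g (S - {j'})"
        show "f = g"
        proof (rule ext)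
          fix x
          show "f x = g x"
          proof (cases "x \<in> S - {j'}")
            case True
            then show ?thesis using fun_cong[OF eq, of x] by simp
          next
            case False
            then show ?thesis using f g by (cases "x = j'") (auto simp: T_def indep_choices_def PiE_def extensional_def)
          qed
        qed
      qed
      show "(\<lambda>f. restrict f (S - {j'})) ` {f \<in> T S. f j' = a'} \<subseteq> T (S - {j'})"
        by (auto simp: T_def indep_choices_def PiE_def Pi_def)
      show "finite (T (S - {j'}))" using less.prems by (intro finT) auto
    qed (use s in auto)
    also have "\<dots> \<le> 2 * card (T (insert j' (S - {j'})))"
      unfolding T_def
    proof (rule less.hyps)
      show "card (S - {j'}) < card S" using j' finS by (meson card_Diff1_less)
    qed (use less.prems j' in auto)
    finally show ?thesis using j' by (simp add: insert_absorb)
  qed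
  have "bad \<subseteq> (\<Union>a\<in>A j. \<Union>(j', a')\<in>{x \<in> C a. fst x \<in> S}. {f \<in> T S. f j' = a'} \<times> {a})" (is "_ \<subseteq> ?R")
  proof
    fix x assume "x \<in> bad"
    then obtain f a j' where x: "x = (f, a)" "f \<in> T S" "a \<in> A j" "j' \<in> S" "cf (j, a) (j', f j')"
      by (auto simp: bad_def X_def)
    have "f j' \<in> A j'" using x by (auto simp: T_def indep_choices_def)
    then have "(j', f j') \<in> C a" using x less.prems by (auto simp: C_def)
    then show "x \<in> ?R" using x by force
  qed
  moreover have "finite ?R" using finT finC A less.prems by (auto intro!: finite_UN_I)
  ultimately have "card bad \<le> card ?R" by (rule card_mono[rotated])
  also have "\<dots> \<le> (\<Sum>a\<in>A j. card (\<Union>(j', a')\<in>{x \<in> C a. fst x \<in> S}. {f \<in> T S. f j' = a'} \<times> {a}))"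
    by (rule card_UN_le) (use A less.prems in auto)
  also have "\<dots> \<le> (\<Sum>a\<in>A j. \<Sum>(j', a')\<in>{x \<in> C a. fst x \<in> S}. card {f \<in> T S. f j' = a'})"
  proof (rule sum_mono)
    fix a assume "a \<in> A j"
    have "card (\<Union>(j', a')\<in>{x \<in> C a. fst x \<in> S}. {f \<in> T S. f j' = a'} \<times> {a})
       \<le> (\<Sum>x\<in>{x \<in> C a. fst x \<in> S}. card (case x of (j', a') \<Rightarrow> {f \<in> T S. f j' = a'} \<times> {a}))"
      by (rule card_UN_le) (use finC in auto)
    also have "\<dots> = (\<Sum>(j', a')\<in>{x \<in> C a. fst x \<in> S}. card {f \<in> T S. f j' = a'})"
      by (intro sum.cong) (auto simp: card_cartesian_product)
    finally show "card (\<Union>(j', a')\<in>{x \<in> C a. fst x \<in> S}. {f \<in> T S. f j' = a'} \<times> {a}) \<le> \<dots>" .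
  qed
  finally have "real (card bad) \<le> real (\<Sum>a\<in>A j. \<Sum>(j', a')\<in>{x \<in> C a. fst x \<in> S}. card {f \<in> T S. f j' = a'})"
    by linarith
  also have "\<dots> = (\<Sum>a\<in>A j. \<Sum>(j', a')\<in>{x \<in> C a. fst x \<in> S}. real (card {f \<in> T S. f j' = a'}))"
    by (simp add: case_prod_unfold)
  also have "\<dots> \<le> (\<Sum>a\<in>A j. \<Sum>(j', a')\<in>{x \<in> C a. fst x \<in> S}. 2 * card (T S) / s)"
    by (intro sum_mono) (use fibre s in \<open>auto simp: field_simps\<close>)
  \<comment> \<open>For each \<open>a\<close> at most \<open>s / 4\<close> options conflict, and
    each blocks a share of at most \<open>2 / s\<close> of \<open>T S\<close>. Hence at least half
    of the extensions survive.\<close>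
  also have "\<dots> \<le> (\<Sum>a\<in>A j. real (card (T S)) / 2)"
  proof (rule sum_mono)
    fix a assume a: "a \<in> A j"
    have "card {x \<in> C a. fst x \<in> S} \<le> card (C a)" using finC by (intro card_mono) auto
    also have "real (card (C a)) \<le> s / 4" unfolding C_def using cf a less.prems by auto
    finally have "card {x \<in> C a. fst x \<in> S} \<le> s / 4" by simp
    then have "card {x \<in> C a. fst x \<in> S} * (2 * card (T S) / s) \<le> s / 4 * (2 * card (T S) / s)"
      using s by (intro mult_right_mono) auto
    then show "(\<Sum>(j', a')\<in>{x \<in> C a. fst x \<in> S}. 2 * card (T S) / s) \<le> card (T S) / 2"
      using s by (simp add: case_prod_unfold)
  qed
  finally have bad: "real (card bad) \<le> card (A j) * (card (T S) / 2)" by simp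
  have "card (X - bad) \<le> card (T (insert j S))"
  proof (rule card_inj_on_le)
    show "inj_on (\<lambda>(f, a). f(j := a)) (X - bad)"
    proof (rule inj_onI, clarify)
      fix f a g b assume "(f, a) \<in> X" "(g, b) \<in> X" and eq: "f(j := a) = g(j := b)"
      then have fg: "f \<in> PiE S A" "g \<in> PiE S A" by (auto simp: X_def T_def indep_choices_def)
      have "a = b" using fun_cong[OF eq, of j] by simp
      moreover have "f = g"
      proof
        fix x show "f x = g x"
          using fun_cong[OF eq, of x] fg less.prems by (cases "x = j") (auto simp: PiE_def extensional_def)
      qed
      ultimately show "f = g \<and> a = b" by simp
    qed
    show "(\<lambda>(f, a). f(j := a)) ` (X - bad) \<subseteq> T (insert j S)"
    proof clarify
      fix f a assume fa: "(f, a) \<in> X" "(f, a) \<notin> bad"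
      have f: "f \<in> PiE S A" "\<And>i k. i \<in> S \<Longrightarrow> k \<in> S \<Longrightarrow> i \<noteq> k \<Longrightarrow> \<not> cf (i, f i) (k, f k)"
        and a: "a \<in> A j" using fa by (auto simp: X_def T_def indep_choices_def)
      have nb: "\<not> cf (j, a) (k, f k)" if "k \<in> S" for k using fa that by (auto simp: bad_def)
      have nb': "\<not> cf (k, f k) (j, a)" if "k \<in> S" for k using nb[OF that] sym by blast
      have "f(j := a) \<in> PiE (insert j S) A" using f a by (intro PiE_fun_upd) auto
      then show "f(j := a) \<in> T (insert j S)"
        unfolding T_def indep_choices_def using f nb nb' less.prems by auto
    qed
    show "finite (T (insert j S))" using less.prems by (intro finT) auto
  qed
  moreover have "card (X - bad) = card X - card bad"
    using finX by (intro card_Diff_subset) (auto simp: bad_def intro: finite_subset)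
  moreover have "card X = card (T S) * card (A j)" by (simp add: X_def card_cartesian_product)
  ultimately have "real (card (T S)) * card (A j) - card bad \<le> card (T (insert j S))"
    by (smt (verit) of_nat_diff of_nat_le_iff of_nat_mult diff_is_0_eq nat_le_linear of_nat_0_le_iff)
  with bad have "real (card (T S)) * card (A j) / 2 \<le> card (T (insert j S))" by (simp add: mult.commute)
  moreover have "s * real (card (T S)) \<le> card (A j) * real (card (T S))"
    using A less.prems by (intro mult_right_mono) auto
  ultimately show ?case unfolding T_def by (simp add: mult.commute)
qed

lemma independent_transversal:
  fixes s :: real
  assumes J: "finite J" and A: "\<And>j. j \<in> J \<Longrightarrow> finite (A j)" "\<And>j. j \<in> J \<Longrightarrow> s \<le> card (A j)"
    and s: "s > 0"
    and cf: "\<And>j a. j \<in> J \<Longrightarrow> a \<in> A j \<Longrightarrow> card {x \<in> Sigma J A. cf (j, a) x} \<le> s / 4"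
    and sym: "\<And>x y. cf x y \<Longrightarrow> cf y x"
  obtains f where "\<And>j. j \<in> J \<Longrightarrow> f j \<in> A j"
    "\<And>j j'. j \<in> J \<Longrightarrow> j' \<in> J \<Longrightarrow> j \<noteq> j' \<Longrightarrow> \<not> cf (j, f j) (j', f j')"
proof -
  have "card (indep_choices A cf S) > 0" if "S \<subseteq> J" for S
    using finite_subset[OF that J] that
  proof (induction S rule: finite_induct)
    case empty
    then show ?case by (simp add: indep_choices_def)
  next
    case (insert x S)
    have "0 < s * card (indep_choices A cf S)" using insert s by auto
    also have "\<dots> \<le> 2 * card (indep_choices A cf (insert x S))"
      by (rule card_indep_choices_step[where J = J, OF J A s]) (use insert cf sym in auto)
    finally show ?case by simp
  qed
  then obtain f where "f \<in> indep_choices A cf J" by (metis card_gt_0_iff equals0I subset_refl)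
  then show ?thesis by (intro that[of f]) (auto simp: indep_choices_def)
qed

text \<open>\<open>I l e\<close> is the set of resources that option \<open>e\<close> uses when
  \<open>l\<close> takes it; for the stars these are a leaf and a colour.\<close>

definition load :: "('l \<Rightarrow> 'e \<Rightarrow> 'i set) \<Rightarrow> 'l set \<Rightarrow> ('l \<Rightarrow> 'e set) \<Rightarrow> 'i \<Rightarrow> nat" where
  "load I L A i = card {x \<in> Sigma L A. i \<in> I (fst x) (snd x)}"

text \<open>Elements of \<open>L\<close> are peeled off, each being one that the hypothesis supplies
  for the current set, and each keeps only the options that are light for that set. A resource that
  is heavy for the current set is then avoided by the peeled element, so its load is that of the
  rest; a light one stays light even with full lists.\<close>

lemma balanced_sublists:
  fixes s \<Delta> :: real and I :: "'l \<Rightarrow> 'e \<Rightarrow> 'i set" and Av :: "'l \<Rightarrow> 'e set"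
  assumes "finite L" and fin: "\<And>l. l \<in> L \<Longrightarrow> finite (Av l)" and D: "\<Delta> \<ge> 0"
    and "\<And>L'. L' \<subseteq> L \<Longrightarrow> L' \<noteq> {} \<Longrightarrow>
           \<exists>l\<in>L'. s \<le> card {e \<in> Av l. \<forall>i\<in>I l e. load I L' Av i < \<Delta>}"
  shows "\<exists>A. (\<forall>l\<in>L. A l \<subseteq> Av l \<and> s \<le> card (A l)) \<and> (\<forall>i. load I L A i \<le> \<Delta>)"
  using assms(1) fin assms(4)
proof (induction "card L" arbitrary: L)
  case 0
  then show ?case using D by (simp add: load_def)
next
  case (Suc n)
  have ne: "L \<noteq> {}" using Suc.hyps(2) by auto
  obtain l0 where l0: "l0 \<in> L" "s \<le> card {e \<in> Av l0. \<forall>i\<in>I l0 e. load I L Av i < \<Delta>}"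
    using Suc.prems(3)[OF subset_refl ne] by blast
  have "\<exists>A. (\<forall>l\<in>L - {l0}. A l \<subseteq> Av l \<and> s \<le> card (A l)) \<and> (\<forall>i. load I (L - {l0}) A i \<le> \<Delta>)"
  proof (rule Suc.hyps(1))
    show "n = card (L - {l0})" using Suc.hyps(2) Suc.prems(1) l0 by simp
  next
    fix L' assume "L' \<subseteq> L - {l0}" "L' \<noteq> {}"
    then show "\<exists>l\<in>L'. s \<le> card {e \<in> Av l. \<forall>i\<in>I l e. load I L' Av i < \<Delta>}"
      by (intro Suc.prems(3)) auto
  qed (use Suc.prems in auto)
  then obtain A where A: "\<And>l. l \<in> L - {l0} \<Longrightarrow> A l \<subseteq> Av l \<and> s \<le> card (A l)"
    "\<And>i. load I (L - {l0}) A i \<le> \<Delta>" by blast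
  define B where "B = A(l0 := {e \<in> Av l0. \<forall>i\<in>I l0 e. load I L Av i < \<Delta>})"
  have sub: "B l \<subseteq> Av l" if "l \<in> L" for l using A that by (auto simp: B_def)
  have finAv: "finite (Sigma L Av)" using Suc.prems by auto
  have "load I L B i \<le> \<Delta>" for i
  proof (cases "load I L Av i < \<Delta>")
    case True
    have "load I L B i \<le> load I L Av i"
      unfolding load_def using sub by (intro card_mono finite_subset[OF _ finAv]) auto
    then show ?thesis using True by linarith
  next
    case False
    have "finite {x \<in> Sigma (L - {l0}) A. i \<in> I (fst x) (snd x)}"
      using A by (intro finite_subset[OF _ finAv]) auto
    then have "load I L B i \<le> load I (L - {l0}) A i"
      unfolding load_def using False by (intro card_mono) (auto simp: B_def split: if_splits)
    then show ?thesis using A(2)[of i] by linarith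
  qed
  moreover have "B l \<subseteq> Av l \<and> s \<le> card (B l)" if "l \<in> L" for l
    using A(1)[of l] l0 that by (auto simp: B_def)
  ultimately show ?case by blast
qed

text \<open>Double counting of hits. Edges with fewer than half of \<open>g * card U / N\<close>
  hits carry at most half of the guaranteed \<open>g * card U\<close> hits, and each remaining edge
  carries at most \<open>m\<close>.\<close>

lemma many_good_hitters:
  fixes g N m :: real
  assumes fin: "finite E" "finite U" and N: "card E \<le> N" "N > 0" and g: "g \<ge> 0"
    and \<Gamma>: "\<And>u. u \<in> U \<Longrightarrow> g \<le> card {e \<in> E. e \<in> \<Gamma> u}"
    and m: "\<And>e. e \<in> E \<Longrightarrow> card {u \<in> U. e \<in> \<Gamma> u} \<le> m" and m0: "m \<ge> 0"
  shows "g * card U / 2 \<le> m * card {e \<in> E. g / (2 * N) * card U \<le> card {u \<in> U. e \<in> \<Gamma> u}}"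
proof -
  let ?h = "\<lambda>e. real (card {u \<in> U. e \<in> \<Gamma> u})"
  let ?G = "{e \<in> E. g / (2 * N) * card U \<le> ?h e}"
  have "g * card U \<le> (\<Sum>u\<in>U. real (card {e \<in> E. e \<in> \<Gamma> u}))"
    using sum_mono[of U "\<lambda>_. g", OF \<Gamma>] by (simp add: mult.commute)
  also have "\<dots> = (\<Sum>u\<in>U. \<Sum>e\<in>E. if e \<in> \<Gamma> u then 1 else 0)"
    using fin by (intro sum.cong) (simp_all add: sum.If_cases Int_def)
  also have "\<dots> = (\<Sum>e\<in>E. ?h e)"
    by (subst sum.swap) (use fin in \<open>simp add: sum.If_cases Int_def\<close>)
  also have "\<dots> = (\<Sum>e\<in>?G. ?h e) + (\<Sum>e\<in>E - ?G. ?h e)"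
    using fin by (subst sum.subset_diff[of ?G E]) auto
  also have "(\<Sum>e\<in>?G. ?h e) \<le> (\<Sum>e\<in>?G. m)" using m by (intro sum_mono) auto
  also have "(\<Sum>e\<in>E - ?G. ?h e) \<le> (\<Sum>e\<in>E - ?G. g / (2 * N) * card U)"
    by (intro sum_mono) auto
  also have "\<dots> \<le> (\<Sum>e\<in>E. g / (2 * N) * card U)"
    using fin g N by (intro sum_mono2) auto
  also have "\<dots> = card E * (g / (2 * N) * card U)" by simp
  also have "\<dots> \<le> N * (g / (2 * N) * card U)" using g N by (intro mult_right_mono) auto
  also have "\<dots> = g * card U / 2" using N by simp
  finally show ?thesis by (simp add: mult.commute)
qed

section \<open>Paths and rotations\<close>

definition nbhd :: "'a set set \<Rightarrow> 'a set \<Rightarrow> 'a set" where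
  "nbhd F S = {v. \<exists>u\<in>S. {u, v} \<in> F} - S"

definition is_path :: "'a set set \<Rightarrow> 'a list \<Rightarrow> bool" where
  "is_path F xs \<longleftrightarrow> xs \<noteq> [] \<and> distinct xs \<and> successively (\<lambda>u v. {u, v} \<in> F) xs"

definition longest_path :: "'a set \<Rightarrow> 'a set set \<Rightarrow> 'a list \<Rightarrow> bool" where
  "longest_path V F xs \<longleftrightarrow> is_path F xs \<and> set xs \<subseteq> V \<and>
     (\<forall>ys. is_path F ys \<longrightarrow> set ys \<subseteq> V \<longrightarrow> length ys \<le> length xs)"

definition cut_connected :: "'a set \<Rightarrow> 'a set set \<Rightarrow> bool" where
  "cut_connected V F \<longleftrightarrow>
     (\<forall>X\<subseteq>V. X \<noteq> {} \<longrightarrow> X \<noteq> V \<longrightarrow> (\<exists>u\<in>X. \<exists>v\<in>V - X. {u, v} \<in> F))"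

lemma is_path_append:
  "is_path F (xs @ ys) \<longleftrightarrow>
     xs @ ys \<noteq> [] \<and> (xs \<noteq> [] \<longrightarrow> is_path F xs) \<and> (ys \<noteq> [] \<longrightarrow> is_path F ys) \<and>
     set xs \<inter> set ys = {} \<and> (xs \<noteq> [] \<longrightarrow> ys \<noteq> [] \<longrightarrow> {last xs, hd ys} \<in> F)"
  by (auto simp: is_path_def successively_append_iff)

lemma is_path_single [simp]: "is_path F [x]"
  by (simp add: is_path_def)

lemma is_path_Cons:
  "is_path F (x # xs) \<longleftrightarrow> xs = [] \<or> (is_path F xs \<and> x \<notin> set xs \<and> {x, hd xs} \<in> F)"
  by (auto simp: is_path_def successively_Cons)

lemma is_path_rev [simp]: "is_path F (rev xs) = is_path F xs"
  by (simp add: is_path_def insert_commute)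

lemma is_path_mono: "is_path F xs \<Longrightarrow> F \<subseteq> F' \<Longrightarrow> is_path F' xs"
  by (auto simp: is_path_def intro: successively_mono)

lemma longest_path_rev: "longest_path V F xs \<Longrightarrow> longest_path V F (rev xs)"
  by (simp add: longest_path_def)

lemma longest_path_exists:
  assumes "finite V" "V \<noteq> {}"
  obtains xs where "longest_path V F xs"
proof -
  let ?P = "\<lambda>xs. is_path F xs \<and> set xs \<subseteq> V"
  obtain v where "v \<in> V" using assms by auto
  then have "?P [v]" by simp
  moreover have "\<forall>xs. ?P xs \<longrightarrow> length xs < Suc (card V)"
    using assms by (auto simp: is_path_def less_Suc_eq_le) (metis card_mono distinct_card)
  ultimately obtain xs where "?P xs" "\<forall>ys. ?P ys \<longrightarrow> length ys \<le> length xs"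
    using ex_has_greatest_nat[of ?P "[v]" length "Suc (card V)"] by (metis less_imp_le)
  then show ?thesis by (intro that) (auto simp: longest_path_def)
qed

section \<open>Edges of a path\<close>

fun path_edges :: "'a list \<Rightarrow> 'a set set" where
  "path_edges (a # b # xs) = insert {a, b} (path_edges (b # xs))"
| "path_edges _ = {}"

lemma path_edges_Cons:
  "path_edges (a # xs) = (if xs = [] then {} else insert {a, hd xs} (path_edges xs))"
  by (cases xs) auto

lemma path_edges_append:
  "path_edges (xs @ ys) = path_edges xs \<union> path_edges ys \<union>
     (if xs \<noteq> [] \<and> ys \<noteq> [] then {{last xs, hd ys}} else {})"
  by (induction xs) (simp_all add: path_edges_Cons Un_insert_left insert_commute Un_commute)

lemma path_edges_rev [simp]: "path_edges (rev xs) = path_edges xs"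
proof (induction xs)
  case (Cons a xs)
  have "{hd xs, a} = {a, hd xs}" by auto
  with Cons show ?case by (simp add: path_edges_append path_edges_Cons last_rev)
qed simp

lemma path_edges_subset: "e \<in> path_edges xs \<Longrightarrow> e \<subseteq> set xs"
  by (induction xs rule: path_edges.induct) auto

lemma path_edges_at:
  assumes "distinct (as @ y # bs)" "{v, y} \<in> path_edges (as @ y # bs)"
  shows "(as \<noteq> [] \<and> v = last as) \<or> (bs \<noteq> [] \<and> v = hd bs)"
proof -
  have "{v, y} \<notin> path_edges as" "{v, y} \<notin> path_edges bs"
    using assms(1) path_edges_subset by fastforce+
  then show ?thesis
    using assms by (auto simp: path_edges_append path_edges_Cons doubleton_eq_iff split: if_splits)
qed

lemma card_path_nbrs:
  assumes "distinct xs" "finite R"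
  shows "finite {v. \<exists>y\<in>R. {v, y} \<in> path_edges xs}"
    and "card {v. \<exists>y\<in>R. {v, y} \<in> path_edges xs} \<le> 2 * card R"
proof -
  let ?N = "\<lambda>y. {v. {v, y} \<in> path_edges xs}"
  have N: "finite (?N y) \<and> card (?N y) \<le> 2" for y
  proof (cases "y \<in> set xs")
    case True
    then obtain as bs where xs: "xs = as @ y # bs" by (meson split_list)
    have sub: "?N y \<subseteq> {last as, hd bs}"
      using path_edges_at[of as y bs] assms(1) unfolding xs by blast
    then have "card (?N y) \<le> card {last as, hd bs}" by (intro card_mono) auto
    also have "\<dots> \<le> 2" by (simp add: card_insert_if)
    finally show ?thesis using finite_subset[OF sub] by simp
  next
    case False
    then have "?N y = {}" using path_edges_subset[of "{_, y}" xs] by blast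
    then show ?thesis by simp
  qed
  have eq: "{v. \<exists>y\<in>R. {v, y} \<in> path_edges xs} = (\<Union>y\<in>R. ?N y)" by blast
  show "finite {v. \<exists>y\<in>R. {v, y} \<in> path_edges xs}"
    unfolding eq using N assms(2) by blast
  have "card (\<Union>y\<in>R. ?N y) \<le> (\<Sum>y\<in>R. card (?N y))" using assms(2) by (rule card_UN_le)
  also have "\<dots> \<le> (\<Sum>y\<in>R. 2)" by (intro sum_mono) (use N in blast)
  finally show "card {v. \<exists>y\<in>R. {v, y} \<in> path_edges xs} \<le> 2 * card R" unfolding eq by simp
qed

text \<open>Posa rotations with the first vertex fixed: the chord from the last vertex to
  \<open>z\<close> replaces the edge from \<open>z\<close> to \<open>hd bs\<close>, and
  \<open>hd bs\<close> becomes the last vertex.\<close>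

inductive_set rotations :: "'a set set \<Rightarrow> 'a list \<Rightarrow> 'a list set" for F xs where
  base: "xs \<in> rotations F xs"
| rotate: "as @ z # bs \<in> rotations F xs \<Longrightarrow> bs \<noteq> [] \<Longrightarrow> {z, last bs} \<in> F
    \<Longrightarrow> as @ z # rev bs \<in> rotations F xs"

lemma is_path_rotate:
  assumes "is_path F (as @ z # bs)" "bs \<noteq> []" "{z, last bs} \<in> F"
  shows "is_path F (as @ z # rev bs)"
proof -
  have "is_path F ((as @ [z]) @ bs)" using assms by simp
  note p = this[unfolded is_path_append[of F "as @ [z]" bs]]
  have "is_path F ((as @ [z]) @ rev bs)"
    unfolding is_path_append[of F "as @ [z]" "rev bs"]
    using p assms(2,3) by (simp add: hd_rev)
  then show ?thesis by simp
qed

lemma rotations_path: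
  assumes "q \<in> rotations F xs" "is_path F xs"
  shows "is_path F q \<and> set q = set xs \<and> length q = length xs \<and> hd q = hd xs"
  using assms(1)
proof induction
  case base
  then show ?case using assms by simp
next
  case (rotate as z bs)
  then have "is_path F (as @ z # rev bs)" by (intro is_path_rotate) auto
  moreover have "hd (as @ z # rev bs) = hd (as @ z # bs)" by (cases as) auto
  moreover have "set (as @ z # rev bs) = set (as @ z # bs)" by simp
  moreover have "length (as @ z # rev bs) = length (as @ z # bs)" by simp
  ultimately show ?case using rotate.IH by metis
qed

text \<open>The only edge lost in a rotation is \<open>{z, hd bs}\<close>, and \<open>hd bs\<close>
  is the end of the rotated path. So every edge ever lost contains an end reached by
  rotations.\<close>

lemma rotations_keep_edges:
  assumes "q \<in> rotations F xs" "e \<in> path_edges xs"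
  shows "e \<in> path_edges q \<or> (\<exists>y\<in>last ` rotations F xs. y \<in> e)"
  using assms(1)
proof induction
  case base
  then show ?case using assms by simp
next
  case (rotate as z bs)
  have "as @ z # rev bs \<in> rotations F xs" using rotate rotations.rotate by metis
  moreover have "last (as @ z # rev bs) = hd bs" using rotate by (simp add: last_rev)
  ultimately have "hd bs \<in> last ` rotations F xs" by (metis imageI)
  moreover have "e \<in> path_edges (as @ z # rev bs)"
    if "e \<in> path_edges (as @ z # bs)" "e \<noteq> {z, hd bs}"
  proof -
    have "e \<in> path_edges as \<union> path_edges bs \<union> (if as \<noteq> [] then {{last as, z}} else {})"
      using that rotate.hyps(2) by (auto simp: path_edges_append path_edges_Cons split: if_splits)
    then show ?thesis by (auto simp: path_edges_append path_edges_Cons split: if_splits)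
  qed
  ultimately show ?case using rotate.IH by blast
qed

text \<open>Posa's lemma. Maximality puts a neighbour of an end on the path; if it is no end itself,
  comparing its path edges before and after the rotations shows that it was next to an end already
  in \<open>xs\<close>.\<close>

lemma rotation_ends_nbhd:
  assumes xs: "longest_path V F xs" and F: "\<And>e. e \<in> F \<Longrightarrow> e \<subseteq> V"
  defines "R \<equiv> last ` rotations F xs"
  shows "nbhd F R \<subseteq> {v. \<exists>y\<in>R. {v, y} \<in> path_edges xs}"
proof
  fix z assume "z \<in> nbhd F R"
  then obtain q where q: "q \<in> rotations F xs" "{last q, z} \<in> F" and zR: "z \<notin> R"
    by (auto simp: nbhd_def R_def)
  have path: "is_path F xs" using xs by (simp add: longest_path_def)
  note qp = rotations_path[OF q(1) path]
  have V: "set q \<subseteq> V" "z \<in> V" using qp xs F[OF q(2)] by (auto simp: longest_path_def)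
  have "z \<in> set q"
  proof (rule ccontr)
    assume "z \<notin> set q"
    then have "is_path F (q @ [z])" using qp q by (subst is_path_append) auto
    moreover have "set (q @ [z]) \<subseteq> V" using V by simp
    ultimately have "length (q @ [z]) \<le> length xs" using xs unfolding longest_path_def by blast
    then show False using qp by simp
  qed
  then obtain as bs where qs: "q = as @ z # bs" by (meson split_list)
  have "bs \<noteq> []"
  proof
    assume "bs = []"
    then have "z = last q" using qs by simp
    then show False using zR q(1) unfolding R_def by blast
  qed
  have "as @ z # rev bs \<in> rotations F xs"
    using q qs \<open>bs \<noteq> []\<close> by (intro rotations.rotate) (auto simp: insert_commute)
  moreover have "last (as @ z # rev bs) = hd bs" using \<open>bs \<noteq> []\<close> by (simp add: last_rev)
  ultimately have wR: "hd bs \<in> R" unfolding R_def by (metis imageI)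
  \<comment> \<open>An edge of \<open>xs\<close> at \<open>z\<close> either was lost, and then its
    other vertex is in \<open>R\<close> because \<open>z\<close> is not, or it survives in
    \<open>q\<close>, where \<open>z\<close> is adjacent only to \<open>last as\<close> and
    \<open>hd bs\<close>.\<close>
  have keep: "v \<in> R \<or> v = hd bs \<or> (as \<noteq> [] \<and> v = last as)" if "{v, z} \<in> path_edges xs" for v
  proof -
    have "{v, z} \<in> path_edges q \<or> (\<exists>y\<in>R. y \<in> {v, z})"
      using rotations_keep_edges[OF q(1) that] by (simp add: R_def)
    moreover have "distinct (as @ z # bs)" using qp qs by (auto simp: is_path_def)
    ultimately show ?thesis using path_edges_at[of as z bs v] zR qs by auto
  qed
  have "z \<in> set xs" using qp \<open>z \<in> set q\<close> by simp
  then obtain cs ds where xss: "xs = cs @ z # ds" by (meson split_list)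
  have dx: "distinct xs" using path by (simp add: is_path_def)
  have "xs \<in> rotations F xs" by (rule rotations.base)
  then have "ds \<noteq> []" using zR xss by (auto simp: R_def image_iff)
  then have e1: "{hd ds, z} \<in> path_edges xs"
    by (auto simp: xss path_edges_append path_edges_Cons insert_commute)
  have "hd ds \<in> R \<or> as \<noteq> [] \<and> hd ds = last as" using keep[OF e1] wR by metis
  then consider "hd ds \<in> R" | "as \<noteq> []" "hd ds = last as" by blast
  then show "z \<in> {v. \<exists>y\<in>R. {v, y} \<in> path_edges xs}"
  proof cases
    case 1
    then show ?thesis using e1 by (auto simp: insert_commute)
  next
    case 2
    \<comment> \<open>If the successor of \<open>z\<close> in \<open>xs\<close> is now
      \<open>last as\<close>, the predecessor must be in \<open>R\<close>. A predecessor exists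
      because rotations fix the first vertex and \<open>z\<close> is not first in
      \<open>q\<close>.\<close>
    have "hd q = hd xs" using qp by simp
    then have "cs \<noteq> []"
      using 2 qs xss qp by (cases cs; cases as) (auto simp: is_path_def)
    then have e2: "{last cs, z} \<in> path_edges xs"
      by (auto simp: xss path_edges_append)
    have "last cs \<noteq> hd ds" using dx xss \<open>cs \<noteq> []\<close> \<open>ds \<noteq> []\<close>
      by (metis disjoint_iff distinct_append hd_in_set last_in_set list.set_intros(2))
    then have "last cs \<in> R" using keep[OF e2] 2 wR by auto
    then show ?thesis using e2 by (auto simp: insert_commute)
  qed
qed

text \<open>The ends reached by rotations have at most twice as many neighbours, all next to them on
  the path. Threefold expansion of sets up to size \<open>g\<close> therefore forces more than
  \<open>g\<close> ends.\<close>

lemma posa_many_ends: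
  fixes g :: real
  assumes "finite V" and xs: "longest_path V F xs" and F: "\<And>e. e \<in> F \<Longrightarrow> e \<subseteq> V"
    and exp: "\<And>S. S \<subseteq> V \<Longrightarrow> S \<noteq> {} \<Longrightarrow> card S \<le> g \<Longrightarrow> 3 * card S \<le> card (nbhd F S)"
  shows "g < card {y. \<exists>q. longest_path V F q \<and> set q = set xs \<and> hd q = hd xs \<and> last q = y}"
    and "g < length xs"
proof -
  define R where "R = last ` rotations F xs"
  have path: "is_path F xs" using xs by (simp add: longest_path_def)
  have rot: "longest_path V F q \<and> set q = set xs \<and> hd q = hd xs" if "q \<in> rotations F xs" for q
    using rotations_path[OF that path] xs by (simp add: longest_path_def)
  have RV: "R \<subseteq> set xs"
  proof
    fix y assume "y \<in> R"
    then obtain q where q: "q \<in> rotations F xs" "y = last q" by (auto simp: R_def)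
    then show "y \<in> set xs" using rotations_path[OF q(1) path] by (metis is_path_def last_in_set)
  qed
  then have finR: "finite R" using finite_subset by blast
  have "R \<noteq> {}" using rotations.base by (auto simp: R_def)
  have "\<not> card R \<le> g"
  proof
    assume "card R \<le> g"
    then have "3 * card R \<le> card (nbhd F R)"
      using RV xs \<open>R \<noteq> {}\<close> unfolding longest_path_def by (intro exp) (blast, simp_all)
    also have "card (nbhd F R) \<le> card {v. \<exists>y\<in>R. {v, y} \<in> path_edges xs}"
      unfolding R_def
      by (intro card_mono card_path_nbrs rotation_ends_nbhd[OF xs F])
        (use path finR in \<open>simp_all add: is_path_def R_def\<close>)
    also have "\<dots> \<le> 2 * card R"
      using path finR by (intro card_path_nbrs) (simp_all add: is_path_def)
    finally show False using \<open>R \<noteq> {}\<close> finR by simp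
  qed
  then have g: "g < card R" by simp
  let ?S = "{y. \<exists>q. longest_path V F q \<and> set q = set xs \<and> hd q = hd xs \<and> last q = y}"
  have "?S \<subseteq> set xs"
  proof
    fix y assume "y \<in> ?S"
    then obtain q where q: "longest_path V F q" "set q = set xs" "last q = y" by blast
    then have "q \<noteq> []" by (simp add: longest_path_def is_path_def)
    then show "y \<in> set xs" using q last_in_set by metis
  qed
  then have "finite ?S" using finite_subset by blast
  moreover have "R \<subseteq> ?S" using rot unfolding R_def by blast
  ultimately have "card R \<le> card ?S" by (rule card_mono)
  then show "g < card ?S" using g by simp
  have "card R \<le> card (set xs)" using RV by (intro card_mono) auto
  also have "\<dots> \<le> length xs" by (rule card_length)
  finally show "g < length xs" using g by simp
qed

section \<open>Closing and lengthening paths\<close>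

lemma cycle_edges_subset:
  assumes "is_path F xs" "{last xs, hd xs} \<in> F"
  shows "cycle_edges xs \<subseteq> F"
proof -
  have step: "{xs ! i, xs ! Suc i} \<in> F" if "Suc i < length xs" for i
  proof -
    have "xs = take (Suc i) xs @ drop (Suc i) xs" by simp
    moreover have "take (Suc i) xs \<noteq> []" "drop (Suc i) xs \<noteq> []" using that by auto
    ultimately have "{last (take (Suc i) xs), hd (drop (Suc i) xs)} \<in> F"
      using assms(1) is_path_append[of F "take (Suc i) xs" "drop (Suc i) xs"] by simp
    moreover have "last (take (Suc i) xs) = xs ! i"
      using that by (simp add: take_Suc_conv_app_nth)
    ultimately show ?thesis using that by (simp add: hd_drop_conv_nth)
  qed
  have "xs \<noteq> []" using assms by (simp add: is_path_def)
  have "{xs ! i, xs ! (Suc i mod length xs)} \<in> F" if "i < length xs" for i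
  proof (cases "Suc i = length xs")
    case True
    then have "i = length xs - 1" by simp
    then show ?thesis using assms(2) \<open>xs \<noteq> []\<close> by (simp add: last_conv_nth hd_conv_nth)
  next
    case False
    then show ?thesis using step[of i] that by simp
  qed
  then show ?thesis by (auto simp: cycle_edges_def)
qed

text \<open>If the cycle closed by \<open>cl\<close> misses a vertex, connectivity gives an edge
  from some \<open>u\<close> on it to an outside vertex \<open>v\<close>; the cycle is cut open
  behind \<open>u\<close> and \<open>v\<close> is appended.\<close>

lemma close_path:
  assumes con: "cut_connected V F" and xs: "is_path F xs" "set xs \<subseteq> V" "3 \<le> length xs"
    and cl: "{last xs, hd xs} \<in> F"
  shows "(\<exists>vs. distinct vs \<and> set vs = V \<and> 3 \<le> length vs \<and> cycle_edges vs \<subseteq> F) \<or>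
    (\<exists>ys. is_path F ys \<and> set ys \<subseteq> V \<and> length xs < length ys)"
proof (cases "set xs = V")
  case True
  then show ?thesis using cycle_edges_subset[OF xs(1) cl] xs by (auto simp: is_path_def)
next
  case False
  have "xs \<noteq> []" using xs by auto
  then obtain u v where uv: "u \<in> set xs" "v \<in> V - set xs" "{u, v} \<in> F"
    using con[unfolded cut_connected_def, rule_format, of "set xs"] False xs(2) by auto
  obtain as bs where s: "xs = as @ u # bs" using uv by (meson split_list)
  have "is_path F ((as @ [u]) @ bs)" using xs s by simp
  note p = this[unfolded is_path_append[of F "as @ [u]" bs]]
  have c: "hd xs = hd (as @ [u])" unfolding s by (cases as) auto
  have "is_path F (bs @ as @ [u])"
    unfolding is_path_append[of F bs "as @ [u]"] using p cl c by (auto simp: s)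
  then have "is_path F ((bs @ as @ [u]) @ [v])"
    unfolding is_path_append[of F "bs @ as @ [u]" "[v]"] using uv s by auto
  then have "is_path F ((bs @ as @ [u]) @ [v]) \<and> set ((bs @ as @ [u]) @ [v]) \<subseteq> V \<and>
      length xs < length ((bs @ as @ [u]) @ [v])"
    using uv xs s by auto
  then show ?thesis by blast
qed

text \<open>\<open>succ_in P z\<close> names the end created by adding \<open>{last P, z}\<close>:
  the successor of \<open>z\<close> after a rotation, and \<open>z\<close> itself if
  \<open>z\<close> lies off the path and extends it. The default value makes one formula cover both
  cases.\<close>

fun succ_in :: "'a list \<Rightarrow> 'a \<Rightarrow> 'a" where
  "succ_in (a # b # xs) z = (if a = z then b else succ_in (b # xs) z)"
| "succ_in _ z = z"

lemma succ_in_notin [simp]: "z \<notin> set xs \<Longrightarrow> succ_in xs z = z"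
  by (induction xs z rule: succ_in.induct) auto

lemma succ_in_append:
  "distinct (as @ z # bs) \<Longrightarrow> succ_in (as @ z # bs) z = (if bs = [] then z else hd bs)"
proof (induction as)
  case Nil
  then show ?case by (cases bs) auto
next
  case (Cons a as)
  then show ?case by (cases as) simp_all
qed

lemma succ_in_split:
  assumes "distinct xs" "z \<in> set xs" "z \<noteq> last xs"
  obtains as bs where "xs = as @ z # succ_in xs z # bs"
proof -
  obtain as cs where s: "xs = as @ z # cs" using assms by (meson split_list)
  then have "cs \<noteq> []" using assms by auto
  then have "succ_in xs z = hd cs" using succ_in_append[of as z cs] assms s by simp
  then have "xs = as @ z # succ_in xs z # tl cs" using s \<open>cs \<noteq> []\<close> by simp
  then show ?thesis using that by blast
qed

text \<open>Distinct neighbours of a path end thus give distinct new ends, so degrees survive the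
  passage to successors. Vertices off the path are fixed and the others stay on it; the last vertex
  is left out because it is mapped to itself and would collide with its predecessor.\<close>

lemma inj_on_succ_in:
  assumes "distinct xs" "xs \<noteq> []"
  shows "inj_on (succ_in xs) (- {last xs})"
proof (rule inj_onI)
  fix a b assume a: "a \<in> - {last xs}" and b: "b \<in> - {last xs}" and eq: "succ_in xs a = succ_in xs b"
  have mem: "succ_in xs z \<in> set xs \<longleftrightarrow> z \<in> set xs" if nl: "z \<noteq> last xs" for z
  proof (cases "z \<in> set xs")
    case True
    then obtain as bs where "xs = as @ z # succ_in xs z # bs" using succ_in_split[of xs z] nl assms by metis
    then have "succ_in xs z \<in> set xs" by (metis in_set_conv_decomp append_Cons append_assoc append_Nil)
    then show ?thesis using True by simp
  qed simp
  show "a = b"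
  proof (cases "a \<in> set xs")
    case False
    then show ?thesis using mem a b eq by auto
  next
    case True
    then have "b \<in> set xs" using mem[of a] mem[of b] a b eq by simp
    obtain as bs where s: "xs = as @ a # succ_in xs a # bs" using succ_in_split[of xs a] True a assms by auto
    obtain cs ds where t: "xs = cs @ b # succ_in xs b # ds"
      using succ_in_split[of xs b] \<open>b \<in> set xs\<close> b assms by auto
    have d1: "succ_in xs a \<notin> set (as @ [a]) \<union> set bs"
      using assms(1) by (subst (asm) s) auto
    have "succ_in xs a \<notin> set (cs @ [b]) \<union> set ds"
      using assms(1) eq by (subst (asm) t) auto
    moreover have "(as @ [a]) @ succ_in xs a # bs = (cs @ [b]) @ succ_in xs a # ds" using s t eq by simp
    ultimately have "as @ [a] = cs @ [b]"
      using append_Cons_eq_iff[of "succ_in xs a" "as @ [a]" bs "cs @ [b]" ds] d1 by blast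
    then show ?thesis by simp
  qed
qed

text \<open>The first edge extends \<open>P\<close> by \<open>z\<close> or rotates it at
  \<open>z\<close>. After a rotation the second edge joins the two ends, and
  \<open>close_path\<close> applies.\<close>

lemma booster_lengthens:
  assumes con: "cut_connected V F" and P: "longest_path V F P" "3 \<le> length P"
    and z: "z \<in> V" "z \<noteq> last P"
    and F': "F \<subseteq> F'" "{last P, z} \<in> F'" "{hd P, succ_in P z} \<in> F'"
  shows "(\<exists>vs. distinct vs \<and> set vs = V \<and> 3 \<le> length vs \<and> cycle_edges vs \<subseteq> F') \<or>
    (\<exists>ys. is_path F' ys \<and> set ys \<subseteq> V \<and> length P < length ys)"
proof -
  have PV: "set P \<subseteq> V" and path: "is_path F' P"
    using P F' by (auto simp: longest_path_def intro: is_path_mono)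
  show ?thesis
  proof (cases "z \<in> set P")
    case False
    have "P \<noteq> []" using P by auto
    then have "is_path F' (P @ [z])" using path False F' by (subst is_path_append) auto
    moreover have "set (P @ [z]) \<subseteq> V" "length P < length (P @ [z])" using PV z by auto
    ultimately show ?thesis by blast
  next
    case True
    then obtain as bs where s: "P = as @ z # succ_in P z # bs"
      using succ_in_split[of P z] z path by (auto simp: is_path_def)
    let ?q = "as @ z # rev (succ_in P z # bs)"
    have "is_path F' ?q"
    proof (rule is_path_rotate)
      show "is_path F' (as @ z # succ_in P z # bs)" using path s by simp
      have "last (succ_in P z # bs) = last P" using arg_cong[OF s, of last] by simp
      then show "{z, last (succ_in P z # bs)} \<in> F'" using F'(2) by (simp add: insert_commute)
    qed simp
    moreover have "set ?q = set P" "length ?q = length P"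
      using arg_cong[OF s, of set] arg_cong[OF s, of length] by auto
    moreover have "hd ?q = hd P" using arg_cong[OF s, of hd] by (simp add: hd_append split: if_splits)
    moreover have "last ?q = succ_in P z" by simp
    moreover have "cut_connected V F'" using con F'(1) unfolding cut_connected_def by blast
    ultimately show ?thesis
      using close_path[of V F' ?q] PV P(2) F'(3) by (simp add: insert_commute)
  qed
qed

section \<open>Adaptive hitting in a Dirac graph\<close>

lemma card_doubleton_image:
  assumes "finite P"
  shows "card P \<le> 2 * card ((\<lambda>(x, y). {x, y}) ` P)"
proof -
  define f :: "'a \<times> 'a \<Rightarrow> 'a set" where "f = (\<lambda>(x, y). {x, y})"
  have fib: "card {p \<in> P. f p = e} \<le> 2" for e
  proof (cases "\<exists>x y. e = {x, y}")
    case True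
    then obtain x y where "e = {x, y}" by (elim exE)
    have "{p \<in> P. f p = e} \<subseteq> {(x, y), (y, x)}"
    proof
      fix p assume "p \<in> {p \<in> P. f p = e}"
      then have "{fst p, snd p} = {x, y}" using \<open>e = {x, y}\<close> by (simp add: f_def case_prod_unfold)
      then have "p = (x, y) \<or> p = (y, x)" unfolding doubleton_eq_iff by (metis prod.collapse)
      then show "p \<in> {(x, y), (y, x)}" by blast
    qed
    then have "card {p \<in> P. f p = e} \<le> card {(x, y), (y, x)}" by (intro card_mono) auto
    also have "\<dots> \<le> 2" by (cases "x = y") simp_all
    finally show ?thesis .
  next
    case False
    then have "{p \<in> P. f p = e} = {}" unfolding f_def by fast
    then show ?thesis by (metis card.empty le0)
  qed
  have "P = (\<Union>e\<in>f ` P. {p \<in> P. f p = e})" by blast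
  then have "card P = card (\<Union>e\<in>f ` P. {p \<in> P. f p = e})" by (rule arg_cong)
  also have "\<dots> \<le> (\<Sum>e\<in>f ` P. card {p \<in> P. f p = e})" using assms by (intro card_UN_le) simp
  also have "\<dots> \<le> (\<Sum>e\<in>f ` P. 2)" by (intro sum_mono fib)
  finally show ?thesis by (simp add: f_def)
qed

section \<open>Greedy hitting with new colours\<close>

definition unhit :: "'u set \<Rightarrow> ('u \<Rightarrow> 'e set) \<Rightarrow> 'e set \<Rightarrow> 'u set" where
  "unhit U \<Gamma> D = {u \<in> U. \<Gamma> u \<inter> D = {}}"

text \<open>\<open>\<theta>\<close> is relative to the targets still unhit, so each chosen edge
  shrinks their number by the factor \<open>1 - \<theta>\<close>.\<close>

definition hitters :: "'e set \<Rightarrow> real \<Rightarrow> 'u set \<Rightarrow> ('u \<Rightarrow> 'e set) \<Rightarrow> 'e set \<Rightarrow> 'e set" where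
  "hitters E \<theta> U \<Gamma> D =
     {e \<in> E. \<theta> * card (unhit U \<Gamma> D) \<le> card {u \<in> unhit U \<Gamma> D. e \<in> \<Gamma> u}}"

text \<open>The target sets \<open>\<tau>\<close> may depend on the set \<open>M\<close> exposed so far, which is what
  makes this property usable adaptively.\<close>
definition rich :: "real \<Rightarrow> real \<Rightarrow> real \<Rightarrow> nat \<Rightarrow> 'a edge_coloring \<Rightarrow>
    ('a set set \<Rightarrow> 'a set set \<Rightarrow> 'a set set) \<Rightarrow> bool" where
  "rich k m r c0 H \<tau> \<longleftrightarrow> (\<forall>M F. M \<subseteq> dom H \<longrightarrow> F \<subseteq> M \<longrightarrow> real (card M) \<le> k \<longrightarrow> m \<le> real (card (\<tau> F (M - F))) \<longrightarrow>
     r \<le> real (card {e \<in> \<tau> F (M - F). \<exists>j\<in>{1..c0}. H e = Some j \<and> Some j \<notin> H ` M}))"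

text \<open>\<open>rich\<close> speaks of one exposed set and a part \<open>F\<close> of it;
  disjointness recovers \<open>D\<close> as the rest. As \<open>R\<close> has fewer than
  \<open>r\<close> edges, it cannot cover all usable targets.\<close>

lemma rich_obtain:
  fixes k m r :: real
  assumes rich: "rich k m r c0 H \<tau>" and M: "F \<subseteq> dom H" "D \<subseteq> dom H" "F \<inter> D = {}" "card (F \<union> D) \<le> k"
    and big: "m \<le> card (\<tau> F D)" and R: "finite R" "card R < r"
  obtains e j where "e \<in> \<tau> F D" "e \<notin> R" "j \<in> {1..c0}" "H e = Some j" "Some j \<notin> H ` (F \<union> D)"
proof -
  have D: "F \<union> D - F = D" using M by blast
  let ?S = "{e \<in> \<tau> F D. \<exists>j\<in>{1..c0}. H e = Some j \<and> Some j \<notin> H ` (F \<union> D)}"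
  have sub: "F \<union> D \<subseteq> dom H" "F \<subseteq> F \<union> D" using M by simp_all
  have big': "m \<le> card (\<tau> F (F \<union> D - F))" using big D by simp
  have r: "r \<le> card ?S"
    using rich[unfolded rich_def, rule_format, OF sub M(4) big'] unfolding D .
  have "\<not> ?S \<subseteq> R"
  proof
    assume "?S \<subseteq> R"
    then have "card ?S \<le> card R" by (rule card_mono[OF R(1)])
    then show False using r R(2) by linarith
  qed
  then obtain e where "e \<in> ?S" "e \<notin> R" by blast
  then show ?thesis using that by blast
qed

text \<open>While more than \<open>thr\<close> targets are unhit, the hitters form a large family,
  and \<open>rich\<close> supplies one outside \<open>R\<close> with a new colour. The colours avoid
  those of \<open>F\<close> and each other, so any part of \<open>D\<close> can later be added to a
  rainbow \<open>F\<close>.\<close>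

lemma greedy_hitting:
  fixes U :: "'u set" and \<Gamma> :: "'u \<Rightarrow> 'a set set" and k m r thr \<theta> :: real
  assumes rich: "rich k m r c0 H \<tau>" and \<tau>: "\<And>D. \<tau> F D = hitters E \<theta> U \<Gamma> D"
    and fin: "finite U" "finite F" and F: "F \<subseteq> dom H" and R: "finite R" "card R < r"
    and big: "\<And>D. thr < card (unhit U \<Gamma> D) \<Longrightarrow> m \<le> card (hitters E \<theta> U \<Gamma> D)"
    and k: "card F + J \<le> k" and \<theta>: "0 \<le> \<theta>" "\<theta> \<le> 1"
  shows "\<exists>D. finite D \<and> D \<subseteq> dom H \<and> D \<subseteq> E \<and> D \<inter> R = {} \<and> D \<inter> F = {} \<and> card D \<le> J \<and>
    (\<forall>e\<in>D. \<exists>j\<in>{1..c0}. H e = Some j \<and> Some j \<notin> H ` F) \<and> inj_on H D \<and>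
    (card (unhit U \<Gamma> D) \<le> thr \<or> card (unhit U \<Gamma> D) \<le> (1 - \<theta>) ^ J * card U)"
  using k
proof (induction J)
  case 0
  have "unhit U \<Gamma> {} = U" by (simp add: unhit_def)
  then show ?case by (intro exI[of _ "{}"]) simp
next
  case (Suc J)
  have "card F + J \<le> k" using Suc.prems by simp
  from Suc.IH[OF this] obtain D where D: "finite D" "D \<subseteq> dom H" "D \<subseteq> E" "D \<inter> R = {}"
    "D \<inter> F = {}" "card D \<le> J"
    "\<forall>e\<in>D. \<exists>j\<in>{1..c0}. H e = Some j \<and> Some j \<notin> H ` F" "inj_on H D"
    "card (unhit U \<Gamma> D) \<le> thr \<or> card (unhit U \<Gamma> D) \<le> (1 - \<theta>) ^ J * card U"
    by (elim exE conjE)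
  show ?case
  proof (cases "card (unhit U \<Gamma> D) \<le> thr")
    case True
    have "card D \<le> Suc J" using D(6) by simp
    with D True show ?thesis by (intro exI[of _ D] conjI) (simp_all only: disjI1)
  next
    case False
    have "card (F \<union> D) \<le> card F + card D" by (rule card_Un_le)
    then have c: "card (F \<union> D) \<le> k" using D(6) Suc.prems by linarith
    have d: "F \<inter> D = {}" using D(5) by blast
    have m: "m \<le> card (\<tau> F D)" using big[of D] False unfolding \<tau> by simp
    obtain e j where e: "e \<in> \<tau> F D" "e \<notin> R" "j \<in> {1..c0}" "H e = Some j"
      "Some j \<notin> H ` (F \<union> D)"
      by (rule rich_obtain[OF rich F D(2) d c m R])
    have e1: "e \<in> hitters E \<theta> U \<Gamma> D" using e(1) unfolding \<tau> .
    let ?D = "insert e D"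
    have eFD: "e \<notin> F \<union> D" using e by (metis imageI)
    have "unhit U \<Gamma> ?D = unhit U \<Gamma> D - {u \<in> unhit U \<Gamma> D. e \<in> \<Gamma> u}"
      by (auto simp: unhit_def)
    moreover have fu: "finite (unhit U \<Gamma> D)" using fin by (simp add: unhit_def)
    moreover have "card {u \<in> unhit U \<Gamma> D. e \<in> \<Gamma> u} \<le> card (unhit U \<Gamma> D)"
      by (rule card_mono[OF fu]) blast
    ultimately have "real (card (unhit U \<Gamma> ?D))
        = real (card (unhit U \<Gamma> D)) - real (card {u \<in> unhit U \<Gamma> D. e \<in> \<Gamma> u})"
      by (simp add: card_Diff_subset of_nat_diff)
    also have "\<dots> \<le> (1 - \<theta>) * card (unhit U \<Gamma> D)"
      using e1 by (simp add: hitters_def algebra_simps)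
    also have "\<dots> \<le> (1 - \<theta>) * ((1 - \<theta>) ^ J * card U)"
      using D(9) False \<theta> by (intro mult_left_mono) auto
    finally have "card (unhit U \<Gamma> ?D) \<le> (1 - \<theta>) ^ Suc J * card U" by (simp add: mult.assoc)
    moreover have "finite ?D" "?D \<subseteq> dom H" "?D \<subseteq> E" "?D \<inter> R = {}" "?D \<inter> F = {}" "card ?D \<le> Suc J"
      using D(1-6) e(2,4) e1 eFD by (auto simp: hitters_def card_insert_if)
    moreover have "\<forall>e\<in>?D. \<exists>j\<in>{1..c0}. H e = Some j \<and> Some j \<notin> H ` F"
    proof
      fix e' assume "e' \<in> ?D"
      then consider "e' = e" | "e' \<in> D" by blast
      then show "\<exists>j\<in>{1..c0}. H e' = Some j \<and> Some j \<notin> H ` F"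
      proof cases
        case 1
        then show ?thesis using e(3-5) by blast
      next
        case 2
        then show ?thesis using D(7) by blast
      qed
    qed
    moreover have "inj_on H ?D"
    proof -
      have "H e \<notin> H ` (D - {e})" using e(4,5) by (metis Diff_subset UnCI image_mono image_subset_iff image_Un subsetD)
      then show ?thesis using D(8) by simp
    qed
    ultimately show ?thesis by (intro exI[of _ ?D] conjI disjI2)
  qed
qed

lemma one_minus_power_le_exp:
  fixes x :: real
  assumes "x \<le> 1"
  shows "(1 - x) ^ k \<le> exp (- x * k)"
proof -
  have "(1 - x) ^ k \<le> exp (- x) ^ k"
    using assms exp_ge_add_one_self[of "- x"] by (intro power_mono) auto
  then show ?thesis by (simp add: exp_of_nat_mult[symmetric] mult.commute)
qed

section \<open>The Dirac host and its split pairs\<close>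

definition neighbours :: "'a set set \<Rightarrow> 'a \<Rightarrow> 'a set" where
  "neighbours E v = {u. {v, u} \<in> E}"

text \<open>\<open>\<gamma>\<close> is the scale of expansion. Its numerical bound is dictated by
  the star estimate, which needs \<open>384 * \<gamma> \<le> 1 / 256\<close>; the other uses are far
  weaker. \<open>3 \<le> \<gamma> * n\<close> makes longest paths in an expander long enough to be
  closed into a cycle.\<close>

locale dirac_host =
  fixes V :: "'a set" and E :: "'a set set" and n :: nat and \<epsilon> \<gamma> :: real
  assumes finV: "finite V" and cardV: "card V = n"
    and E: "E \<subseteq> {e. e \<subseteq> V \<and> card e = 2}"
    and eps: "0 < \<epsilon>" "\<epsilon> \<le> 1" and gam: "0 < \<gamma>" "\<gamma> \<le> 1/100000" and n_large: "3 \<le> \<gamma> * n"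
    and dirac: "\<And>v. v \<in> V \<Longrightarrow> (1 + \<epsilon>) * n / 2 \<le> card (neighbours E v)"
begin

lemma gamma_eps: "0 < \<gamma> * \<epsilon>" "\<gamma> * \<epsilon> \<le> 1"
proof -
  have "\<gamma> * \<epsilon> \<le> 1 * 1" using gam eps by (intro mult_mono) auto
  then show "0 < \<gamma> * \<epsilon>" "\<gamma> * \<epsilon> \<le> 1" using gam eps by auto
qed

lemma n_pos: "n > 0"
  using n_large by (cases n) auto

lemma finE: "finite E"
proof (rule finite_subset)
  show "E \<subseteq> Pow V" using E by blast
qed (use finV in simp)

lemma edge_neq: "{u, v} \<in> E \<Longrightarrow> u \<noteq> v"
  using E by auto

lemma edge_in_V: "{u, v} \<in> E \<Longrightarrow> u \<in> V \<and> v \<in> V"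
  using E by auto

lemma neighbours_subset: "neighbours E v \<subseteq> V"
  using edge_in_V by (auto simp: neighbours_def)

lemma card_E: "card E \<le> (real n)\<^sup>2"
proof -
  have "E \<subseteq> (\<lambda>(x, y). {x, y}) ` (V \<times> V)"
  proof
    fix e assume "e \<in> E"
    then have "e \<subseteq> V" "card e = 2" using E by auto
    then obtain x y where "e = {x, y}" "x \<in> V" "y \<in> V" unfolding card_2_iff by blast
    then show "e \<in> (\<lambda>(x, y). {x, y}) ` (V \<times> V)" by (intro image_eqI[of _ _ "(x, y)"]) simp_all
  qed
  then have "card E \<le> card ((\<lambda>(x, y). {x, y}) ` (V \<times> V))" using finV by (intro card_mono) auto
  also have "\<dots> \<le> card (V \<times> V)" using finV by (intro card_image_le) auto
  also have "\<dots> = n\<^sup>2" by (simp add: card_cartesian_product cardV power2_eq_square)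
  finally show ?thesis by (metis of_nat_le_iff of_nat_power)
qed

text \<open>Half of the vertices is the size at which the Dirac condition starts to act: each vertex
  of \<open>A\<close> has at least \<open>\<epsilon> * n / 2\<close> neighbours in \<open>B\<close>.
  The unequal sizes still serve connectivity, since one of two complementary sets has at least half
  of the vertices.\<close>

definition split_pairs :: "('a set \<times> 'a set) set" where
  "split_pairs = {(A, B). A \<subseteq> V \<and> B \<subseteq> V \<and> A \<inter> B = {} \<and> \<gamma> * n \<le> card A \<and> n \<le> 2 * card B}"

definition cross_edges :: "'a set \<times> 'a set \<Rightarrow> 'a set set" where
  "cross_edges P = {e. \<exists>a\<in>fst P. \<exists>b\<in>snd P. e = {a, b}}"

lemma many_cross_edges:
  assumes "P \<in> split_pairs"
  shows "\<gamma> * \<epsilon> * (real n)\<^sup>2 / 2 \<le> card {e \<in> E. e \<in> cross_edges P}"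
proof -
  obtain A B where P: "P = (A, B)" by force
  have AB: "A \<subseteq> V" "B \<subseteq> V" "A \<inter> B = {}" "\<gamma> * n \<le> card A" "n \<le> 2 * card B"
    using assms by (auto simp: P split_pairs_def)
  have finAB: "finite A" "finite B" using AB finV finite_subset by blast+
  have fin: "finite (neighbours E a)" for a using neighbours_subset finV finite_subset by blast
  have one: "\<epsilon> * n / 2 \<le> card (neighbours E a \<inter> B)" if "a \<in> A" for a
  proof -
    have "card (neighbours E a \<union> B) \<le> n"
      using AB neighbours_subset[of a] finV cardV card_mono[of V "neighbours E a \<union> B"] by auto
    then have "card (neighbours E a) + card B \<le> n + card (neighbours E a \<inter> B)"
      using card_Un_Int[OF fin finAB(2)] by (metis add_le_mono1)
    moreover have "(1 + \<epsilon>) * n / 2 \<le> card (neighbours E a)" using dirac AB that by auto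
    ultimately show ?thesis using AB(5) by (simp add: field_simps)
  qed
  have "\<gamma> * \<epsilon> * (real n)\<^sup>2 / 2 = (\<gamma> * n) * (\<epsilon> * n / 2)" by (simp add: power2_eq_square)
  also have "\<dots> \<le> card A * (\<epsilon> * n / 2)" using AB eps by (intro mult_right_mono) auto
  also have "\<dots> = (\<Sum>a\<in>A. \<epsilon> * n / 2)" by simp
  also have "\<dots> \<le> (\<Sum>a\<in>A. real (card (neighbours E a \<inter> B)))" by (intro sum_mono one)
  also have "\<dots> = card (Sigma A (\<lambda>a. neighbours E a \<inter> B))" using finAB by simp
  also have "\<dots> \<le> card {e \<in> E. e \<in> cross_edges P}"
  proof (unfold of_nat_le_iff, rule card_inj_on_le)
    show "inj_on (\<lambda>(a, b). {a, b}) (Sigma A (\<lambda>a. neighbours E a \<inter> B))"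
      using AB(3) by (auto simp: inj_on_def doubleton_eq_iff)
    show "(\<lambda>(a, b). {a, b}) ` Sigma A (\<lambda>a. neighbours E a \<inter> B) \<subseteq> {e \<in> E. e \<in> cross_edges P}"
      unfolding P cross_edges_def neighbours_def by fastforce
  qed (use finE in auto)
  finally show ?thesis .
qed

lemma card_split_pairs: "finite split_pairs" "card split_pairs \<le> 4 ^ n"
proof -
  have sub: "split_pairs \<subseteq> Pow V \<times> Pow V" by (auto simp: split_pairs_def)
  then show "finite split_pairs" using finV finite_subset by blast
  have "card split_pairs \<le> card (Pow V \<times> Pow V)" using sub finV by (intro card_mono) auto
  also have "\<dots> = 4 ^ n" using finV by (simp add: card_cartesian_product card_Pow cardV flip: power_mult_distrib)
  finally show "card split_pairs \<le> 4 ^ n" .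
qed

lemma hit_all_split_pairs:
  fixes J :: nat and k r :: real
  assumes rich: "rich k (\<gamma> * \<epsilon> / 4 * (real n)\<^sup>2) r c0 H (\<lambda>F. hitters E (\<gamma> * \<epsilon> / 4) split_pairs cross_edges)"
    and R: "finite R" "card R < r" and J: "J \<le> k" "8 * n \<le> \<gamma> * \<epsilon> * J"
  shows "\<exists>D. finite D \<and> D \<subseteq> dom H \<and> D \<subseteq> E \<and> D \<inter> R = {} \<and> card D \<le> J \<and> inj_on H D \<and>
    (\<forall>e\<in>D. \<exists>j\<in>{1..c0}. H e = Some j) \<and> (\<forall>P\<in>split_pairs. cross_edges P \<inter> D \<noteq> {})"
proof -
  define \<theta> where "\<theta> = \<gamma> * \<epsilon> / 4"
  have \<theta>: "0 < \<theta>" "\<theta> \<le> 1" unfolding \<theta>_def using gamma_eps by auto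
  have big: "\<gamma> * \<epsilon> / 4 * (real n)\<^sup>2 \<le> card (hitters E \<theta> split_pairs cross_edges D)"
    if "0 < card (unhit split_pairs cross_edges D)" for D
  proof -
    let ?U = "unhit split_pairs cross_edges D"
    let ?g = "\<gamma> * \<epsilon> * (real n)\<^sup>2 / 2"
    have fU: "finite ?U" using card_split_pairs by (simp add: unhit_def)
    have e: "?g / (2 * (real n)\<^sup>2) = \<theta>" using n_pos by (simp add: \<theta>_def)
    \<comment> \<open>With \<open>m\<close> taken as the number of unhit pairs,
      \<open>card ?U\<close> cancels. The number of hitters is quadratic however many or few pairs
      are left.\<close>
    have "?g * card ?U / 2 \<le> real (card ?U) * real (card {e \<in> E. ?g / (2 * (real n)\<^sup>2) * card ?U \<le> card {u \<in> ?U. e \<in> cross_edges u}})"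
    proof (rule many_good_hitters)
      show "?g \<le> card {e \<in> E. e \<in> cross_edges u}" if "u \<in> ?U" for u
        using many_cross_edges that by (auto simp: unhit_def)
      show "card {u \<in> ?U. e \<in> cross_edges u} \<le> real (card ?U)" for e
        using fU by (auto intro: card_mono)
    qed (use finE fU card_E n_pos gam eps in auto)
    then have "card ?U * (?g / 2) \<le> card ?U * real (card (hitters E \<theta> split_pairs cross_edges D))"
      unfolding e hitters_def by (simp add: mult_ac)
    then show ?thesis using that by (simp add: field_simps)
  qed
  have "\<exists>D. finite D \<and> D \<subseteq> dom H \<and> D \<subseteq> E \<and> D \<inter> R = {} \<and> D \<inter> {} = {} \<and> card D \<le> J \<and>
    (\<forall>e\<in>D. \<exists>j\<in>{1..c0}. H e = Some j \<and> Some j \<notin> H ` {}) \<and> inj_on H D \<and>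
    (card (unhit split_pairs cross_edges D) \<le> (0::real) \<or>
     card (unhit split_pairs cross_edges D) \<le> (1 - \<theta>) ^ J * card split_pairs)"
    by (rule greedy_hitting[OF rich]) (use card_split_pairs R big J \<theta> in \<open>auto simp: \<theta>_def\<close>)
  then obtain D where D: "finite D" "D \<subseteq> dom H" "D \<subseteq> E" "D \<inter> R = {}" "D \<inter> {} = {}"
    "card D \<le> J" "\<forall>e\<in>D. \<exists>j\<in>{1..c0}. H e = Some j \<and> Some j \<notin> H ` {}" "inj_on H D"
    "card (unhit split_pairs cross_edges D) \<le> (0::real) \<or>
     card (unhit split_pairs cross_edges D) \<le> (1 - \<theta>) ^ J * card split_pairs"
    by (elim exE conjE)
  \<comment> \<open>There are at most \<open>4 ^ n\<close> pairs and
    \<open>\<theta> * J \<ge> 2 * n\<close>. Since \<open>exp 2 > 4\<close>, fewer than one pair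
    stays unhit.\<close>
  have "(1 - \<theta>) ^ J * card split_pairs < 1"
  proof -
    have "(1 - \<theta>) ^ J \<le> exp (- \<theta> * J)" using \<theta> by (intro one_minus_power_le_exp) auto
    also have "\<dots> \<le> exp (- 2 * n)" using J by (simp add: \<theta>_def)
    finally have "(1 - \<theta>) ^ J * card split_pairs \<le> exp (- 2 * n) * 4 ^ n"
      using card_split_pairs(2) by (intro mult_mono) (auto simp flip: of_nat_le_iff)
    also have "\<dots> = (exp (- 2) * 4) ^ n"
      by (simp add: power_mult_distrib exp_of_nat_mult[symmetric] mult.commute)
    also have "\<dots> < 1"
    proof -
      have "(2::real) \<le> exp 1" using exp_ge_add_one_self[of 1] by simp
      moreover have "(5::real) / 2 \<le> exp 1" using exp_lower_Taylor_quadratic[of 1] by simp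
      then have "(5/2)\<^sup>2 \<le> (exp 1 :: real)\<^sup>2" by (intro power_mono) auto
      then have "4 < exp (2::real)" by (simp add: power2_eq_square flip: exp_add)
      then have "exp (- 2) * 4 < (1::real)" by (simp add: exp_minus field_simps)
      then show ?thesis using n_pos by (intro power_less_one_iff[THEN iffD2]) auto
    qed
    finally show ?thesis .
  qed
  then have "card (unhit split_pairs cross_edges D) = 0" using D(9) by linarith
  then have "unhit split_pairs cross_edges D = {}" using card_split_pairs by (simp add: unhit_def)
  then have "\<forall>P\<in>split_pairs. cross_edges P \<inter> D \<noteq> {}" unfolding unhit_def by blast
  moreover have "\<forall>e\<in>D. \<exists>j\<in>{1..c0}. H e = Some j" using D(7) by blast
  ultimately show ?thesis using D by (intro exI[of _ D] conjI)
qed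

end

section \<open>Rainbow stars and expanders\<close>

lemma sum_card_fibres_le:
  assumes "finite P" "finite B"
  shows "(\<Sum>i\<in>B. card {x \<in> P. h x = i}) \<le> card P"
proof -
  have "(\<Sum>i\<in>B. card {x \<in> P. h x = i}) = card (\<Union>i\<in>B. {x \<in> P. h x = i})"
    by (rule card_UN_disjoint[symmetric]) (use assms in auto)
  also have "\<dots> \<le> card P" using assms by (intro card_mono) auto
  finally show ?thesis .
qed

lemma few_heavy_items:
  fixes \<Delta> :: real
  assumes "finite P" "finite B" and heavy: "\<And>i. i \<in> B \<Longrightarrow> \<Delta> \<le> card {x \<in> P. h x = i}"
    and P: "card P = l * s0" and D: "\<Delta> = real s0 / 96" and s0: "s0 > 0"
  shows "card B \<le> 96 * l"
proof -
  have "real (card B) * \<Delta> = (\<Sum>i\<in>B. \<Delta>)" by simp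
  also have "\<dots> \<le> (\<Sum>i\<in>B. real (card {x \<in> P. h x = i}))" by (intro sum_mono heavy)
  also have "\<dots> = real (\<Sum>i\<in>B. card {x \<in> P. h x = i})" by simp
  also have "\<dots> \<le> real (card P)" by (intro of_nat_mono sum_card_fibres_le assms)
  finally have "real (card B) * (real s0 / 96) \<le> real l * real s0" by (simp add: P D)
  then have "real s0 * real (card B) \<le> real s0 * (96 * real l)" by (simp add: algebra_simps)
  then have "real (card B) \<le> 96 * real l" using s0 by simp
  then show ?thesis by linarith
qed

text \<open>These are the edges at \<open>L\<close> that become unusable once the vertices of
  \<open>B\<close> and the colours of \<open>Y\<close> are overloaded.\<close>

definition star_edges ::
    "'a set \<Rightarrow> 'a edge_coloring \<Rightarrow> 'a set \<Rightarrow> 'a set \<Rightarrow> nat set \<Rightarrow> 'a set set" where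
  "star_edges V H L B Y =
     {e \<in> dom H. \<exists>l\<in>L. \<exists>u\<in>V. e = {l, u} \<and> (u \<in> B \<or> H e \<in> Some ` Y)}"

text \<open>The load-balancing step makes the conflict degrees uniformly small compared with the
  number of choices, so that an independent transversal exists.\<close>
lemma rainbow_stars:
  fixes V L :: "'a set" and H :: "'a edge_coloring" and C :: "nat set" and s0 :: nat
  assumes finV: "finite V" and LV: "L \<subseteq> V" and finC: "finite C" and s0: "s0 > 0"
    and avail: "\<And>l. l \<in> L \<Longrightarrow> s0 \<le> card {u \<in> V. {l, u} \<in> dom H - R \<and> H {l, u} \<in> Some ` C}"
    and spread: "\<And>L' B Y. L' \<subseteq> L \<Longrightarrow> L' \<noteq> {} \<Longrightarrow> B \<subseteq> V \<Longrightarrow> Y \<subseteq> C \<Longrightarrow>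
       card B \<le> 96 * card L' \<Longrightarrow> card Y \<le> 96 * card L' \<Longrightarrow>
       4 * card (star_edges V H L' B Y) \<le> card L' * s0"
    and finH: "finite (dom H)"
  shows "\<exists>st. (\<forall>l\<in>L. \<forall>i<6::nat. st (l, i) \<in> V \<and> {l, st (l, i)} \<in> dom H - R \<and> H {l, st (l, i)} \<in> Some ` C) \<and>
    (\<forall>p\<in>L \<times> {..<6}. \<forall>q\<in>L \<times> {..<6}. p \<noteq> q \<longrightarrow>
       st p \<noteq> st q \<and> H {fst p, st p} \<noteq> H {fst q, st q})"
proof -
  have finL: "finite L" using LV finV finite_subset by blast
  define Avail where "Avail l = {u \<in> V. {l, u} \<in> dom H - R \<and> H {l, u} \<in> Some ` C}" for l
  have "\<forall>l\<in>L. \<exists>T\<subseteq>Avail l. card T = s0 \<and> finite T"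
  proof
    fix l assume "l \<in> L"
    then have "s0 \<le> card (Avail l)" unfolding Avail_def by (rule avail)
    then obtain T where "T \<subseteq> Avail l" "card T = s0" "finite T" by (rule obtain_subset_with_card_n)
    then show "\<exists>T\<subseteq>Avail l. card T = s0 \<and> finite T" by (intro exI conjI)
  qed
  then obtain Av where Av: "\<And>l. l \<in> L \<Longrightarrow> Av l \<subseteq> Avail l \<and> card (Av l) = s0 \<and> finite (Av l)" by metis
  define I where "I l u = {Inl u, Inr (H {l, u})}" for l u
  \<comment> \<open>The constants fit the transversal: an option uses two resources and each vertex
    of \<open>L\<close> has six copies, so an option conflicts with at most
    \<open>12 * \<Delta> = s0 / 8 = s / 4\<close> options.\<close>
  define \<Delta> where "\<Delta> = real s0 / 96"
  define s where "s = real s0 / 2"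
  have "\<exists>A. (\<forall>l\<in>L. A l \<subseteq> Av l \<and> s \<le> card (A l)) \<and> (\<forall>i. load I L A i \<le> \<Delta>)"
  proof (rule balanced_sublists)
    fix L' assume L': "L' \<subseteq> L" "L' \<noteq> {}"
    have finL': "finite L'" using L' finL finite_subset by blast
    define P where "P = Sigma L' Av"
    have finP: "finite P" unfolding P_def using finL' Av L' by (intro finite_SigmaI) blast+
    have cardP: "card P = card L' * s0"
      unfolding P_def using finL' Av L' by (subst card_SigmaI) (auto simp: subset_iff)
    show "\<exists>l\<in>L'. s \<le> card {e \<in> Av l. \<forall>i\<in>I l e. load I L' Av i < \<Delta>}"
    proof (rule ccontr)
      assume neg: "\<not> ?thesis"
      define B where "B = {u \<in> V. \<Delta> \<le> load I L' Av (Inl u)}"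
      define Y where "Y = {j \<in> C. \<Delta> \<le> load I L' Av (Inr (Some j))}"
      have "card B \<le> 96 * card L'"
      proof (rule few_heavy_items[OF finP _ _ cardP \<Delta>_def s0])
        show "finite B" using finV by (simp add: B_def)
        fix u assume "u \<in> B"
        moreover have "load I L' Av (Inl u) = card {x \<in> P. snd x = u}"
          unfolding load_def P_def I_def by (intro arg_cong[of _ _ card]) auto
        ultimately show "\<Delta> \<le> card {x \<in> P. snd x = u}" by (simp add: B_def)
      qed
      moreover have "card Y \<le> 96 * card L'"
      proof (rule few_heavy_items[OF finP _ _ cardP \<Delta>_def s0])
        show "finite Y" using finC by (simp add: Y_def)
        fix j assume "j \<in> Y"
        moreover have "load I L' Av (Inr (Some j)) = card {x \<in> P. the (H {fst x, snd x}) = j}"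
        proof -
          have "{x \<in> Sigma L' Av. Inr (Some j) \<in> I (fst x) (snd x)} = {x \<in> P. the (H {fst x, snd x}) = j}"
          proof -
            have "H {l, u} = Some j \<longleftrightarrow> the (H {l, u}) = j" if "l \<in> L'" "u \<in> Av l" for l u
            proof -
              have "H {l, u} \<in> Some ` C" using Av[of l] L' that unfolding Avail_def by blast
              then show ?thesis by auto
            qed
            then show ?thesis unfolding P_def I_def by (auto simp: eq_commute[of "Some j"])
          qed
          then show ?thesis by (simp add: load_def)
        qed
        ultimately show "\<Delta> \<le> card {x \<in> P. the (H {fst x, snd x}) = j}" by (simp add: Y_def)
      qed
      moreover have "B \<subseteq> V" "Y \<subseteq> C" by (auto simp: B_def Y_def)
      ultimately have sp: "4 * card (star_edges V H L' B Y)
          \<le> card L' * s0" (is "4 * card ?X \<le> _")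
        using spread[OF L'] by blast
      \<comment> \<open>If no \<open>l\<close> has enough light options, each has more than half of
        its \<open>s0\<close> options in \<open>bad l\<close>. This gives more than
        \<open>card L' * s0 / 2\<close> pairs and, as an edge arises from at most two of them, more
        than \<open>card L' * s0 / 4\<close> edges, against \<open>spread\<close>.\<close>
      define bad where "bad l = {u \<in> Av l. u \<in> B \<or> H {l, u} \<in> Some ` Y}" for l
      have bad: "s < card (bad l)" if l: "l \<in> L'" for l
      proof -
        let ?good = "{e \<in> Av l. \<forall>i\<in>I l e. load I L' Av i < \<Delta>}"
        have "card ?good < s" using neg l by auto
        have lL: "l \<in> L" using l L' by blast
        have "Av l \<subseteq> ?good \<union> bad l"
        proof
          fix u assume u: "u \<in> Av l"
          then have uu: "u \<in> V" "H {l, u} \<in> Some ` C" using Av[OF lL] by (auto simp: Avail_def)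
          then obtain j where j: "H {l, u} = Some j" "j \<in> C" by blast
          show "u \<in> ?good \<union> bad l"
          proof (cases "u \<in> B \<or> j \<in> Y")
            case True
            then show ?thesis using u j by (auto simp: bad_def)
          next
            case False
            then have "load I L' Av (Inl u) < \<Delta>" "load I L' Av (Inr (Some j)) < \<Delta>"
              using uu j by (auto simp: B_def Y_def)
            then show ?thesis using u j by (simp add: I_def)
          qed
        qed
        moreover have "finite (?good \<union> bad l)" using Av[OF lL] by (simp add: bad_def)
        ultimately have "card (Av l) \<le> card (?good \<union> bad l)" by (intro card_mono)
        also have "\<dots> \<le> card ?good + card (bad l)" by (rule card_Un_le)
        finally have "real s0 \<le> real (card ?good) + card (bad l)" using Av[OF lL] by linarith
        then show ?thesis using \<open>card ?good < s\<close> by (simp add: s_def)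
      qed
      define Q where "Q = Sigma L' bad"
      have QP: "Q \<subseteq> P" by (auto simp: Q_def P_def bad_def)
      have finQ: "finite Q" using QP finP finite_subset by blast
      have finbad: "finite (bad l)" if "l \<in> L'" for l using Av[of l] that L' by (auto simp: bad_def)
      have "card L' * s = (\<Sum>l\<in>L'. s)" by simp
      also have "\<dots> < (\<Sum>l\<in>L'. real (card (bad l)))" using bad finL' L' by (intro sum_strict_mono) auto
      also have "\<dots> = card Q" unfolding Q_def using finL' finbad by simp
      also have "real (card Q) \<le> real (2 * card ((\<lambda>(x, y). {x, y}) ` Q))"
        by (intro of_nat_mono card_doubleton_image finQ)
      also have "\<dots> \<le> real (2 * card ?X)"
      proof (intro of_nat_mono mult_le_mono2 card_mono)
        show "finite ?X" using finH by (simp add: star_edges_def)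
        show "(\<lambda>(x, y). {x, y}) ` Q \<subseteq> ?X"
        proof clarify
          fix l u assume "(l, u) \<in> Q"
          then have lu: "l \<in> L'" "u \<in> Av l" "u \<in> B \<or> H {l, u} \<in> Some ` Y" by (auto simp: Q_def bad_def)
          then have "u \<in> V" "{l, u} \<in> dom H" using Av[of l] L' by (auto simp: Avail_def)
          then show "{l, u} \<in> ?X" unfolding star_edges_def
            using lu by blast
        qed
      qed
      finally have "card L' * s < 2 * real (card ?X)" by simp
      moreover have "real (4 * card ?X) \<le> real (card L' * s0)" using sp by (rule of_nat_mono)
      ultimately show False by (simp add: s_def)
    qed
  qed (use finL Av in \<open>auto simp: \<Delta>_def\<close>)
  then obtain A where A: "\<And>l. l \<in> L \<Longrightarrow> A l \<subseteq> Av l" "\<And>l. l \<in> L \<Longrightarrow> s \<le> card (A l)"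
    "\<And>i. load I L A i \<le> \<Delta>" by blast
  have finA: "finite (A l)" if "l \<in> L" for l using A(1)[OF that] Av[OF that] finite_subset by blast
  \<comment> \<open>The six copies of \<open>l\<close> stand for the six leaves of its star.\<close>
  define J where "J = L \<times> {..<6::nat}"
  define A' where "A' j = A (fst j)" for j :: "'a \<times> nat"
  define cf where "cf x y \<longleftrightarrow> I (fst (fst x)) (snd x) \<inter> I (fst (fst y)) (snd y) \<noteq> {}"
    for x y :: "('a \<times> nat) \<times> 'a"
  have finJ: "finite J" using finL by (simp add: J_def)
  have finS: "finite (Sigma J A')"
    using finJ finA by (auto simp: J_def A'_def)
  obtain f where f: "\<And>j. j \<in> J \<Longrightarrow> f j \<in> A' j"
    "\<And>j j'. j \<in> J \<Longrightarrow> j' \<in> J \<Longrightarrow> j \<noteq> j' \<Longrightarrow> \<not> cf (j, f j) (j', f j')"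
  proof (rule independent_transversal[of J A' s cf])
    show "0 < s" using s0 by (simp add: s_def)
    show "cf y x" if "cf x y" for x y using that by (auto simp: cf_def)
    fix j a assume j: "j \<in> J" and a: "a \<in> A' j"
    let ?T = "\<lambda>it. {x \<in> Sigma J A'. it \<in> I (fst (fst x)) (snd x)}"
    have one: "real (card (?T it)) \<le> 6 * \<Delta>" for it
    proof -
      have "finite {x \<in> Sigma L A. it \<in> I (fst x) (snd x)}" using finL finA by auto
      then have "card (?T it) \<le> card ({..<6::nat} \<times> {x \<in> Sigma L A. it \<in> I (fst x) (snd x)})"
        by (intro card_inj_on_le[of "\<lambda>x. (snd (fst x), fst (fst x), snd x)"])
          (auto simp: inj_on_def J_def A'_def)
      also have "\<dots> = 6 * load I L A it" by (simp add: load_def card_cartesian_product)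
      finally show ?thesis using A(3)[of it] by linarith
    qed
    have "{x \<in> Sigma J A'. cf (j, a) x} \<subseteq> ?T (Inl a) \<union> ?T (Inr (H {fst j, a}))"
      by (auto simp: cf_def I_def)
    moreover have "finite (?T (Inl a) \<union> ?T (Inr (H {fst j, a})))" using finS by simp
    ultimately have "card {x \<in> Sigma J A'. cf (j, a) x} \<le> card (?T (Inl a) \<union> ?T (Inr (H {fst j, a})))"
      by (intro card_mono)
    also have "\<dots> \<le> card (?T (Inl a)) + card (?T (Inr (H {fst j, a})))" by (rule card_Un_le)
    finally have "real (card {x \<in> Sigma J A'. cf (j, a) x}) \<le> 12 * \<Delta>"
      using one[of "Inl a"] one[of "Inr (H {fst j, a})"] by linarith
    then show "card {x \<in> Sigma J A'. cf (j, a) x} \<le> s / 4" by (simp add: s_def \<Delta>_def)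
  qed (use finJ finA A(2) in \<open>auto simp: J_def A'_def\<close>)
  have fA: "f (l, i) \<in> Avail l" if "l \<in> L" "i < 6" for l i
    using f(1)[of "(l, i)"] that A(1)[of l] Av[of l] by (auto simp: J_def A'_def)
  show ?thesis
  proof (intro exI[of _ f] conjI ballI allI impI)
    fix p q assume "p \<in> L \<times> {..<6::nat}" "q \<in> L \<times> {..<6::nat}" "p \<noteq> q"
    then have "\<not> cf (p, f p) (q, f q)" by (intro f(2)) (auto simp: J_def)
    then show "f p \<noteq> f q" "H {fst p, f p} \<noteq> H {fst q, f q}" by (auto simp: cf_def I_def)
  qed (use fA in \<open>auto simp: Avail_def\<close>)
qed

section \<open>Expanders from hitting sets and stars\<close>

definition expander :: "'a set \<Rightarrow> 'a set set \<Rightarrow> real \<Rightarrow> bool" where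
  "expander V F g \<longleftrightarrow>
     (\<forall>S\<subseteq>V. S \<noteq> {} \<longrightarrow> real (card S) \<le> g \<longrightarrow> 3 * card S \<le> card (nbhd F S))"

context dirac_host
begin

lemma nbhd_subset: "F \<subseteq> E \<Longrightarrow> nbhd F S \<subseteq> V"
  using edge_in_V by (auto simp: nbhd_def)

text \<open>\<open>L\<close> is a largest set within the size bound that has at most tenfold
  neighbourhood. A badly expanding set outside could be added to it: this contradicts maximality, or
  the union exceeds \<open>\<gamma> * n\<close> and, having few neighbours, leaves a split pair
  without edges.\<close>

lemma expanding_core:
  assumes FE: "F \<subseteq> E" and hit: "\<And>P. P \<in> split_pairs \<Longrightarrow> cross_edges P \<inter> F \<noteq> {}"
  obtains L where "L \<subseteq> V" "card L \<le> \<gamma> * n"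
    "\<And>S. S \<subseteq> V - L \<Longrightarrow> S \<noteq> {} \<Longrightarrow> card S \<le> \<gamma> * n \<Longrightarrow> 10 * card S \<le> card (nbhd F S - L)"
proof -
  let ?Q = "\<lambda>L. L \<subseteq> V \<and> real (card L) \<le> \<gamma> * n \<and> card (nbhd F L) \<le> 10 * card L"
  have "?Q {}" using gam by (simp add: nbhd_def)
  moreover have "\<forall>L. ?Q L \<longrightarrow> card L < Suc n"
    using card_mono[OF finV] cardV by (auto simp: less_Suc_eq_le)
  ultimately obtain L where L: "?Q L" and max: "\<forall>L'. ?Q L' \<longrightarrow> card L' \<le> card L"
    using ex_has_greatest_nat[of ?Q "{}" card "Suc n"] by (metis (no_types, lifting) less_imp_le)
  have finN: "finite (nbhd F S)" for S using nbhd_subset[OF FE] finV finite_subset by blast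
  show ?thesis
  proof (rule that[of L])
    fix S assume S: "S \<subseteq> V - L" "S \<noteq> {}" "card S \<le> \<gamma> * n"
    have fin: "finite S" "finite L" using S L finV finite_subset by blast+
    show "10 * card S \<le> card (nbhd F S - L)"
    proof (rule ccontr)
      assume neg: "\<not> ?thesis"
      let ?A = "L \<union> S"
      have cA: "card ?A = card L + card S" using fin S by (intro card_Un_disjoint) auto
      have "nbhd F ?A \<subseteq> nbhd F L \<union> (nbhd F S - L)" by (auto simp: nbhd_def)
      then have "card (nbhd F ?A) \<le> card (nbhd F L \<union> (nbhd F S - L))" using finN by (intro card_mono) auto
      also have "\<dots> \<le> card (nbhd F L) + card (nbhd F S - L)" by (rule card_Un_le)
      finally have NA: "card (nbhd F ?A) \<le> 10 * card ?A" using L neg cA by linarith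
      have AV: "?A \<subseteq> V" using L S by blast
      have "card S > 0" using S fin by (simp add: card_gt_0_iff)
      show False
      proof (cases "real (card ?A) \<le> \<gamma> * n")
        case True
        then have "card ?A \<le> card L" using max AV NA by blast
        then show False using cA \<open>card S > 0\<close> by simp
      next
        case False
        \<comment> \<open>The union has at most \<open>2 * \<gamma> * n\<close> vertices and at most
          ten times as many neighbours. Removing both leaves half of \<open>V\<close> as long as
          \<open>44 * \<gamma> \<le> 1\<close>.\<close>
        let ?B = "V - ?A - nbhd F ?A"
        have "card ?A + card (nbhd F ?A) + card ?B \<ge> card (?A \<union> nbhd F ?A \<union> ?B)"
          by (meson card_Un_le add_le_mono1 le_trans)
        moreover have "?A \<union> nbhd F ?A \<union> ?B = V" using AV nbhd_subset[OF FE] by blast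
        ultimately have "n \<le> 11 * card ?A + card ?B" using NA cardV by simp
        moreover have "real (card ?A) \<le> 2 * \<gamma> * n" using cA L S by simp
        moreover have "44 * \<gamma> * n \<le> n" using gam n_pos by (simp add: mult_le_cancel_right1)
        ultimately have "real n \<le> 2 * real (card ?B)" by linarith
        then have "(?A, ?B) \<in> split_pairs" using AV False by (auto simp: split_pairs_def)
        then show False using hit by (fastforce simp: cross_edges_def nbhd_def)
      qed
    qed
  qed (use L in auto)
qed

text \<open>Let \<open>a = card (S - L)\<close> and \<open>b = card (S \<inter> L)\<close>. The core
  gives \<open>10 * a\<close> neighbours of \<open>S\<close>; the six distinct leaves per vertex of
  \<open>L\<close> give at least \<open>5 * b - a\<close>. The first bound suffices if
  \<open>b \<le> 2 * a\<close> and the second if \<open>b \<ge> 2 * a\<close>.\<close>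

lemma stars_make_expander:
  assumes FE: "F \<subseteq> E" and hit: "\<And>P. P \<in> split_pairs \<Longrightarrow> cross_edges P \<inter> F \<noteq> {}"
    and L: "L \<subseteq> V" "\<And>S. S \<subseteq> V - L \<Longrightarrow> S \<noteq> {} \<Longrightarrow> card S \<le> \<gamma> * n \<Longrightarrow> 10 * card S \<le> card (nbhd F S - L)"
    and st: "inj_on st (L \<times> {..<6::nat})" "\<And>l i. l \<in> L \<Longrightarrow> i < 6 \<Longrightarrow> {l, st (l, i)} \<in> F'"
    and F': "F \<subseteq> F'" "F' \<subseteq> E"
  shows "expander V F' (\<gamma> * n)" "cut_connected V F'"
proof -
  have finN: "finite (nbhd F'' S)" if "F'' \<subseteq> E" for F'' S
    using nbhd_subset[OF that] finV finite_subset by blast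
  show ex: "expander V F' (\<gamma> * n)"
    unfolding expander_def
  proof (intro allI impI)
    fix S assume S: "S \<subseteq> V" "S \<noteq> {}" "real (card S) \<le> \<gamma> * n"
    have finS: "finite S" using S finV finite_subset by blast
    have split: "card S = card (S - L) + card (S \<inter> L)"
      using finS by (metis card_Diff_subset_Int add.commute card_mono finite_Int inf_le1 le_add_diff_inverse)
    have a: "10 * card (S - L) \<le> card (nbhd F' S)"
    proof (cases "S - L = {}")
      case True
      then show ?thesis by (simp only: card.empty mult_0_right le0)
    next
      case False
      have "real (card (S - L)) \<le> \<gamma> * n" using S(3) split by linarith
      then have "10 * card (S - L) \<le> card (nbhd F (S - L) - L)" using S False by (intro L(2)) auto
      also have "\<dots> \<le> card (nbhd F' S)" using F' finN by (intro card_mono) (auto simp: nbhd_def)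
      finally show ?thesis .
    qed
    have b: "6 * card (S \<inter> L) \<le> card (nbhd F' S) + card S"
    proof -
      have "inj_on st ((S \<inter> L) \<times> {..<6::nat})" by (rule inj_on_subset[OF st(1)]) auto
      then have "card (st ` ((S \<inter> L) \<times> {..<6::nat})) = 6 * card (S \<inter> L)"
        by (simp add: card_image card_cartesian_product)
      moreover have "st ` ((S \<inter> L) \<times> {..<6::nat}) \<subseteq> nbhd F' S \<union> S"
        using st(2) by (auto simp: nbhd_def)
      then have "card (st ` ((S \<inter> L) \<times> {..<6::nat})) \<le> card (nbhd F' S \<union> S)"
        using finN[OF F'(2)] finS by (intro card_mono) auto
      ultimately show ?thesis using card_Un_le[of "nbhd F' S" S] by linarith
    qed
    show "3 * card S \<le> card (nbhd F' S)" using a b split by linarith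
  qed
  show "cut_connected V F'"
    unfolding cut_connected_def
  proof (intro allI impI)
    fix X assume X: "X \<subseteq> V" "X \<noteq> {}" "X \<noteq> V"
    show "\<exists>u\<in>X. \<exists>v\<in>V - X. {u, v} \<in> F'"
    proof (rule ccontr)
      assume neg: "\<not> ?thesis"
      \<comment> \<open>A set without leaving edges has no neighbours, so expansion forces it above
        size \<open>\<gamma> * n\<close>. Both sides of an empty cut would be that large and would
        form an unhit split pair.\<close>
      have big: "\<gamma> * n < card Z" if Z: "Z \<subseteq> V" "Z \<noteq> {}" "\<And>u v. u \<in> Z \<Longrightarrow> v \<in> V - Z \<Longrightarrow> {u, v} \<notin> F'" for Z
      proof (rule ccontr)
        assume "\<not> \<gamma> * n < card Z"
        then have "3 * card Z \<le> card (nbhd F' Z)" using ex Z unfolding expander_def by auto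
        moreover have "nbhd F' Z = {}" using Z nbhd_subset[OF F'(2), of Z] by (auto simp: nbhd_def)
        moreover have "card Z > 0" using Z finV finite_subset by (metis card_gt_0_iff)
        ultimately show False by simp
      qed
      have neg1: "{u, v} \<notin> F'" if "u \<in> X" "v \<in> V - X" for u v using neg that by blast
      have neg2: "{v, u} \<notin> F'" if "u \<in> X" "v \<in> V - X" for u v
        using neg1[OF that] by (simp add: insert_commute)
      have "\<gamma> * n < card X" using X neg1 by (intro big) auto
      moreover have "\<gamma> * n < card (V - X)"
      proof (rule big)
        show "{u, v} \<notin> F'" if "u \<in> V - X" "v \<in> V - (V - X)" for u v
          using neg2[of v u] that by blast
      qed (use X in auto)
      moreover have "card X + card (V - X) = n"
        using X finV cardV by (metis card_Diff_subset card_mono finite_subset le_add_diff_inverse)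
      ultimately have "(X, V - X) \<in> split_pairs \<or> (V - X, X) \<in> split_pairs"
        using X by (auto simp: split_pairs_def)
      then have "cross_edges (X, V - X) \<inter> F \<noteq> {} \<or> cross_edges (V - X, X) \<inter> F \<noteq> {}" using hit by blast
      then show False using neg1 neg2 F'(1) unfolding cross_edges_def by fastforce
    qed
  qed
qed

end

section \<open>Boosters\<close>

lemma succ_in_cases: "succ_in xs z \<in> insert z (set xs)"
  by (induction xs z rule: succ_in.induct) auto

definition path_starts :: "'a set \<Rightarrow> 'a set set \<Rightarrow> 'a set" where
  "path_starts V F = {x. \<exists>q. longest_path V F q \<and> hd q = x}"

definition path_ends :: "'a set \<Rightarrow> 'a set set \<Rightarrow> 'a \<Rightarrow> 'a set" where
  "path_ends V F x = {y. \<exists>q. longest_path V F q \<and> hd q = x \<and> last q = y}"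

text \<open>Fixing one path per pair of ends makes the target families functions of the edge sets
  alone, as the union bound requires, and lets an oriented edge create only one new end per
  start.\<close>

definition the_path :: "'a set \<Rightarrow> 'a set set \<Rightarrow> 'a \<Rightarrow> 'a \<Rightarrow> 'a list" where
  "the_path V F x y = (SOME q. longest_path V F q \<and> hd q = x \<and> last q = y)"

lemma the_path:
  assumes "y \<in> path_ends V F x"
  shows "longest_path V F (the_path V F x y)" "hd (the_path V F x y) = x" "last (the_path V F x y) = y"
proof -
  have "\<exists>q. longest_path V F q \<and> hd q = x \<and> last q = y" using assms by (simp add: path_ends_def)
  then have "longest_path V F (the_path V F x y) \<and> hd (the_path V F x y) = x \<and> last (the_path V F x y) = y"
    unfolding the_path_def by (rule someI_ex)
  then show "longest_path V F (the_path V F x y)" "hd (the_path V F x y) = x" "last (the_path V F x y) = y"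
    by simp_all
qed

lemma longest_path_ends_in:
  assumes "longest_path V F q"
  shows "hd q \<in> V" "last q \<in> V" "q \<noteq> []" "distinct q" "set q \<subseteq> V"
proof -
  show *: "q \<noteq> []" "distinct q" "set q \<subseteq> V" using assms by (simp_all add: longest_path_def is_path_def)
  show "hd q \<in> V" "last q \<in> V" using * hd_in_set last_in_set by blast+
qed

lemma path_ends_subset: "path_ends V F x \<subseteq> V"
  using longest_path_ends_in(2) by (auto simp: path_ends_def)

lemma path_starts_subset: "path_starts V F \<subseteq> V"
  using longest_path_ends_in(1) by (auto simp: path_starts_def)

lemma path_ends_starts: "path_ends V F x \<subseteq> path_starts V F"
proof
  fix y assume "y \<in> path_ends V F x"
  then obtain q where q: "longest_path V F q" "last q = y" by (auto simp: path_ends_def)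
  then have "longest_path V F (rev q)" "hd (rev q) = y"
    using longest_path_rev longest_path_ends_in(3)[OF q(1)] by (simp_all add: hd_rev)
  then show "y \<in> path_starts V F" by (auto simp: path_starts_def)
qed

lemma expander_mono:
  assumes "expander V F g" "F \<subseteq> F'" "\<And>S. finite (nbhd F' S)"
  shows "expander V F' g"
  unfolding expander_def
proof (intro allI impI)
  fix S assume "S \<subseteq> V" "S \<noteq> {}" "real (card S) \<le> g"
  then have "3 * card S \<le> card (nbhd F S)" using assms(1) by (simp add: expander_def)
  also have "\<dots> \<le> card (nbhd F' S)" using assms by (intro card_mono) (auto simp: nbhd_def)
  finally show "3 * card S \<le> card (nbhd F' S)" .
qed

lemma cut_connected_mono: "cut_connected V F \<Longrightarrow> F \<subseteq> F' \<Longrightarrow> cut_connected V F'"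
  unfolding cut_connected_def by (meson subsetD)

definition spanning_cycle :: "'a set \<Rightarrow> 'a set set \<Rightarrow> bool" where
  "spanning_cycle V F \<longleftrightarrow> (\<exists>vs. distinct vs \<and> set vs = V \<and> 3 \<le> length vs \<and> cycle_edges vs \<subseteq> F)"

definition boosts :: "'a set \<Rightarrow> 'a set set \<Rightarrow> 'a set set \<Rightarrow> bool" where
  "boosts V F F' \<longleftrightarrow> spanning_cycle V F' \<or> (\<forall>xs. is_path F xs \<longrightarrow> set xs \<subseteq> V \<longrightarrow>
     (\<exists>ys. is_path F' ys \<and> set ys \<subseteq> V \<and> length xs < length ys))"

definition cand :: "'a set \<Rightarrow> 'a set set \<Rightarrow> 'a set set \<Rightarrow> 'a \<Rightarrow> 'a \<Rightarrow> 'a set" where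
  "cand V E F x w = {y \<in> path_ends V F x. \<exists>z\<in>neighbours E y. succ_in (the_path V F x y) z = w}"

text \<open>A pair \<open>(x, w)\<close> is a demand if many host edges turn \<open>w\<close> into the end of a longest path
  from \<open>x\<close>, either by a rotation or, when \<open>w\<close> lies off the path, by extending it.\<close>
definition demands :: "'a set \<Rightarrow> 'a set set \<Rightarrow> real \<Rightarrow> 'a set set \<Rightarrow> ('a \<times> 'a) set" where
  "demands V E \<epsilon> F = {(x, w). x \<in> path_starts V F \<and> w \<in> V \<and>
     \<epsilon> / 4 * card (path_ends V F x) \<le> card (cand V E F x w)}"

definition witnesses :: "'a set \<Rightarrow> 'a set set \<Rightarrow> 'a set set \<Rightarrow> 'a \<times> 'a \<Rightarrow> 'a set set" where
  "witnesses V E F u = {e \<in> E. \<exists>y\<in>path_ends V F (fst u). \<exists>z. e = {y, z} \<and>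
     succ_in (the_path V F (fst u) y) z = snd u}"

text \<open>The second edge of a booster whose first edge is already among the helpers in
  \<open>D\<close>.\<close>

definition closers :: "'a set \<Rightarrow> 'a set set \<Rightarrow> real \<Rightarrow> 'a set set \<Rightarrow> 'a set set \<Rightarrow> 'a set set" where
  "closers V E \<epsilon> F D = {e \<in> E. \<exists>x w. e = {x, w} \<and> (x, w) \<in> demands V E \<epsilon> F \<and>
     witnesses V E F (x, w) \<inter> D \<noteq> {}}"

section \<open>Counting demands, witnesses and closers\<close>

context dirac_host
begin

lemma finite_nbhd: "F \<subseteq> E \<Longrightarrow> finite (nbhd F S)"
  using finite_subset[OF nbhd_subset finV] .

lemma finite_neighbours: "finite (neighbours E v)"
  using finite_subset[OF neighbours_subset finV] .

lemma finite_path_ends: "finite (path_ends V F x)" "finite (path_starts V F)"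
  using finite_subset[OF path_ends_subset finV] finite_subset[OF path_starts_subset finV] .

text \<open>For the starts: the far ends of the longest paths from one start are, after reversal,
  starts themselves.\<close>

lemma many_path_ends:
  assumes FE: "F \<subseteq> E" and ex: "expander V F (\<gamma> * n)"
  shows "x \<in> path_starts V F \<Longrightarrow> \<gamma> * n < card (path_ends V F x)"
    and "\<gamma> * n < card (path_starts V F)"
    and "longest_path V F q \<Longrightarrow> 3 \<le> length q"
proof -
  have FV: "e \<subseteq> V" if "e \<in> F" for e using FE E that by blast
  have posa: "\<gamma> * n < card {y. \<exists>p. longest_path V F p \<and> set p = set q \<and> hd p = hd q \<and> last p = y}"
    "\<gamma> * n < length q" if "longest_path V F q" for q
    by (rule posa_many_ends[OF finV that FV]; use ex in \<open>simp add: expander_def\<close>)+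
  show ends: "\<gamma> * n < card (path_ends V F x)" if x: "x \<in> path_starts V F" for x
  proof -
    obtain q where q: "longest_path V F q" "hd q = x" using x by (auto simp: path_starts_def)
    have "card {y. \<exists>p. longest_path V F p \<and> set p = set q \<and> hd p = hd q \<and> last p = y} \<le> card (path_ends V F x)"
      using q by (intro card_mono finite_path_ends) (auto simp: path_ends_def)
    then show ?thesis using posa(1)[OF q(1)] by linarith
  qed
  show "3 \<le> length q" if "longest_path V F q" for q
    using posa(2)[OF that] n_large by linarith
  have "V \<noteq> {}" using cardV n_pos by auto
  then obtain q where q: "longest_path V F q" using longest_path_exists[OF finV] by metis
  then have "hd q \<in> path_starts V F" by (auto simp: path_starts_def)
  then have "\<gamma> * n < card (path_ends V F (hd q))" by (rule ends)
  also have "card (path_ends V F (hd q)) \<le> card (path_starts V F)"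
    by (intro card_mono finite_path_ends path_ends_starts)
  finally show "\<gamma> * n < card (path_starts V F)" by simp
qed

text \<open>Pairs of an end \<open>y\<close> and a new end \<open>w\<close> are counted from the
  side of \<open>y\<close>: injectivity of \<open>succ_in\<close> turns the degree of
  \<open>y\<close> into as many different \<open>w\<close>.\<close>

lemma sum_cand:
  "card (path_ends V F x) * ((1 + \<epsilon>) * n / 2) \<le> (\<Sum>w\<in>V. real (card (cand V E F x w)))"
proof -
  let ?S = "path_ends V F x"
  let ?K = "\<lambda>y. {w \<in> V. \<exists>z\<in>neighbours E y. succ_in (the_path V F x y) z = w}"
  have K: "(1 + \<epsilon>) * n / 2 \<le> card (?K y)" if y: "y \<in> ?S" for y
  proof -
    let ?P = "the_path V F x y"
    note P = longest_path_ends_in[OF the_path(1)[OF y]] and last = the_path(3)[OF y]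
    have "inj_on (succ_in ?P) (neighbours E y)"
    proof (rule inj_on_subset[OF inj_on_succ_in])
      show "neighbours E y \<subseteq> - {last ?P}" using edge_neq[of y y] by (auto simp: last neighbours_def)
    qed (use P in simp_all)
    then have "card (neighbours E y) = card (succ_in ?P ` neighbours E y)" by (simp add: card_image)
    also have "\<dots> \<le> card (?K y)"
    proof (intro card_mono)
      show "succ_in ?P ` neighbours E y \<subseteq> ?K y"
      proof
        fix w assume "w \<in> succ_in ?P ` neighbours E y"
        then obtain z where z: "z \<in> neighbours E y" "w = succ_in ?P z" by blast
        then have "w \<in> V" using succ_in_cases[of ?P z] P(5) neighbours_subset[of y] by auto
        then show "w \<in> ?K y" using z by blast
      qed
    qed (use finV in simp)
    finally have "card (neighbours E y) \<le> card (?K y)" .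
    moreover have "(1 + \<epsilon>) * n / 2 \<le> card (neighbours E y)"
      by (rule dirac[OF subsetD[OF path_ends_subset y]])
    ultimately show ?thesis by linarith
  qed
  have "card ?S * ((1 + \<epsilon>) * n / 2) = (\<Sum>y\<in>?S. (1 + \<epsilon>) * n / 2)" by simp
  also have "\<dots> \<le> (\<Sum>y\<in>?S. real (card (?K y)))" by (intro sum_mono K)
  also have "\<dots> = (\<Sum>y\<in>?S. \<Sum>w\<in>V. if \<exists>z\<in>neighbours E y. succ_in (the_path V F x y) z = w then 1 else 0)"
    using finV by (intro sum.cong) (simp_all add: sum.If_cases Int_def)
  also have "\<dots> = (\<Sum>w\<in>V. real (card (cand V E F x w)))"
    by (subst sum.swap) (use finite_path_ends in \<open>simp add: sum.If_cases Int_def cand_def\<close>)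
  finally show ?thesis .
qed

lemma demands_subset: "demands V E \<epsilon> F \<subseteq> V \<times> V"
  using path_starts_subset[THEN subsetD] by (auto simp: demands_def)

lemma finite_demands: "finite (demands V E \<epsilon> F)"
  using finite_subset[OF demands_subset] finV by simp

lemma card_demands: "card (demands V E \<epsilon> F) \<le> (real n)\<^sup>2"
proof -
  have "card (demands V E \<epsilon> F) \<le> card (V \<times> V)" using finV by (intro card_mono demands_subset) simp
  also have "\<dots> = n\<^sup>2" by (simp add: card_cartesian_product cardV power2_eq_square)
  finally show ?thesis by (metis of_nat_le_iff of_nat_power)
qed

text \<open>By averaging over \<open>w\<close>: those below the threshold lose at most an
  \<open>\<epsilon> / 4\<close> share of the sum, and each of the others contributes at most
  \<open>card (path_ends V F x)\<close>. The result exceeds half of the vertices, so that the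
  demands at \<open>x\<close> overlap its neighbourhood.\<close>

lemma many_demands:
  assumes x: "x \<in> path_starts V F" and S: "card (path_ends V F x) > 0"
  shows "(1 / 2 + \<epsilon> / 4) * n \<le> card {w. (x, w) \<in> demands V E \<epsilon> F}"
proof -
  let ?S = "path_ends V F x"
  define T where "T = {w \<in> V. \<epsilon> / 4 * card ?S \<le> card (cand V E F x w)}"
  have T: "{w. (x, w) \<in> demands V E \<epsilon> F} = T" using x by (auto simp: demands_def T_def)
  have TV: "T \<subseteq> V" by (auto simp: T_def)
  have c: "card (cand V E F x w) \<le> card ?S" for w
    using finite_path_ends by (intro card_mono) (auto simp: cand_def)
  have "card ?S * ((1 + \<epsilon>) * n / 2) \<le> (\<Sum>w\<in>V. real (card (cand V E F x w)))" by (rule sum_cand)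
  also have "\<dots> = (\<Sum>w\<in>T. real (card (cand V E F x w))) + (\<Sum>w\<in>V - T. real (card (cand V E F x w)))"
    using finV TV by (subst sum.subset_diff[of T V]) auto
  also have "(\<Sum>w\<in>T. real (card (cand V E F x w))) \<le> (\<Sum>w\<in>T. real (card ?S))"
    using c by (intro sum_mono) simp
  also have "(\<Sum>w\<in>V - T. real (card (cand V E F x w))) \<le> (\<Sum>w\<in>V - T. \<epsilon> / 4 * card ?S)"
    by (intro sum_mono) (auto simp: T_def)
  also have "\<dots> \<le> (\<Sum>w\<in>V. \<epsilon> / 4 * card ?S)" using finV eps by (intro sum_mono2) auto
  finally have "card ?S * ((1 + \<epsilon>) * n / 2) \<le> card ?S * (card T + \<epsilon> / 4 * n)"
    by (simp add: cardV algebra_simps)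
  then have "(1 + \<epsilon>) * n / 2 \<le> card T + \<epsilon> / 4 * n" using S by simp
  then show ?thesis unfolding T by (simp add: field_simps)
qed

text \<open>Every candidate end lies on a witness, and a witness has only two vertices.\<close>

lemma many_witnesses:
  assumes u: "u \<in> demands V E \<epsilon> F" and S: "\<gamma> * n < card (path_ends V F (fst u))"
  shows "\<epsilon> * \<gamma> * n / 8 \<le> card {e \<in> E. e \<in> witnesses V E F u}"
proof -
  let ?W = "witnesses V E F u"
  have WE: "?W \<subseteq> E" by (auto simp: witnesses_def)
  have finW: "finite ?W" using WE finE finite_subset by blast
  have "cand V E F (fst u) (snd u) \<subseteq> \<Union>?W"
  proof
    fix y assume "y \<in> cand V E F (fst u) (snd u)"
    then obtain z where "y \<in> path_ends V F (fst u)" "{y, z} \<in> E" "succ_in (the_path V F (fst u) y) z = snd u"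
      by (auto simp: cand_def neighbours_def)
    then have "{y, z} \<in> ?W" by (auto simp: witnesses_def)
    then show "y \<in> \<Union>?W" by blast
  qed
  moreover have "finite (\<Union>?W)"
  proof (rule finite_Union[OF finW])
    fix e assume "e \<in> ?W"
    then have "e \<subseteq> V" using WE E by blast
    then show "finite e" by (rule finite_subset[OF _ finV])
  qed
  ultimately have "card (cand V E F (fst u) (snd u)) \<le> card (\<Union>?W)" by (intro card_mono)
  also have "\<dots> \<le> (\<Sum>e\<in>?W. card e)" by (rule card_Union_le_sum_card)
  also have "\<dots> = (\<Sum>e\<in>?W. 2)" using WE E by (intro sum.cong) auto
  finally have c: "card (cand V E F (fst u) (snd u)) \<le> 2 * card ?W" by simp
  have "\<epsilon> / 4 * (\<gamma> * n) \<le> \<epsilon> / 4 * card (path_ends V F (fst u))"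
    using S eps by (intro mult_left_mono) auto
  also have "\<dots> \<le> card (cand V E F (fst u) (snd u))" using u by (auto simp: demands_def)
  finally have "\<epsilon> / 4 * (\<gamma> * n) \<le> 2 * real (card ?W)" using c by linarith
  moreover have "{e \<in> E. e \<in> ?W} = ?W" using WE by blast
  ultimately show ?thesis by (simp add: field_simps)
qed

text \<open>For each start and each orientation of \<open>e\<close> the fixed path determines the
  new end. That this bound is linear is what makes the number of demand hitters quadratic.\<close>

lemma few_hits:
  assumes e: "e \<in> E"
  shows "card {u \<in> demands V E \<epsilon> F. e \<in> witnesses V E F u} \<le> 2 * n"
proof -
  have "card e = 2" using e E by blast
  then obtain a b where ab: "e = {a, b}" unfolding card_2_iff by (elim exE conjE)
  let ?f = "\<lambda>a b x. (x, succ_in (the_path V F x a) b)"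
  have "{u \<in> demands V E \<epsilon> F. e \<in> witnesses V E F u} \<subseteq> ?f a b ` V \<union> ?f b a ` V"
  proof
    fix u assume u: "u \<in> {u \<in> demands V E \<epsilon> F. e \<in> witnesses V E F u}"
    obtain x w where xw: "u = (x, w)" by force
    have "x \<in> V" using u xw demands_subset by blast
    obtain y z where yz: "e = {y, z}" "succ_in (the_path V F x y) z = w"
      using u xw by (auto simp: witnesses_def)
    then have "y = a \<and> z = b \<or> y = b \<and> z = a" using ab by (metis doubleton_eq_iff)
    then have "u = ?f a b x \<or> u = ?f b a x" using xw yz by blast
    then show "u \<in> ?f a b ` V \<union> ?f b a ` V" using \<open>x \<in> V\<close> by blast
  qed
  then have "card {u \<in> demands V E \<epsilon> F. e \<in> witnesses V E F u} \<le> card (?f a b ` V \<union> ?f b a ` V)"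
    using finV by (intro card_mono) auto
  also have "\<dots> \<le> card (?f a b ` V) + card (?f b a ` V)" by (rule card_Un_le)
  also have "\<dots> \<le> card V + card V" using finV by (intro add_mono card_image_le)
  finally show ?thesis using cardV by simp
qed

text \<open>The demands at a start and its neighbourhood together exceed \<open>n\<close> by
  \<open>3 / 4 * \<epsilon> * n\<close>. In units of \<open>\<gamma> * \<epsilon> * n * n\<close>,
  the starts give \<open>3 / 4\<close> of pairs, at most \<open>1 / 4\<close> are unhit, and passing
  to unordered edges halves the remaining \<open>1 / 2\<close>.\<close>

lemma many_closers:
  assumes FE: "F \<subseteq> E" and ex: "expander V F (\<gamma> * n)"
    and un: "card (unhit (demands V E \<epsilon> F) (witnesses V E F) D) \<le> \<gamma> * \<epsilon> / 4 * (real n)\<^sup>2"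
  shows "\<gamma> * \<epsilon> / 4 * (real n)\<^sup>2 \<le> card (closers V E \<epsilon> F D)"
proof -
  let ?U = "unhit (demands V E \<epsilon> F) (witnesses V E F) D"
  define W where "W = Sigma (path_starts V F) (\<lambda>x. {w. (x, w) \<in> demands V E \<epsilon> F} \<inter> neighbours E x)"
  have finW: "finite W" unfolding W_def using finite_path_ends finite_neighbours by auto
  have one: "3 / 4 * \<epsilon> * n \<le> card ({w. (x, w) \<in> demands V E \<epsilon> F} \<inter> neighbours E x)"
    if x: "x \<in> path_starts V F" for x
  proof -
    let ?T = "{w. (x, w) \<in> demands V E \<epsilon> F}"
    have TV: "?T \<subseteq> V" using demands_subset by blast
    have finT: "finite ?T" using TV finV finite_subset by blast
    have "card (?T \<union> neighbours E x) \<le> n"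
      unfolding cardV[symmetric] using TV neighbours_subset[of x] finV by (intro card_mono) auto
    moreover have "card ?T + card (neighbours E x) = card (?T \<union> neighbours E x) + card (?T \<inter> neighbours E x)"
      by (rule card_Un_Int[OF finT finite_neighbours])
    moreover have "card (path_ends V F x) > 0"
    proof -
      have "0 < real (card (path_ends V F x))" using many_path_ends(1)[OF FE ex x] n_large by linarith
      then show ?thesis by simp
    qed
    then have "(1 / 2 + \<epsilon> / 4) * n \<le> card ?T" by (rule many_demands[OF x])
    moreover have "(1 + \<epsilon>) * n / 2 \<le> card (neighbours E x)" by (rule dirac[OF subsetD[OF path_starts_subset x]])
    ultimately show ?thesis by (simp add: field_simps)
  qed
  have "\<gamma> * n * (3 / 4 * \<epsilon> * n) \<le> card (path_starts V F) * (3 / 4 * \<epsilon> * n)"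
    using many_path_ends(2)[OF FE ex] eps by (intro mult_right_mono) auto
  also have "\<dots> = (\<Sum>x\<in>path_starts V F. 3 / 4 * \<epsilon> * n)" by simp
  also have "\<dots> \<le> (\<Sum>x\<in>path_starts V F. real (card ({w. (x, w) \<in> demands V E \<epsilon> F} \<inter> neighbours E x)))"
    by (intro sum_mono one)
  also have "\<dots> = card W" unfolding W_def using finite_path_ends finite_neighbours by simp
  finally have W: "3 / 4 * (\<gamma> * \<epsilon>) * (real n)\<^sup>2 \<le> card W" by (simp add: power2_eq_square algebra_simps)
  have "card W - card ?U \<le> card (W - ?U)"
    using finite_demands by (intro diff_card_le_card_Diff) (simp add: unhit_def)
  then have "real (card W) - real (card ?U) \<le> real (card (W - ?U))" by linarith
  with W un have "\<gamma> * \<epsilon> / 2 * (real n)\<^sup>2 \<le> card (W - ?U)" by (simp add: field_simps)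
  also have "card (W - ?U) \<le> 2 * card ((\<lambda>(x, y). {x, y}) ` (W - ?U))"
    using finW by (intro card_doubleton_image) simp
  also have "\<dots> \<le> 2 * card (closers V E \<epsilon> F D)"
  proof (intro mult_le_mono2 card_mono)
    show "finite (closers V E \<epsilon> F D)" using finE by (simp add: closers_def)
    show "(\<lambda>(x, y). {x, y}) ` (W - ?U) \<subseteq> closers V E \<epsilon> F D"
    proof clarify
      fix x w assume xw: "(x, w) \<in> W" "(x, w) \<notin> ?U"
      then have "(x, w) \<in> demands V E \<epsilon> F" "{x, w} \<in> E" by (simp_all add: W_def neighbours_def)
      moreover from this have "witnesses V E F (x, w) \<inter> D \<noteq> {}" using xw by (simp add: unhit_def)
      ultimately show "{x, w} \<in> closers V E \<epsilon> F D" unfolding closers_def by blast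
    qed
  qed
  finally show ?thesis by simp
qed

text \<open>In \<open>many_good_hitters\<close> both \<open>g\<close> and \<open>m\<close> are
  linear here, so quadratically many unhit demands yield quadratically many hitters. Each of them
  serves only a share of order \<open>1 / n\<close>, which is why linearly many helpers are
  needed.\<close>

lemma many_demand_hitters:
  assumes FE: "F \<subseteq> E" and ex: "expander V F (\<gamma> * n)"
    and un: "\<gamma> * \<epsilon> / 4 * (real n)\<^sup>2 < card (unhit (demands V E \<epsilon> F) (witnesses V E F) D)"
  shows "(\<gamma> * \<epsilon>)\<^sup>2 / 128 * (real n)\<^sup>2
    \<le> card (hitters E (\<gamma> * \<epsilon> / (16 * n)) (demands V E \<epsilon> F) (witnesses V E F) D)"
proof -
  let ?U = "unhit (demands V E \<epsilon> F) (witnesses V E F) D"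
  let ?g = "\<epsilon> * \<gamma> * n / 8"
  let ?h = "hitters E (\<gamma> * \<epsilon> / (16 * n)) (demands V E \<epsilon> F) (witnesses V E F) D"
  have fU: "finite ?U" using finite_demands by (simp add: unhit_def)
  have e: "?g / (2 * (real n)\<^sup>2) = \<gamma> * \<epsilon> / (16 * n)" using n_pos by (simp add: power2_eq_square)
  have "?g * card ?U / 2 \<le> real (2 * n) *
    real (card {e \<in> E. ?g / (2 * (real n)\<^sup>2) * card ?U \<le> card {u \<in> ?U. e \<in> witnesses V E F u}})"
  proof (rule many_good_hitters)
    show "?g \<le> card {e \<in> E. e \<in> witnesses V E F u}" if "u \<in> ?U" for u
    proof (rule many_witnesses)
      show "u \<in> demands V E \<epsilon> F" using that by (simp add: unhit_def)
      then show "\<gamma> * n < card (path_ends V F (fst u))"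
        by (intro many_path_ends(1)[OF FE ex]) (auto simp: demands_def)
    qed
    show "card {u \<in> ?U. e \<in> witnesses V E F u} \<le> real (2 * n)" if "e \<in> E" for e
    proof -
      have "card {u \<in> ?U. e \<in> witnesses V E F u} \<le> card {u \<in> demands V E \<epsilon> F. e \<in> witnesses V E F u}"
        using finite_demands by (intro card_mono) (auto simp: unhit_def)
      then show ?thesis using few_hits[OF that, of F] by linarith
    qed
  qed (use finE fU card_E n_pos gam eps in auto)
  then have *: "?g * card ?U / 2 \<le> 2 * n * real (card ?h)"
    unfolding e hitters_def by simp
  have "n * ((\<gamma> * \<epsilon>)\<^sup>2 / 128 * (real n)\<^sup>2) * 2 = ?g * (\<gamma> * \<epsilon> / 4 * (real n)\<^sup>2) / 2"
    by (simp add: power2_eq_square)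
  also have "\<dots> \<le> ?g * card ?U / 2"
    using un eps gam by (intro divide_right_mono mult_left_mono) auto
  also note *
  finally have "(2 * real n) * ((\<gamma> * \<epsilon>)\<^sup>2 / 128 * (real n)\<^sup>2) \<le> (2 * real n) * card ?h" by (simp add: mult_ac)
  then show ?thesis using n_pos by (simp add: field_simps)
qed

section \<open>Booster rounds\<close>

lemma closer_lengthens:
  assumes FE: "F \<subseteq> E" and ex: "expander V F (\<gamma> * n)" and con: "cut_connected V F"
    and f2: "f2 \<in> closers V E \<epsilon> F D"
  obtains f1 where "f1 \<in> D" "boosts V F (insert f2 (insert f1 F))"
proof -
  obtain x w f1 where f: "f2 = {x, w}" "f1 \<in> witnesses V E F (x, w)" "f1 \<in> D"
    using f2 unfolding closers_def by blast
  then obtain y z where yz: "f1 = {y, z}" "f1 \<in> E" "y \<in> path_ends V F x" "succ_in (the_path V F x y) z = w"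
    by (auto simp: witnesses_def)
  let ?P = "the_path V F x y" and ?F = "insert f2 (insert f1 F)"
  note P = the_path[OF yz(3)]
  have "z \<in> V" "z \<noteq> last ?P" using yz edge_in_V edge_neq unfolding P(3) by blast+
  then have "(\<exists>vs. distinct vs \<and> set vs = V \<and> 3 \<le> length vs \<and> cycle_edges vs \<subseteq> ?F) \<or>
    (\<exists>ys. is_path ?F ys \<and> set ys \<subseteq> V \<and> length ?P < length ys)"
    using f yz P by (intro booster_lengthens[OF con P(1) many_path_ends(3)[OF FE ex P(1)]]) auto
  moreover have "length xs \<le> length ?P" if "is_path F xs" "set xs \<subseteq> V" for xs
    using P(1) that by (simp add: longest_path_def)
  ultimately show ?thesis
    by (intro that[of f1] f(3)) (metis boosts_def spanning_cycle_def le_less_trans)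
qed

text \<open>The smaller the threshold \<open>m\<close>, the stronger is \<open>rich\<close>; the
  common value is the smallest of the three size guarantees, that of the demand hitters.\<close>

definition progress_rich :: "real \<Rightarrow> real \<Rightarrow> nat \<Rightarrow> 'a edge_coloring \<Rightarrow> bool" where
  "progress_rich k r c0 H \<longleftrightarrow>
     (let m = (\<gamma> * \<epsilon>)\<^sup>2 / 128 * (real n)\<^sup>2 in
      rich k m r c0 H (\<lambda>F. hitters E (\<gamma> * \<epsilon> / 4) split_pairs cross_edges) \<and>
      rich k m r c0 H (\<lambda>F. hitters E (\<gamma> * \<epsilon> / (16 * n)) (demands V E \<epsilon> F) (witnesses V E F)) \<and>
      rich k m r c0 H (closers V E \<epsilon>))"

lemma booster_step:
  fixes k r :: real and J :: nat
  assumes rich: "progress_rich k r c0 H" and R: "finite R" "card R < r" and HE: "dom H \<subseteq> E"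
    and F: "F \<subseteq> dom H" "inj_on H F" "F \<inter> R = {}" "expander V F (\<gamma> * n)" "cut_connected V F"
    and k: "card F + J \<le> k" and J: "exp (- (\<gamma> * \<epsilon> * J / (16 * n))) \<le> \<gamma> * \<epsilon> / 4"
  obtains f1 f2 where "insert f2 (insert f1 F) \<subseteq> dom H" "inj_on H (insert f2 (insert f1 F))"
    "insert f2 (insert f1 F) \<inter> R = {}"
    "boosts V F (insert f2 (insert f1 F))"
proof -
  define m where "m = (\<gamma> * \<epsilon>)\<^sup>2 / 128 * (real n)\<^sup>2"
  have rich2: "rich k m r c0 H (\<lambda>F. hitters E (\<gamma> * \<epsilon> / (16 * n)) (demands V E \<epsilon> F) (witnesses V E F))"
    and rich3: "rich k m r c0 H (closers V E \<epsilon>)"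
    using rich unfolding progress_rich_def Let_def m_def by simp_all
  have FE: "F \<subseteq> E" using F HE by blast
  have finF: "finite F" using FE finE finite_subset by blast
  define \<theta> where "\<theta> = \<gamma> * \<epsilon> / (16 * n)"
  define thr where "thr = \<gamma> * \<epsilon> / 4 * (real n)\<^sup>2"
  let ?U = "demands V E \<epsilon> F" and ?\<Gamma> = "witnesses V E F"
  note ge = gamma_eps
  have \<theta>: "0 \<le> \<theta>" "\<theta> \<le> 1"
  proof -
    show "0 \<le> \<theta>" using ge by (simp add: \<theta>_def)
    have "\<gamma> * \<epsilon> \<le> 16 * real n" using ge n_pos by linarith
    then show "\<theta> \<le> 1" using n_pos by (simp add: \<theta>_def)
  qed
  have big: "m \<le> card (hitters E \<theta> ?U ?\<Gamma> D)" if "thr < card (unhit ?U ?\<Gamma> D)" for D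
    unfolding m_def \<theta>_def using that unfolding thr_def by (rule many_demand_hitters[OF FE F(4)])
  have "\<exists>D. finite D \<and> D \<subseteq> dom H \<and> D \<subseteq> E \<and> D \<inter> R = {} \<and> D \<inter> F = {} \<and> card D \<le> J \<and>
    (\<forall>e\<in>D. \<exists>j\<in>{1..c0}. H e = Some j \<and> Some j \<notin> H ` F) \<and> inj_on H D \<and>
    (card (unhit ?U ?\<Gamma> D) \<le> thr \<or> card (unhit ?U ?\<Gamma> D) \<le> (1 - \<theta>) ^ J * card ?U)"
    by (rule greedy_hitting[OF rich2[folded \<theta>_def] refl finite_demands finF F(1) R big k \<theta>])
  then obtain D where D: "finite D" "D \<subseteq> dom H" "D \<subseteq> E" "D \<inter> R = {}" "D \<inter> F = {}" "card D \<le> J"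
    "\<forall>e\<in>D. \<exists>j\<in>{1..c0}. H e = Some j \<and> Some j \<notin> H ` F" "inj_on H D"
    "card (unhit ?U ?\<Gamma> D) \<le> thr \<or> card (unhit ?U ?\<Gamma> D) \<le> (1 - \<theta>) ^ J * card ?U"
    by (elim exE conjE)
  have "(1 - \<theta>) ^ J * card ?U \<le> thr"
  proof -
    have "(1 - \<theta>) ^ J \<le> exp (- \<theta> * J)" using \<theta> by (intro one_minus_power_le_exp) auto
    also have "- \<theta> * J = - (\<gamma> * \<epsilon> * J / (16 * n))" by (simp add: \<theta>_def)
    also note J
    finally have "(1 - \<theta>) ^ J * card ?U \<le> \<gamma> * \<epsilon> / 4 * (real n)\<^sup>2"
      using card_demands ge by (intro mult_mono) auto
    then show ?thesis by (simp add: thr_def)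
  qed
  then have un: "card (unhit ?U ?\<Gamma> D) \<le> \<gamma> * \<epsilon> / 4 * (real n)\<^sup>2" using D(9) unfolding thr_def by linarith
  have "m \<le> \<gamma> * \<epsilon> / 4 * (real n)\<^sup>2"
  proof -
    have "(\<gamma> * \<epsilon>)\<^sup>2 \<le> \<gamma> * \<epsilon> * 1" unfolding power2_eq_square using ge by (intro mult_left_mono) auto
    then have "(\<gamma> * \<epsilon>)\<^sup>2 / 128 \<le> \<gamma> * \<epsilon> / 4" using ge by simp
    then show ?thesis unfolding m_def by (intro mult_right_mono) auto
  qed
  also have "\<dots> \<le> card (closers V E \<epsilon> F D)" by (rule many_closers[OF FE F(4) un])
  finally have m: "m \<le> card (closers V E \<epsilon> F D)" .
  have "card (F \<union> D) \<le> card F + card D" by (rule card_Un_le)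
  then have c: "card (F \<union> D) \<le> k" using D(6) k by linarith
  have d: "F \<inter> D = {}" using D(5) by blast
  obtain f2 j where f2: "f2 \<in> closers V E \<epsilon> F D" "f2 \<notin> R" "j \<in> {1..c0}" "H f2 = Some j"
    "Some j \<notin> H ` (F \<union> D)"
    by (rule rich_obtain[OF rich3 F(1) D(2) d c m R])
  \<comment> \<open>Only \<open>f1\<close> is kept from \<open>D\<close>, so \<open>F\<close> grows
    by at most two edges. The colour of \<open>f2\<close> avoids those of all of
    \<open>F \<union> D\<close> and thus differs from that of \<open>f1\<close>, whichever helper
    this turns out to be.\<close>
  obtain f1 where f1: "f1 \<in> D" "boosts V F (insert f2 (insert f1 F))"
    by (rule closer_lengthens[OF FE F(4,5) f2(1)])
  have "H f1 \<notin> H ` F"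
  proof -
    obtain i where "H f1 = Some i" "Some i \<notin> H ` F" using D(7) f1(1) by blast
    then show ?thesis by simp
  qed
  then have "H f1 \<notin> H ` (F - {f1})" by blast
  then have i1: "inj_on H (insert f1 F)" unfolding inj_on_insert using F(2) by (intro conjI)
  have "H f2 \<notin> H ` insert f1 F" using f2(4,5) f1(1) by auto
  then have "H f2 \<notin> H ` (insert f1 F - {f2})" by blast
  then have i2: "inj_on H (insert f2 (insert f1 F))"
    unfolding inj_on_insert[of H f2 "insert f1 F"] using i1 by (intro conjI)
  show ?thesis
  proof (rule that[OF _ i2 _ f1(2)])
    show "insert f2 (insert f1 F) \<subseteq> dom H" using F(1) D(2) f1(1) f2(4) by auto
    show "insert f2 (insert f1 F) \<inter> R = {}" using F(3) D(4) f1(1) f2(2) by auto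
  qed
qed

text \<open>\<open>d\<close> counts the rounds left. A round keeps at most two new edges and reuses
  the allowance of \<open>J\<close> helpers. The strict inequality \<open>n < length xs + d\<close>
  leaves one round for closing a path that already covers \<open>V\<close>; at \<open>d = 0\<close>
  it is contradictory.\<close>

lemma expander_to_cycle:
  fixes k r :: real and J :: nat
  assumes rich: "progress_rich k r c0 H" and R: "finite R" "card R < r" and HE: "dom H \<subseteq> E"
    and J: "exp (- (\<gamma> * \<epsilon> * J / (16 * n))) \<le> \<gamma> * \<epsilon> / 4"
    and "F \<subseteq> dom H" "inj_on H F" "F \<inter> R = {}" "expander V F (\<gamma> * n)" "cut_connected V F"
    and "is_path F xs" "set xs \<subseteq> V" "n < length xs + d"
    and "card F + 2 * d + J \<le> k"
  shows "\<exists>F'. F' \<subseteq> dom H \<and> inj_on H F' \<and> F' \<inter> R = {} \<and> spanning_cycle V F'"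
  using assms(6-)
proof (induction d arbitrary: F xs)
  case 0
  have "length xs = card (set xs)" using 0 by (simp add: is_path_def distinct_card)
  also have "\<dots> \<le> n" unfolding cardV[symmetric] using 0 finV by (intro card_mono) auto
  finally show ?case using 0 by simp
next
  case (Suc d)
  have k: "card F + J \<le> k" using Suc.prems(9) by simp
  obtain f1 f2 where f: "insert f2 (insert f1 F) \<subseteq> dom H" "inj_on H (insert f2 (insert f1 F))"
    "insert f2 (insert f1 F) \<inter> R = {}"
    "boosts V F (insert f2 (insert f1 F))"
    by (rule booster_step[OF rich R HE Suc.prems(1-5) k J])
  let ?F = "insert f2 (insert f1 F)"
  show ?case
  proof (cases "spanning_cycle V ?F")
    case True
    then show ?thesis using f by blast
  next
    case False
    then obtain ys where ys: "is_path ?F ys" "set ys \<subseteq> V" "length xs < length ys"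
      using f(4) Suc.prems(6,7) unfolding boosts_def by blast
    show ?thesis
    proof (rule Suc.IH[OF f(1-3) _ _ ys(1,2)])
      have FE: "?F \<subseteq> E" using f(1) HE by (rule subset_trans)
      show "expander V ?F (\<gamma> * n)" using Suc.prems(4) by (rule expander_mono) (use finite_nbhd[OF FE] in auto)
      show "cut_connected V ?F" using Suc.prems(5) by (rule cut_connected_mono) auto
      show "n < length ys + d" using ys(3) Suc.prems(8) by simp
      have "finite F" using finite_subset[OF FE finE] by simp
      then have "card ?F \<le> card F + 2" by (simp add: card_insert_if)
      then have "card ?F + 2 * d + J \<le> card F + 2 * Suc d + J" by simp
      then show "card ?F + 2 * d + J \<le> k" using Suc.prems(9) by linarith
    qed
  qed
qed

end

section \<open>Packing rainbow Hamilton cycles\<close>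

lemma rich_mono: "rich k m r c0 H \<tau> \<Longrightarrow> m \<le> m' \<Longrightarrow> rich k m' r c0 H \<tau>"
  unfolding rich_def by (meson order_trans)

lemma is_path_path_edges: "distinct xs \<Longrightarrow> xs \<noteq> [] \<Longrightarrow> is_path (path_edges xs) xs"
proof (induction xs)
  case (Cons a xs)
  show ?case
  proof (cases "xs = []")
    case False
    then have "is_path (path_edges xs) xs" using Cons by simp
    then have "is_path (path_edges (a # xs)) xs"
      by (rule is_path_mono) (simp add: path_edges_Cons subset_insertI)
    then show ?thesis using Cons.prems False by (simp add: is_path_Cons path_edges_Cons)
  qed simp
qed simp

text \<open>Removing \<open>t\<close> earlier cycles thus costs a vertex at most
  \<open>4 * t\<close> edges, which its degree in the reserved colours absorbs.\<close>

lemma cycle_edges_nbrs: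
  assumes "distinct vs" "vs \<noteq> []"
  shows "card {u. {v, u} \<in> cycle_edges vs} \<le> 4" "finite {u. {v, u} \<in> cycle_edges vs}"
proof -
  let ?F = "insert {last vs, hd vs} (path_edges vs)"
  have "is_path ?F vs" using is_path_path_edges[OF assms] by (rule is_path_mono) blast
  then have "cycle_edges vs \<subseteq> ?F" by (rule cycle_edges_subset) simp
  then have sub: "{u. {v, u} \<in> cycle_edges vs} \<subseteq> {u. \<exists>y\<in>{v}. {u, y} \<in> path_edges vs} \<union> {last vs, hd vs}"
    by (auto simp: insert_commute doubleton_eq_iff)
  have fin: "finite {u. \<exists>y\<in>{v}. {u, y} \<in> path_edges vs}"
    using assms(1) by (rule card_path_nbrs) simp
  show "finite {u. {v, u} \<in> cycle_edges vs}" by (rule finite_subset[OF sub]) (use fin in simp)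
  have "card {u. {v, u} \<in> cycle_edges vs} \<le> card ({u. \<exists>y\<in>{v}. {u, y} \<in> path_edges vs} \<union> {last vs, hd vs})"
    by (rule card_mono[OF _ sub]) (use fin in simp)
  also have "\<dots> \<le> card {u. \<exists>y\<in>{v}. {u, y} \<in> path_edges vs} + card {last vs, hd vs}" by (rule card_Un_le)
  also have "card {u. \<exists>y\<in>{v}. {u, y} \<in> path_edges vs} \<le> 2 * card {v}"
    using assms(1) by (rule card_path_nbrs) simp
  also have "card {last vs, hd vs} \<le> 2" by (simp add: card_insert_if)
  finally show "card {u. {v, u} \<in> cycle_edges vs} \<le> 4" by simp
qed

lemma card_cycle_edges: "card (cycle_edges vs) \<le> length vs" "finite (cycle_edges vs)"
proof -
  have e: "cycle_edges vs = (\<lambda>i. {vs ! i, vs ! (Suc i mod length vs)}) ` {..<length vs}"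
    by (auto simp: cycle_edges_def)
  show "finite (cycle_edges vs)" unfolding e by simp
  have "card (cycle_edges vs) \<le> card {..<length vs}" unfolding e by (rule card_image_le) simp
  then show "card (cycle_edges vs) \<le> length vs" by simp
qed

context dirac_host
begin

definition colour_nbrs :: "nat set \<Rightarrow> 'a edge_coloring \<Rightarrow> 'a \<Rightarrow> 'a set" where
  "colour_nbrs C H v = {u \<in> V. {v, u} \<in> dom H \<and> H {v, u} \<in> Some ` C}"

text \<open>The set \<open>L\<close> is found by looking at \<open>H\<close>, so the spreading
  hypothesis of \<open>rainbow_stars\<close> is required of all small nonempty sets.\<close>

definition star_spread :: "nat set \<Rightarrow> nat \<Rightarrow> 'a edge_coloring \<Rightarrow> bool" where
  "star_spread C1 s0 H \<longleftrightarrow> (\<forall>L\<subseteq>V. L \<noteq> {} \<longrightarrow> card L \<le> \<gamma> * n \<longrightarrow> (\<forall>B\<subseteq>V. \<forall>Y\<subseteq>C1.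
     card B \<le> 96 * card L \<longrightarrow> card Y \<le> 96 * card L \<longrightarrow>
     4 * card (star_edges V H L B Y) \<le> card L * s0))"

lemma rainbow_spanning_cycle:
  fixes k r :: real and K1 J s0 :: nat
  assumes rich: "progress_rich k r c0 H" and HE: "dom H \<subseteq> E"
    and R: "finite R" "card R < r"
    and J: "exp (- (\<gamma> * \<epsilon> * J / (16 * n))) \<le> \<gamma> * \<epsilon> / 4"
    and K1: "8 * n \<le> \<gamma> * \<epsilon> * K1" and k: "K1 + 3 * n + J \<le> k"
    and C1: "finite C1" "C1 \<inter> {1..c0} = {}" and s0: "s0 > 0"
    and avail: "\<And>v. v \<in> V \<Longrightarrow> s0 \<le> card {u \<in> V. {v, u} \<in> dom H - R \<and> H {v, u} \<in> Some ` C1}"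
    and spread: "star_spread C1 s0 H"
  shows "\<exists>F. F \<subseteq> dom H \<and> inj_on H F \<and> F \<inter> R = {} \<and> spanning_cycle V F"
proof -
  let ?m = "(\<gamma> * \<epsilon>)\<^sup>2 / 128 * (real n)\<^sup>2"
  have rich1: "rich k ?m r c0 H (\<lambda>F. hitters E (\<gamma> * \<epsilon> / 4) split_pairs cross_edges)"
    using rich unfolding progress_rich_def Let_def by simp_all
  note ge = gamma_eps
  have "?m \<le> \<gamma> * \<epsilon> / 4 * (real n)\<^sup>2"
  proof (rule mult_right_mono)
    have "(\<gamma> * \<epsilon>)\<^sup>2 \<le> \<gamma> * \<epsilon> * 1" unfolding power2_eq_square using ge by (intro mult_left_mono) auto
    then show "(\<gamma> * \<epsilon>)\<^sup>2 / 128 \<le> \<gamma> * \<epsilon> / 4" using ge by simp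
  qed simp
  then have rich1': "rich k (\<gamma> * \<epsilon> / 4 * (real n)\<^sup>2) r c0 H
      (\<lambda>F. hitters E (\<gamma> * \<epsilon> / 4) split_pairs cross_edges)"
    by (rule rich_mono[OF rich1])
  have "real K1 \<le> k" using k by simp
  from hit_all_split_pairs[OF rich1' R this K1] obtain D where
    D: "finite D" "D \<subseteq> dom H" "D \<subseteq> E" "D \<inter> R = {}" "card D \<le> K1" "inj_on H D"
      "\<forall>e\<in>D. \<exists>j\<in>{1..c0}. H e = Some j" "\<forall>P\<in>split_pairs. cross_edges P \<inter> D \<noteq> {}"
    by (elim exE conjE)
  have hit: "cross_edges P \<inter> D \<noteq> {}" if "P \<in> split_pairs" for P using D(8) that by blast
  obtain L where L: "L \<subseteq> V" "card L \<le> \<gamma> * n"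
    "\<And>S. S \<subseteq> V - L \<Longrightarrow> S \<noteq> {} \<Longrightarrow> card S \<le> \<gamma> * n \<Longrightarrow> 10 * card S \<le> card (nbhd D S - L)"
    using expanding_core[OF D(3) hit] by metis
  have finL: "finite L" using finite_subset[OF L(1) finV] .
  have finH: "finite (dom H)" using finite_subset[OF HE finE] .
  have "\<exists>st. (\<forall>l\<in>L. \<forall>i<6::nat. st (l, i) \<in> V \<and> {l, st (l, i)} \<in> dom H - R \<and> H {l, st (l, i)} \<in> Some ` C1) \<and>
    (\<forall>p\<in>L \<times> {..<6}. \<forall>q\<in>L \<times> {..<6}. p \<noteq> q \<longrightarrow>
       st p \<noteq> st q \<and> H {fst p, st p} \<noteq> H {fst q, st q})"
  proof (rule rainbow_stars[OF finV L(1) C1(1) s0 _ _ finH])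
    show "s0 \<le> card {u \<in> V. {l, u} \<in> dom H - R \<and> H {l, u} \<in> Some ` C1}" if "l \<in> L" for l
      using that L(1) by (intro avail) blast
    fix L' B Y assume L': "L' \<subseteq> L" "L' \<noteq> {}" and BY: "B \<subseteq> V" "Y \<subseteq> C1" "card B \<le> 96 * card L'" "card Y \<le> 96 * card L'"
    have "card L' \<le> card L" using card_mono[OF finL L'(1)] .
    then have "card L' \<le> \<gamma> * n" using L(2) by linarith
    moreover have "L' \<subseteq> V" using L' L(1) by blast
    ultimately show "4 * card (star_edges V H L' B Y) \<le> card L' * s0"
      using spread L'(2) BY unfolding star_spread_def by simp
  qed
  then obtain st where st: "\<forall>l\<in>L. \<forall>i<6::nat. st (l, i) \<in> V \<and> {l, st (l, i)} \<in> dom H - R \<and> H {l, st (l, i)} \<in> Some ` C1"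
    "\<forall>p\<in>L \<times> {..<6}. \<forall>q\<in>L \<times> {..<6}. p \<noteq> q \<longrightarrow> st p \<noteq> st q \<and> H {fst p, st p} \<noteq> H {fst q, st q}"
    by (elim exE conjE)
  define g where "g p = {fst p, st p}" for p
  define Q where "Q = g ` (L \<times> {..<6::nat})"
  define F where "F = D \<union> Q"
  have Q: "Q \<subseteq> dom H" "Q \<inter> R = {}" "\<And>e. e \<in> Q \<Longrightarrow> H e \<in> Some ` C1"
    using st(1) by (force simp: Q_def g_def)+
  have injQ: "inj_on H Q"
  proof (rule inj_onI)
    fix e e' assume ee: "e \<in> Q" "e' \<in> Q" "H e = H e'"
    then obtain p q where pq: "p \<in> L \<times> {..<6}" "q \<in> L \<times> {..<6}" "e = g p" "e' = g q"
      unfolding Q_def by blast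
    then have "p = q" using ee(3) st(2) unfolding g_def by metis
    then show "e = e'" using pq by simp
  qed
  have FH: "F \<subseteq> dom H" using D(2) Q(1) by (simp add: F_def)
  have FE: "F \<subseteq> E" using FH HE by (rule subset_trans)
  have FR: "F \<inter> R = {}" using D(4) Q(2) unfolding F_def by blast
  have injF: "inj_on H F"
  proof -
    \<comment> \<open>Edges of \<open>D\<close> have colours in \<open>{1..c0}\<close>, star edges
      have colours in the disjoint class \<open>C1\<close>.\<close>
    have "H e \<noteq> H e'" if "e \<in> D" "e' \<in> Q" for e e'
    proof -
      obtain j where j: "j \<in> {1..c0}" "H e = Some j" using D(7) \<open>e \<in> D\<close> by blast
      obtain i where i: "i \<in> C1" "H e' = Some i" using Q(3)[OF \<open>e' \<in> Q\<close>] by blast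
      have "i \<noteq> j" using i j C1(2) by blast
      then show ?thesis using i j by simp
    qed
    note ne = this
    have "H ` (D - Q) \<inter> H ` (Q - D) = {}"
    proof (rule equals0I)
      fix y assume "y \<in> H ` (D - Q) \<inter> H ` (Q - D)"
      then obtain e e' where "e \<in> D" "e' \<in> Q" "y = H e" "y = H e'" by blast
      then show False using ne[of e e'] by simp
    qed
    then show ?thesis unfolding F_def inj_on_Un using D(6) injQ by blast
  qed
  \<comment> \<open>The stars have at most \<open>6 * \<gamma> * n\<close> edges, well below
    \<open>n\<close>. Of the \<open>3 * n\<close> in the budget, one \<open>n\<close> pays for them
    and \<open>2 * n\<close> for the booster rounds.\<close>
  have "card F \<le> K1 + n"
  proof -
    have "card Q \<le> card (L \<times> {..<6::nat})" unfolding Q_def using finL by (intro card_image_le) simp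
    also have "\<dots> = 6 * card L" by (simp add: card_cartesian_product)
    finally have "real (card Q) \<le> 6 * real (card L)" by linarith
    also have "\<dots> \<le> 6 * \<gamma> * n" using L(2) by simp
    also have "6 * \<gamma> * n \<le> 1 * real n" using gam by (intro mult_right_mono) auto
    finally have "card Q \<le> n" by simp
    then show ?thesis using card_Un_le[of D Q] D(5) unfolding F_def by linarith
  qed
  then have kF: "card F + 2 * n + J \<le> k" using k by linarith
  have inj_st: "inj_on st (L \<times> {..<6::nat})" using st(2) unfolding inj_on_def by blast
  have stF: "{l, st (l, i)} \<in> F" if "l \<in> L" "i < 6" for l i
    using that by (force simp: F_def Q_def g_def)
  have DF: "D \<subseteq> F" by (simp add: F_def)
  note exp = stars_make_expander[OF D(3) hit L(1,3) inj_st stF DF FE]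
  obtain v where v: "v \<in> V" using cardV n_pos by fastforce
  show ?thesis
  proof (rule expander_to_cycle[OF rich R HE J FH injF FR])
    \<comment> \<open>A single vertex already has length one, so \<open>n\<close> rounds suffice,
      including the one that closes the cycle.\<close>
    show "is_path F [v]" "set [v] \<subseteq> V" "n < length [v] + n" using v by simp_all
  qed (use exp kF in simp_all)
qed

text \<open>The properties of \<open>H\<close> are uniform in the forbidden set \<open>R\<close>, so
  the same \<open>H\<close> serves every cycle as long as the earlier ones together have fewer than
  \<open>r\<close> edges and take few edges at each vertex.\<close>

lemma rainbow_packing:
  fixes k r :: real and K1 J s0 t :: nat
  assumes rich: "progress_rich k r c0 H" and HE: "dom H \<subseteq> E" and t: "t * n < r"
    and J: "exp (- (\<gamma> * \<epsilon> * J / (16 * n))) \<le> \<gamma> * \<epsilon> / 4"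
    and K1: "8 * n \<le> \<gamma> * \<epsilon> * K1" and k: "K1 + 3 * n + J \<le> k"
    and C1: "finite C1" "C1 \<inter> {1..c0} = {}" and s0: "s0 > 0"
    and avail: "\<And>v. v \<in> V \<Longrightarrow> s0 + 4 * t \<le> card (colour_nbrs C1 H v)"
    and spread: "star_spread C1 s0 H"
  shows "has_disjoint_rainbow_hamilton_cycles V H t"
proof -
  let ?good = "\<lambda>F. hamilton_cycle (V, dom H) F \<and> rainbow H F"
  have "\<exists>\<F>. finite \<F> \<and> card \<F> = i \<and> pairwise disjnt \<F> \<and> (\<forall>F\<in>\<F>. ?good F)" if "i \<le> t" for i
    using that
  proof (induction i)
    case 0
    then show ?case by (intro exI[of _ "{}"]) simp
  next
    case (Suc i)
    then have it: "i \<le> t" by simp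
    from Suc.IH[OF it] obtain \<F> where \<F>: "finite \<F>" "card \<F> = i" "pairwise disjnt \<F>" "\<forall>F\<in>\<F>. ?good F"
      by (elim exE conjE)
    define R where "R = \<Union>\<F>"
    have cyc: "\<exists>vs. distinct vs \<and> set vs = V \<and> vs \<noteq> [] \<and> F = cycle_edges vs" if "F \<in> \<F>" for F
      using \<F>(4) that unfolding hamilton_cycle_def by fastforce
    have finF: "finite F" if "F \<in> \<F>" for F using cyc[OF that] card_cycle_edges(2) by blast
    have cardF: "card F \<le> n" if "F \<in> \<F>" for F
      using cyc[OF that] card_cycle_edges(1) cardV by (metis distinct_card)
    have nbF: "card {u. {v, u} \<in> F} \<le> 4 \<and> finite {u. {v, u} \<in> F}" if "F \<in> \<F>" for F v
      using cyc[OF that] cycle_edges_nbrs by metis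
    have finR: "finite R" unfolding R_def using \<F>(1) finF by blast
    have "card R \<le> (\<Sum>F\<in>\<F>. card F)" unfolding R_def by (rule card_Union_le_sum_card)
    also have "\<dots> \<le> (\<Sum>F\<in>\<F>. n)" by (intro sum_mono cardF)
    also have "\<dots> \<le> t * n" using \<F>(2) it by simp
    finally have "card R \<le> t * n" .
    then have cR: "card R < r" using t by linarith
    have av: "s0 \<le> card {u \<in> V. {v, u} \<in> dom H - R \<and> H {v, u} \<in> Some ` C1}" if v: "v \<in> V" for v
    proof -
      let ?A = "colour_nbrs C1 H v"
      let ?A' = "{u \<in> V. {v, u} \<in> dom H - R \<and> H {v, u} \<in> Some ` C1}"
      let ?N = "\<Union>F\<in>\<F>. {u. {v, u} \<in> F}"
      have finN: "finite ?N" using \<F>(1) nbF by blast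
      have "card ?N \<le> (\<Sum>F\<in>\<F>. card {u. {v, u} \<in> F})" using \<F>(1) by (rule card_UN_le)
      also have "\<dots> \<le> (\<Sum>F\<in>\<F>. 4)" by (intro sum_mono) (use nbF in blast)
      finally have N: "card ?N \<le> 4 * t" using \<F>(2) it by simp
      have "?A \<subseteq> ?A' \<union> ?N" unfolding R_def colour_nbrs_def by blast
      then have "card ?A \<le> card (?A' \<union> ?N)" by (intro card_mono) (use finV finN in simp_all)
      also have "\<dots> \<le> card ?A' + card ?N" by (rule card_Un_le)
      finally show ?thesis using N avail[OF v] by linarith
    qed
    have "\<exists>F. F \<subseteq> dom H \<and> inj_on H F \<and> F \<inter> R = {} \<and> spanning_cycle V F"
      by (rule rainbow_spanning_cycle[OF rich HE finR cR J K1 k C1 s0 av spread])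
    then obtain F vs where F: "F \<subseteq> dom H" "inj_on H F" "F \<inter> R = {}"
      and vs: "distinct vs" "set vs = V" "3 \<le> length vs" "cycle_edges vs \<subseteq> F"
      unfolding spanning_cycle_def by (elim exE conjE)
    let ?C = "cycle_edges vs"
    have C: "?good ?C"
    proof
      have "?C \<subseteq> dom H" using vs(4) F(1) by (rule subset_trans)
      then show "hamilton_cycle (V, dom H) ?C" unfolding hamilton_cycle_def using vs by auto
      show "rainbow H ?C" unfolding rainbow_def
        using \<open>?C \<subseteq> dom H\<close> inj_on_subset[OF F(2) vs(4)] by blast
    qed
    \<comment> \<open>A nonempty cycle disjoint from the earlier ones differs from all of them, so
      the family really grows by one.\<close>
    have "{vs ! 0, vs ! (Suc 0 mod length vs)} \<in> ?C"
      unfolding cycle_edges_def using vs(3) by (intro CollectI exI[of _ 0]) auto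
    then have ne: "?C \<noteq> {}" by blast
    have dis: "disjnt ?C F'" if "F' \<in> \<F>" for F'
      using F(3) vs(4) that unfolding R_def disjnt_def by blast
    have new: "?C \<notin> \<F>" using dis ne unfolding disjnt_def by blast
    show ?case
    proof (intro exI[of _ "insert ?C \<F>"] conjI)
      show "finite (insert ?C \<F>)" "card (insert ?C \<F>) = Suc i" using \<F> new by simp_all
      show "pairwise disjnt (insert ?C \<F>)"
        using \<F>(3) dis by (auto simp: pairwise_insert disjnt_sym)
      show "\<forall>F\<in>insert ?C \<F>. ?good F" using C \<F>(4) by blast
    qed
  qed
  from this[of t] show ?thesis unfolding has_disjoint_rainbow_hamilton_cycles_def by auto
qed

end

section \<open>Independent edge states\<close>

definition edge_state_pmf :: "nat \<Rightarrow> real \<Rightarrow> nat option pmf" where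
  "edge_state_pmf c p = bind_pmf (bernoulli_pmf p)
     (\<lambda>b. if b then map_pmf Some (pmf_of_set {1..c}) else return_pmf None)"

definition edge_states_pmf :: "'a set set \<Rightarrow> nat \<Rightarrow> real \<Rightarrow> 'a edge_coloring pmf" where
  "edge_states_pmf E c p = Pi_pmf E None (\<lambda>_. edge_state_pmf c p)"

text \<open>Keeping and colouring merge into one independent state per edge, \<open>None\<close> for
  an edge that is not kept. The later estimates all use this product measure.\<close>

lemma random_colored_graph_eq:
  assumes "finite (edges G)"
  shows "random_colored_graph c G p = edge_states_pmf (edges G) c p"
proof -
  let ?E = "edges G" and ?Q = "map_pmf Some (pmf_of_set {1..c})"
  have "edge_states_pmf ?E c p
      = bind_pmf (Pi_pmf ?E False (\<lambda>_. bernoulli_pmf p))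
          (\<lambda>f. Pi_pmf ?E None (\<lambda>x. if f x then ?Q else return_pmf None))"
    unfolding edge_states_pmf_def edge_state_pmf_def using assms by (rule Pi_pmf_bind)
  also have "\<dots> = random_colored_graph c G p"
    unfolding random_colored_graph_def random_edges_def bind_map_pmf
    by (simp add: Pi_pmf_if_set[OF assms])
  finally show ?thesis ..
qed

lemma pmf_edge_state_Some:
  assumes "0 \<le> p" "p \<le> 1" "j \<in> {1..c}"
  shows "pmf (edge_state_pmf c p) (Some j) = p / c"
proof -
  have "pmf (map_pmf Some (pmf_of_set {1..c})) (Some j) = pmf (pmf_of_set {1..c}) j"
    by (rule pmf_map_inj') simp
  also have "\<dots> = 1 / c" using assms(3) by (subst pmf_of_set) auto
  finally show ?thesis
    using assms by (simp add: edge_state_pmf_def pmf_bind integral_bernoulli_pmf)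
qed

lemma prob_edge_state_colours:
  assumes "0 \<le> p" "p \<le> 1" "S \<subseteq> {1..c}"
  shows "measure_pmf.prob (edge_state_pmf c p) (Some ` S) = p * card S / c"
proof -
  have "finite S" using assms(3) finite_subset by blast
  then have "measure_pmf.prob (edge_state_pmf c p) (Some ` S) = (\<Sum>x\<in>Some ` S. pmf (edge_state_pmf c p) x)"
    by (intro measure_measure_pmf_finite) simp
  also have "\<dots> = (\<Sum>j\<in>S. pmf (edge_state_pmf c p) (Some j))" by (subst sum.reindex) auto
  also have "\<dots> = (\<Sum>j\<in>S. p / c)"
    using assms pmf_edge_state_Some by (intro sum.cong refl) blast
  finally show ?thesis by simp
qed

lemma prob_edge_state_present:
  assumes "0 \<le> p" "p \<le> 1"
  shows "measure_pmf.prob (edge_state_pmf c p) (- {None}) = p"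
proof -
  have "pmf (map_pmf Some (pmf_of_set {1..c})) None = 0"
    by (simp add: pmf_map vimage_def)
  then have "pmf (edge_state_pmf c p) None = 1 - p"
    using assms by (simp add: edge_state_pmf_def pmf_bind integral_bernoulli_pmf)
  then have "measure_pmf.prob (edge_state_pmf c p) {None} = 1 - p" by (simp add: measure_pmf_single)
  then show ?thesis using measure_pmf.prob_compl[of "{None}" "edge_state_pmf c p"] by (simp add: Compl_eq_Diff_UNIV)
qed

section \<open>Exponential moments and Chernoff bounds\<close>

lemma integrable_pmf_indicator: "integrable (measure_pmf P) (indicator A :: _ \<Rightarrow> real)"
  by (rule measure_pmf.integrable_const_bound[where B = 1]) auto

lemma prob_le_expectation:
  fixes f :: "'a \<Rightarrow> real"
  assumes "integrable (measure_pmf P) f" "\<And>x. 0 \<le> f x" "\<And>x. x \<in> A \<Longrightarrow> 1 \<le> f x"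
  shows "measure_pmf.prob P A \<le> measure_pmf.expectation P f"
proof -
  have "measure_pmf.prob P A = measure_pmf.expectation P (indicator A)" by simp
  also have "\<dots> \<le> measure_pmf.expectation P f"
    using assms by (intro integral_mono integrable_pmf_indicator) (auto simp: indicator_def)
  finally show ?thesis .
qed

text \<open>The power is a product of independent factors, each \<open>a\<close> on
  \<open>B e\<close> and \<open>1\<close> elsewhere; then \<open>1 + x \<le> exp x\<close> is
  applied to every factor.\<close>

lemma expectation_power_count:
  fixes E :: "'i set" and D :: "'i \<Rightarrow> 'b pmf" and B :: "'i \<Rightarrow> 'b set" and a :: real
  assumes E: "finite E" and a: "a > 0"
  defines "N \<equiv> (\<lambda>\<omega>. card {e \<in> E. \<omega> e \<in> B e})"
  shows "integrable (measure_pmf (Pi_pmf E d D)) (\<lambda>\<omega>. a ^ N \<omega>)"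
    and "measure_pmf.expectation (Pi_pmf E d D) (\<lambda>\<omega>. a ^ N \<omega>)
          \<le> exp ((a - 1) * (\<Sum>e\<in>E. measure_pmf.prob (D e) (B e)))"
proof -
  let ?f = "\<lambda>e y. if y \<in> B e then a else 1"
  have N: "a ^ N \<omega> = (\<Prod>e\<in>E. ?f e (\<omega> e))" for \<omega>
    using E by (simp add: N_def prod.If_cases Int_def)
  have int: "integrable (measure_pmf (D e)) (?f e)" for e
    by (rule measure_pmf.integrable_const_bound[where B = "max a 1"]) (use a in auto)
  show "integrable (measure_pmf (Pi_pmf E d D)) (\<lambda>\<omega>. a ^ N \<omega>)"
    unfolding N using E int by (rule integrable_prod_Pi_pmf)
  have one: "measure_pmf.expectation (D e) (?f e) = 1 + (a - 1) * measure_pmf.prob (D e) (B e)" for e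
  proof -
    have "?f e = (\<lambda>y. 1 + (a - 1) * indicator (B e) y)" by (auto simp: indicator_def)
    then have "measure_pmf.expectation (D e) (?f e)
        = measure_pmf.expectation (D e) (\<lambda>y. 1 + (a - 1) * indicator (B e) y)" by simp
    also have "\<dots> = 1 + (a - 1) * measure_pmf.prob (D e) (B e)"
      by (subst Bochner_Integration.integral_add) (auto intro: integrable_pmf_indicator)
    finally show ?thesis .
  qed
  have "measure_pmf.expectation (Pi_pmf E d D) (\<lambda>\<omega>. a ^ N \<omega>)
      = (\<Prod>e\<in>E. measure_pmf.expectation (D e) (?f e))"
    unfolding N using E int by (rule expectation_prod_Pi_pmf) (use a in auto)
  also have "\<dots> \<le> (\<Prod>e\<in>E. exp ((a - 1) * measure_pmf.prob (D e) (B e)))"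
  proof (intro prod_mono conjI)
    fix e assume "e \<in> E"
    show "0 \<le> measure_pmf.expectation (D e) (?f e)" using a by (intro integral_nonneg_AE) auto
    show "measure_pmf.expectation (D e) (?f e) \<le> exp ((a - 1) * measure_pmf.prob (D e) (B e))"
      unfolding one by (rule exp_ge_add_one_self)
  qed
  also have "\<dots> = exp ((a - 1) * (\<Sum>e\<in>E. measure_pmf.prob (D e) (B e)))"
    using E by (simp add: exp_sum sum_distrib_left)
  finally show "measure_pmf.expectation (Pi_pmf E d D) (\<lambda>\<omega>. a ^ N \<omega>)
          \<le> exp ((a - 1) * (\<Sum>e\<in>E. measure_pmf.prob (D e) (B e)))" .
qed

text \<open>Exponential moment at \<open>a = exp 1\<close>, with
  \<open>exp 1 - 1 \<le> 2\<close>.\<close>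

lemma chernoff_upper:
  fixes m \<mu> :: real
  assumes E: "finite E" and \<mu>: "(\<Sum>e\<in>E. measure_pmf.prob (D e) (B e)) \<le> \<mu>"
  shows "measure_pmf.prob (Pi_pmf E d D) {\<omega>. m \<le> card {e \<in> E. \<omega> e \<in> B e}} \<le> exp (2 * \<mu> - m)"
proof -
  let ?N = "\<lambda>\<omega>. card {e \<in> E. \<omega> e \<in> B e}"
  let ?S = "\<Sum>e\<in>E. measure_pmf.prob (D e) (B e)"
  note exp1 = expectation_power_count[OF E, of "exp 1" d D B]
  have S0: "0 \<le> ?S" by (intro sum_nonneg) simp
  have "exp 1 \<le> (3::real)" by (rule exp_le)
  have "measure_pmf.prob (Pi_pmf E d D) {\<omega>. m \<le> ?N \<omega>}
      \<le> measure_pmf.expectation (Pi_pmf E d D) (\<lambda>\<omega>. exp (- m) * exp 1 ^ ?N \<omega>)"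
  proof (rule prob_le_expectation)
    show "integrable (measure_pmf (Pi_pmf E d D)) (\<lambda>\<omega>. exp (- m) * exp 1 ^ ?N \<omega>)"
      using exp1(1) by (intro integrable_mult_right) simp
    show "1 \<le> exp (- m) * exp 1 ^ ?N \<omega>" if "\<omega> \<in> {\<omega>. m \<le> ?N \<omega>}" for \<omega>
    proof -
      have "1 \<le> exp (- m + ?N \<omega>)" using that by simp
      then show ?thesis by (simp only: exp_add) (simp flip: exp_of_nat_mult)
    qed
  qed simp
  also have "\<dots> = exp (- m) * measure_pmf.expectation (Pi_pmf E d D) (\<lambda>\<omega>. exp 1 ^ ?N \<omega>)" by simp
  also have "\<dots> \<le> exp (- m) * exp ((exp 1 - 1) * ?S)" using exp1(2) by (intro mult_left_mono) simp_all
  also have "\<dots> \<le> exp (- m) * exp (2 * \<mu>)"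
  proof -
    have "(exp 1 - 1) * ?S \<le> 2 * ?S" using S0 \<open>exp 1 \<le> 3\<close> by (intro mult_right_mono) auto
    then show ?thesis using \<mu> by (intro mult_left_mono) auto
  qed
  finally show ?thesis by (simp add: exp_add[symmetric] algebra_simps)
qed

text \<open>Exponential moment at \<open>a = exp (- 1)\<close>, with
  \<open>1 - exp (- 1) \<ge> 1 / 2\<close>.\<close>

lemma chernoff_lower:
  fixes m \<mu> :: real
  assumes E: "finite E" and \<mu>: "\<mu> \<le> (\<Sum>e\<in>E. measure_pmf.prob (D e) (B e))"
  shows "measure_pmf.prob (Pi_pmf E d D) {\<omega>. card {e \<in> E. \<omega> e \<in> B e} \<le> m} \<le> exp (m - \<mu> / 2)"
proof -
  let ?N = "\<lambda>\<omega>. card {e \<in> E. \<omega> e \<in> B e}"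
  let ?S = "\<Sum>e\<in>E. measure_pmf.prob (D e) (B e)"
  note exp1 = expectation_power_count[OF E, of "exp (- 1)" d D B]
  have S0: "0 \<le> ?S" by (intro sum_nonneg) simp
  have "(2::real) \<le> exp 1" using exp_ge_add_one_self[of 1] by simp
  then have half: "exp (- 1) \<le> (1 / 2 :: real)" by (simp add: exp_minus field_simps)
  have "measure_pmf.prob (Pi_pmf E d D) {\<omega>. ?N \<omega> \<le> m}
      \<le> measure_pmf.expectation (Pi_pmf E d D) (\<lambda>\<omega>. exp m * exp (- 1) ^ ?N \<omega>)"
  proof (rule prob_le_expectation)
    show "integrable (measure_pmf (Pi_pmf E d D)) (\<lambda>\<omega>. exp m * exp (- 1) ^ ?N \<omega>)"
      using exp1(1) by (intro integrable_mult_right) simp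
    show "1 \<le> exp m * exp (- 1) ^ ?N \<omega>" if "\<omega> \<in> {\<omega>. ?N \<omega> \<le> m}" for \<omega>
    proof -
      have "1 \<le> exp (m + (- real (?N \<omega>)))" using that by simp
      then show ?thesis by (simp only: exp_add) (simp flip: exp_of_nat_mult)
    qed
  qed simp
  also have "\<dots> = exp m * measure_pmf.expectation (Pi_pmf E d D) (\<lambda>\<omega>. exp (- 1) ^ ?N \<omega>)" by simp
  also have "\<dots> \<le> exp m * exp ((exp (- 1) - 1) * ?S)" using exp1(2) by (intro mult_left_mono) simp_all
  also have "\<dots> \<le> exp m * exp (- \<mu> / 2)"
  proof -
    have "(exp (- 1) - 1) * ?S \<le> (- 1 / 2) * ?S" using S0 half by (intro mult_right_mono) auto
    then show ?thesis using \<mu> by (intro mult_left_mono) auto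
  qed
  finally show ?thesis by (simp add: exp_add[symmetric])
qed

section \<open>Union bound over exposed sets\<close>

lemma prob_bind_le:
  fixes b :: real
  assumes b: "0 \<le> b" and le: "\<And>x. x \<in> S \<Longrightarrow> measure_pmf.prob (Q x) X \<le> b"
    and zero: "\<And>x. x \<notin> S \<Longrightarrow> measure_pmf.prob (Q x) X = 0"
  shows "measure_pmf.prob (bind_pmf P Q) X \<le> b * measure_pmf.prob P S"
proof -
  have "emeasure (bind_pmf P Q) X = (\<integral>\<^sup>+x. emeasure (Q x) X \<partial>P)" by simp
  also have "\<dots> \<le> (\<integral>\<^sup>+x. ennreal b * indicator S x \<partial>P)"
  proof (rule nn_integral_mono)
    fix x
    show "emeasure (Q x) X \<le> ennreal b * indicator S x"
      using le[of x] zero[of x] by (cases "x \<in> S") (simp_all add: measure_pmf.emeasure_eq_measure ennreal_leI)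
  qed
  also have "\<dots> = ennreal b * emeasure P S" by (simp add: nn_integral_cmult)
  also have "\<dots> = ennreal (b * measure_pmf.prob P S)"
    using b by (simp add: measure_pmf.emeasure_eq_measure ennreal_mult)
  finally show ?thesis
    using b by (simp add: measure_pmf.emeasure_eq_measure)
qed

lemma sum_power_card_Pow:
  fixes x :: real
  assumes "finite A"
  shows "(\<Sum>X\<in>Pow A. x ^ card X) = (1 + x) ^ card A"
proof -
  have "(1 + x) ^ card A = (\<Prod>a\<in>A. x + 1)" by (simp add: add.commute)
  also have "\<dots> = (\<Sum>X\<in>Pow A. (\<Prod>a\<in>X. x) * (\<Prod>a\<in>A - X. 1))" using assms by (rule prod_add)
  finally show ?thesis by simp
qed

lemma prob_few_targets:
  fixes p m r :: real and c c0 k :: nat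
  assumes finE: "finite E" and p: "0 \<le> p" "p \<le> 1" and c: "c0 \<le> c" "k \<le> c0" "c > 0"
    and M: "M \<subseteq> E" "card M \<le> k" and T: "T \<subseteq> E" "m \<le> card T" and m: "k \<le> m"
  shows "measure_pmf.prob (edge_states_pmf E c p)
      {H. M \<subseteq> dom H \<and> card {e \<in> T. \<exists>j\<in>{1..c0}. H e = Some j \<and> Some j \<notin> H ` M} < r}
    \<le> exp (r - (m - k) * (p * (c0 - k) / c) / 2) * p ^ card M"
    (is "measure_pmf.prob _ ?X \<le> ?b * _")
proof -
  let ?D = "\<lambda>_::'a set. edge_state_pmf c p"
  have finM: "finite M" using finite_subset[OF M(1) finE] .
  have finT: "finite T" using finite_subset[OF T(1) finE] .
  define comb where "comb f g = (\<lambda>x. if x \<in> M then f x else g x)" for f g :: "'a edge_coloring"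
  have "E = M \<union> (E - M)" using M(1) by blast
  then have "edge_states_pmf E c p = Pi_pmf (M \<union> (E - M)) None ?D"
    unfolding edge_states_pmf_def by (rule arg_cong)
  also have "\<dots> = map_pmf (\<lambda>(f, g). comb f g) (pair_pmf (Pi_pmf M None ?D) (Pi_pmf (E - M) None ?D))"
    unfolding comb_def using finM finE by (intro Pi_pmf_union) auto
  also have "\<dots> = bind_pmf (Pi_pmf M None ?D) (\<lambda>f. map_pmf (comb f) (Pi_pmf (E - M) None ?D))"
    by (simp add: pair_pmf_def map_pmf_def bind_assoc_pmf bind_return_pmf)
  finally have eq: "edge_states_pmf E c p
    = bind_pmf (Pi_pmf M None ?D) (\<lambda>f. map_pmf (comb f) (Pi_pmf (E - M) None ?D))" .
  let ?S = "{f::'a edge_coloring. M \<subseteq> dom f}"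
  have "measure_pmf.prob (edge_states_pmf E c p) ?X \<le> ?b * measure_pmf.prob (Pi_pmf M None ?D) ?S"
    unfolding eq
  proof (rule prob_bind_le)
    fix f :: "'a edge_coloring" assume "f \<notin> ?S"
    then have "comb f -` ?X = {}" by (auto simp: comb_def subset_iff dom_def)
    then show "measure_pmf.prob (map_pmf (comb f) (Pi_pmf (E - M) None ?D)) ?X = 0"
      by (simp only: measure_map_pmf measure_empty)
  next
    fix f :: "'a edge_coloring" assume "f \<in> ?S"
    define C where "C = {j \<in> {1..c0}. Some j \<notin> f ` M}"
    define B where "B e = (if e \<in> T then Some ` C else {})" for e
    have "card C \<ge> c0 - k"
    proof -
      have "{1..c0} - C \<subseteq> the ` (f ` M)"
      proof
        fix j assume "j \<in> {1..c0} - C"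
        then have "Some j \<in> f ` M" by (simp add: C_def)
        then have "the (Some j) \<in> the ` (f ` M)" by (rule imageI)
        then show "j \<in> the ` (f ` M)" by simp
      qed
      then have "card ({1..c0} - C) \<le> card (the ` (f ` M))" using finM by (intro card_mono) auto
      also have "\<dots> \<le> card M" using finM by (meson card_image_le finite_imageI le_trans)
      finally have "card ({1..c0} - C) \<le> k" using M(2) by simp
      moreover have "card ({1..c0} - C) = c0 - card C" by (subst card_Diff_subset) (auto simp: C_def)
      ultimately show ?thesis by simp
    qed
    then have C: "real c0 - k \<le> card C" by linarith
    have "card T \<le> card (T - M) + card M"
      using finT finM by (metis card_Diff_subset_Int card_mono finite_Diff Un_Diff_cancel2 card_Un_le finite_UnI sup_ge1 le_trans)
    then have TM: "m - k \<le> card (T - M)" using T(2) M(2) by linarith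
    have "C \<subseteq> {1..c}" using c(1) by (auto simp: C_def)
    note pC = prob_edge_state_colours[OF p this]
    have "(m - k) * (p * (c0 - k) / c) \<le> card (T - M) * (p * card C / c)"
      using TM C p c m by (intro mult_mono divide_right_mono mult_left_mono) auto
    also have "\<dots> = (\<Sum>e\<in>T - M. measure_pmf.prob (?D e) (B e))" by (simp add: B_def pC)
    also have "\<dots> = (\<Sum>e\<in>E - M. measure_pmf.prob (?D e) (B e))"
      using finE T(1) by (intro sum.mono_neutral_left) (auto simp: B_def)
    finally have mu: "(m - k) * (p * (c0 - k) / c) \<le> (\<Sum>e\<in>E - M. measure_pmf.prob (?D e) (B e))" .
    have "measure_pmf.prob (map_pmf (comb f) (Pi_pmf (E - M) None ?D)) ?X
        = measure_pmf.prob (Pi_pmf (E - M) None ?D) (comb f -` ?X)" by simp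
    also have "\<dots> \<le> measure_pmf.prob (Pi_pmf (E - M) None ?D) {\<omega>. card {e \<in> E - M. \<omega> e \<in> B e} \<le> r}"
    proof (rule measure_pmf.finite_measure_mono)
      show "comb f -` ?X \<subseteq> {\<omega>. real (card {e \<in> E - M. \<omega> e \<in> B e}) \<le> r}"
      proof
        fix \<omega> assume w: "\<omega> \<in> comb f -` ?X"
        have im: "comb f \<omega> ` M = f ` M" by (auto simp: comb_def)
        have "{e \<in> E - M. \<omega> e \<in> B e} \<subseteq>
          {e \<in> T. \<exists>j\<in>{1..c0}. comb f \<omega> e = Some j \<and> Some j \<notin> comb f \<omega> ` M}"
          unfolding im by (auto simp: B_def C_def comb_def split: if_splits)
        then have "card {e \<in> E - M. \<omega> e \<in> B e} \<le>
          card {e \<in> T. \<exists>j\<in>{1..c0}. comb f \<omega> e = Some j \<and> Some j \<notin> comb f \<omega> ` M}"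
          using finT by (intro card_mono) auto
        moreover have "card {e \<in> T. \<exists>j\<in>{1..c0}. comb f \<omega> e = Some j \<and> Some j \<notin> comb f \<omega> ` M} < r"
          using w by simp
        ultimately show "\<omega> \<in> {\<omega>. real (card {e \<in> E - M. \<omega> e \<in> B e}) \<le> r}" by simp
      qed
    qed simp
    also have "\<dots> \<le> ?b" using finE mu by (intro chernoff_lower) auto
    finally show "measure_pmf.prob (map_pmf (comb f) (Pi_pmf (E - M) None ?D)) ?X \<le> ?b" .
  qed simp
  also have "?S = Pi M (\<lambda>_. - {None})" by (auto simp: dom_def)
  also have "measure_pmf.prob (Pi_pmf M None ?D) (Pi M (\<lambda>_. - {None})) = p ^ card M"
    using finM p by (simp add: measure_Pi_pmf_Pi prob_edge_state_present)
  finally show ?thesis .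
qed

text \<open>The weight \<open>z ^ card M\<close> pays for the number of sets \<open>M\<close> in the union bound.\<close>
lemma prob_not_rich:
  fixes p m r z :: real and c c0 k :: nat
  assumes finE: "finite E" and p: "0 \<le> p" "p \<le> 1" and c: "c0 \<le> c" "k \<le> c0" "c > 0"
    and \<tau>: "\<And>F D. \<tau> F D \<subseteq> E" and m: "k \<le> m" and z: "0 < z" "z \<le> 1"
  shows "measure_pmf.prob (edge_states_pmf E c p) {H. \<not> rich k m r c0 H \<tau>}
    \<le> exp (k * ln (1 / z) + 2 * p * z * card E + r - (m - k) * (p * (c0 - k) / c) / 2)"
proof -
  let ?P = "edge_states_pmf E c p"
  let ?b = "exp (r - (m - k) * (p * (c0 - k) / c) / 2)"
  let ?I = "{M \<in> Pow E. card M \<le> k}"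
  define X where "X M F = (if m \<le> card (\<tau> F (M - F)) then
    {H. M \<subseteq> dom H \<and> card {e \<in> \<tau> F (M - F). \<exists>j\<in>{1..c0}. H e = Some j \<and> Some j \<notin> H ` M} < r} else {})" for M F
  have XP: "measure_pmf.prob ?P (X M F) \<le> ?b * p ^ card M" if "M \<in> ?I" for M F
  proof (cases "m \<le> card (\<tau> F (M - F))")
    case True
    then show ?thesis unfolding X_def using that
      by (simp only: if_True) (intro prob_few_targets finE p c \<tau> m, auto)
  next
    case False
    then show ?thesis using p by (simp add: X_def)
  qed
  have supp: "H \<in> set_pmf ?P \<Longrightarrow> dom H \<subseteq> E" for H
    using set_Pi_pmf_subset[OF finE] by (fastforce simp: edge_states_pmf_def)
  have finI: "finite ?I" using finE by simp
  have finM: "finite M" if "M \<in> ?I" for M using that finite_subset[OF _ finE] by blast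
  have "measure_pmf.prob ?P {H. \<not> rich k m r c0 H \<tau>} = measure_pmf.prob ?P ({H. \<not> rich k m r c0 H \<tau>} \<inter> set_pmf ?P)"
    by (simp add: measure_Int_set_pmf)
  also have "\<dots> \<le> measure_pmf.prob ?P (\<Union>M\<in>?I. \<Union>F\<in>Pow M. X M F)"
  proof (rule measure_pmf.finite_measure_mono)
    show "{H. \<not> rich k m r c0 H \<tau>} \<inter> set_pmf ?P \<subseteq> (\<Union>M\<in>?I. \<Union>F\<in>Pow M. X M F)"
    proof
      fix H assume H: "H \<in> {H. \<not> rich k m r c0 H \<tau>} \<inter> set_pmf ?P"
      then obtain M F where MF: "M \<subseteq> dom H" "F \<subseteq> M" "real (card M) \<le> real k" "m \<le> card (\<tau> F (M - F))"
        "\<not> r \<le> card {e \<in> \<tau> F (M - F). \<exists>j\<in>{1..c0}. H e = Some j \<and> Some j \<notin> H ` M}"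
        unfolding rich_def by blast
      have "dom H \<subseteq> E" using H by (intro supp) simp
      then have "M \<in> ?I" using MF(1,3) by auto
      moreover have "H \<in> X M F" using MF by (simp add: X_def)
      ultimately show "H \<in> (\<Union>M\<in>?I. \<Union>F\<in>Pow M. X M F)" using MF(2) by blast
    qed
  qed simp
  also have "\<dots> \<le> (\<Sum>M\<in>?I. measure_pmf.prob ?P (\<Union>F\<in>Pow M. X M F))"
    using finI by (intro measure_pmf.finite_measure_subadditive_finite) auto
  also have "\<dots> \<le> (\<Sum>M\<in>?I. \<Sum>F\<in>Pow M. measure_pmf.prob ?P (X M F))"
  proof (rule sum_mono)
    fix M assume "M \<in> ?I"
    then have "finite M" by (rule finM)
    then have "finite (Pow M)" by simp
    then show "measure_pmf.prob ?P (\<Union>F\<in>Pow M. X M F) \<le> (\<Sum>F\<in>Pow M. measure_pmf.prob ?P (X M F))"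
      by (rule measure_pmf.finite_measure_subadditive_finite) simp
  qed
  also have "\<dots> \<le> (\<Sum>M\<in>?I. \<Sum>F\<in>Pow M. ?b * p ^ card M)"
    by (intro sum_mono XP)
  also have "\<dots> = (\<Sum>M\<in>?I. ?b * (2 * p) ^ card M)"
  proof (rule sum.cong[OF refl])
    fix M assume "M \<in> ?I"
    then have "finite M" by (rule finM)
    then have "card (Pow M) = 2 ^ card M" by (rule card_Pow)
    then have "(\<Sum>F\<in>Pow M. ?b * p ^ card M) = 2 ^ card M * (?b * p ^ card M)" by simp
    then show "(\<Sum>F\<in>Pow M. ?b * p ^ card M) = ?b * (2 * p) ^ card M"
      by (simp only: power_mult_distrib) (simp only: mult_ac)
  qed
  \<comment> \<open>The factor 2 comes from the choice of \<open>F\<close> inside \<open>M\<close>.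
    As \<open>card M \<le> k\<close>, the price \<open>(1 / z) ^ k\<close> buys the weight
    \<open>z ^ card M\<close> in every term; then the sum may run over all subsets of
    \<open>E\<close> and is a binomial power.\<close>
  also have "\<dots> \<le> (\<Sum>M\<in>?I. ?b * ((1 / z) ^ k * (2 * p * z) ^ card M))"
  proof (intro sum_mono mult_left_mono)
    fix M assume M: "M \<in> ?I"
    have "(1 / z) ^ card M \<le> (1 / z) ^ k" using z M by (intro power_increasing) auto
    then have "(1 / z) ^ card M * (2 * p * z) ^ card M \<le> (1 / z) ^ k * (2 * p * z) ^ card M"
      using p z by (intro mult_right_mono) auto
    moreover have "(1 / z) ^ card M * (2 * p * z) ^ card M = (2 * p) ^ card M"
      unfolding power_mult_distrib[symmetric] using z by simp
    ultimately show "(2 * p) ^ card M \<le> (1 / z) ^ k * (2 * p * z) ^ card M" by simp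
  qed simp
  also have "\<dots> \<le> (\<Sum>M\<in>Pow E. ?b * ((1 / z) ^ k * (2 * p * z) ^ card M))"
    using finE p z by (intro sum_mono2) auto
  also have "\<dots> = ?b * (1 / z) ^ k * (1 + 2 * p * z) ^ card E"
    unfolding sum_power_card_Pow[OF finE, symmetric] sum_distrib_left by (simp only: mult.assoc)
  also have "\<dots> \<le> ?b * (1 / z) ^ k * exp (2 * p * z) ^ card E"
    using p z by (intro mult_left_mono power_mono exp_ge_add_one_self) auto
  also have "(1 / z) ^ k = exp (k * ln (1 / z))"
    using z by (simp add: exp_of_nat_mult)
  also have "exp (2 * p * z) ^ card E = exp (2 * p * z * card E)"
    by (simp add: exp_of_nat_mult[symmetric] mult.commute)
  finally show ?thesis by (simp add: exp_add[symmetric] algebra_simps)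
qed

section \<open>Probabilities of the exceptional events\<close>

text \<open>Each of \<open>j\<close> draws picks an element of \<open>V\<close> or nothing.\<close>

lemma card_small_subsets:
  assumes "finite V"
  shows "card {B \<in> Pow V. card B \<le> j} \<le> (card V + 1) ^ j"
proof (induction j)
  case 0
  have "{B \<in> Pow V. card B \<le> 0} \<subseteq> {{}}" using assms finite_subset by fastforce
  then have "card {B \<in> Pow V. card B \<le> 0} \<le> card {{} :: 'a set}" by (intro card_mono) simp_all
  then show ?case by simp
next
  case (Suc j)
  let ?S = "\<lambda>j. {B \<in> Pow V. card B \<le> j}"
  let ?f = "\<lambda>(x, B). case x of None \<Rightarrow> B | Some v \<Rightarrow> insert v B"
  let ?O = "insert None (Some ` V)"
  have fin: "finite (?O \<times> ?S j)" using assms by simp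
  have "?S (Suc j) \<subseteq> ?f ` (?O \<times> ?S j)"
  proof
    fix B assume B: "B \<in> ?S (Suc j)"
    show "B \<in> ?f ` (?O \<times> ?S j)"
    proof (cases "card B \<le> j")
      case True
      then show ?thesis using B by (intro image_eqI[of _ _ "(None, B)"]) auto
    next
      case False
      then have "card B = Suc j" using B by simp
      then obtain v B' where v: "B = insert v B'" "v \<notin> B'" "card B' = j" using card_Suc_eq by metis
      then show ?thesis using B by (intro image_eqI[of _ _ "(Some v, B')"]) auto
    qed
  qed
  then have "card (?S (Suc j)) \<le> card (?f ` (?O \<times> ?S j))" using fin by (intro card_mono) simp_all
  also have "\<dots> \<le> card (?O \<times> ?S j)" using fin by (rule card_image_le)
  also have "\<dots> = (card V + 1) * card (?S j)"
    using assms by (simp add: card_cartesian_product card_image)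
  also have "\<dots> \<le> (card V + 1) * (card V + 1) ^ j" using Suc.IH by (rule mult_le_mono2)
  finally show ?case by simp
qed

lemma set_edge_states_pmf: "finite E \<Longrightarrow> H \<in> set_pmf (edge_states_pmf E c p) \<Longrightarrow> dom H \<subseteq> E"
  using set_Pi_pmf_subset[of E] by (fastforce simp: edge_states_pmf_def)

context dirac_host
begin

lemma prob_low_degree:
  fixes a p :: real
  assumes p: "0 \<le> p" "p \<le> 1" and C: "C \<subseteq> {1..c}" and v: "v \<in> V"
  shows "measure_pmf.prob (edge_states_pmf E c p)
      {H. card (colour_nbrs C H v) \<le> a}
    \<le> exp (a - n / 4 * (p * card C / c))"
proof -
  define B where "B e = (if v \<in> e then Some ` C else {})" for e
  let ?Ev = "{e \<in> E. v \<in> e}"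
  have "card (neighbours E v) \<le> card ?Ev"
  proof (rule card_inj_on_le)
    show "inj_on (\<lambda>u. {v, u}) (neighbours E v)" by (auto simp: inj_on_def doubleton_eq_iff)
    show "(\<lambda>u. {v, u}) ` neighbours E v \<subseteq> ?Ev" by (auto simp: neighbours_def)
  qed (use finE in simp)
  moreover have "n / 2 \<le> (1 + \<epsilon>) * n / 2" using eps by (simp add: field_simps)
  ultimately have "n / 2 \<le> card ?Ev" using dirac[OF v] by linarith
  then have "n / 2 * (p * card C / c) \<le> card ?Ev * (p * card C / c)"
    using p by (intro mult_right_mono) auto
  also have "\<dots> = (\<Sum>e\<in>?Ev. measure_pmf.prob (edge_state_pmf c p) (B e))"
    by (simp add: B_def prob_edge_state_colours[OF p C])
  also have "\<dots> = (\<Sum>e\<in>E. measure_pmf.prob (edge_state_pmf c p) (B e))"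
    using finE by (intro sum.mono_neutral_left) (auto simp: B_def)
  finally have mu: "n / 2 * (p * card C / c) \<le> (\<Sum>e\<in>E. measure_pmf.prob (edge_state_pmf c p) (B e))" .
  have "measure_pmf.prob (edge_states_pmf E c p)
      {H. card (colour_nbrs C H v) \<le> a}
    \<le> measure_pmf.prob (edge_states_pmf E c p) {H. card {e \<in> E. H e \<in> B e} \<le> a}"
  proof (rule measure_pmf.finite_measure_mono)
    show "{H. card (colour_nbrs C H v) \<le> a}
      \<subseteq> {H. card {e \<in> E. H e \<in> B e} \<le> a}"
    proof
      fix H :: "'a edge_coloring"
      let ?U = "colour_nbrs C H v"
      have finU: "finite ?U" using finV by (simp add: colour_nbrs_def)
      assume H: "H \<in> {H. card (colour_nbrs C H v) \<le> a}"
      have "{e \<in> E. H e \<in> B e} \<subseteq> (\<lambda>u. {v, u}) ` ?U"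
      proof
        fix e assume e: "e \<in> {e \<in> E. H e \<in> B e}"
        then have ve: "v \<in> e" "H e \<in> Some ` C" by (auto simp: B_def split: if_splits)
        have "card e = 2" "e \<subseteq> V" using e E by blast+
        then obtain x y where "e = {x, y}" unfolding card_2_iff by (elim exE conjE)
        then obtain u where u: "e = {v, u}" using ve(1) by (cases "v = x") (auto simp: insert_commute)
        then show "e \<in> (\<lambda>u. {v, u}) ` ?U" using ve e E \<open>e \<subseteq> V\<close>
          by (intro image_eqI[of _ _ u]) (auto simp: colour_nbrs_def)
      qed
      then have "card {e \<in> E. H e \<in> B e} \<le> card ((\<lambda>u. {v, u}) ` ?U)"
        using finU by (intro card_mono) simp_all
      also have "\<dots> \<le> card ?U" using finU by (rule card_image_le)
      finally show "H \<in> {H. card {e \<in> E. H e \<in> B e} \<le> a}" using H by simp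
    qed
  qed simp
  also have "\<dots> \<le> exp (a - n / 2 * (p * card C / c) / 2)"
    unfolding edge_states_pmf_def using finE mu by (rule chernoff_lower)
  finally show ?thesis by (simp add: mult.assoc)
qed

lemma prob_star_concentration:
  fixes p :: real and s0 c :: nat
  assumes p: "0 \<le> p" "p \<le> 1" and C: "C \<subseteq> {1..c}" and c: "n \<le> c" and s0: "n * p / 32 \<le> s0"
    and L: "L \<subseteq> V" "card L \<le> \<gamma> * n" and B: "B \<subseteq> V" "card B \<le> 96 * card L"
    and Y: "Y \<subseteq> C" "card Y \<le> 96 * card L"
  shows "measure_pmf.prob (edge_states_pmf E c p)
      {H. card L * s0 < 4 * card (star_edges V H L B Y)}
    \<le> exp (- (n * p / 256)) ^ card L"
proof -
  let ?D = "edge_state_pmf c p"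
  define EB where "EB = {e \<in> E. \<exists>l\<in>L. \<exists>u\<in>B. e = {l, u}}"
  define EL where "EL = {e \<in> E. \<exists>l\<in>L. \<exists>u\<in>V. e = {l, u}}"
  \<comment> \<open>Edges into \<open>B\<close> count whenever present, the others at
    \<open>L\<close> only with a colour in \<open>Y\<close>. As \<open>n \<le> c\<close>, the mean
    is at most \<open>card L * p * (card B + card Y)\<close>, and both cardinalities are at most
    \<open>96 * \<gamma> * n\<close>.\<close>
  define S where "S e = (if e \<in> EB then - {None} else if e \<in> EL then Some ` Y else {})" for e
  have finL: "finite L" and finB: "finite B" using finite_subset[OF L(1) finV] finite_subset[OF B(1) finV] .
  have doub: "card {e \<in> E. \<exists>l\<in>L. \<exists>u\<in>W. e = {l, u}} \<le> card L * card W" if "finite W" for W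
  proof -
    have "{e \<in> E. \<exists>l\<in>L. \<exists>u\<in>W. e = {l, u}} \<subseteq> (\<lambda>(x, y). {x, y}) ` (L \<times> W)" by auto
    then have "card {e \<in> E. \<exists>l\<in>L. \<exists>u\<in>W. e = {l, u}} \<le> card ((\<lambda>(x, y). {x, y}) ` (L \<times> W))"
      using finL that by (intro card_mono) auto
    also have "\<dots> \<le> card (L \<times> W)" using finL that by (intro card_image_le) auto
    finally show ?thesis by (simp add: card_cartesian_product)
  qed
  have cEB: "card EB \<le> card L * card B" unfolding EB_def using finB by (rule doub)
  have cEL: "card EL \<le> card L * n" unfolding EL_def using doub[OF finV] cardV by simp
  have Yc: "Y \<subseteq> {1..c}" using Y(1) C by blast
  have gp: "\<gamma> * (n * p) \<le> n * p / 100000" using gam p mult_right_mono[OF gam(2), of "n * p"] by simp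
  have "(\<Sum>e\<in>E. measure_pmf.prob ?D (S e)) \<le> (\<Sum>e\<in>E. (if e \<in> EB then p else 0) + (if e \<in> EL then p * card Y / c else 0))"
  proof (rule sum_mono)
    fix e
    show "measure_pmf.prob ?D (S e) \<le> (if e \<in> EB then p else 0) + (if e \<in> EL then p * card Y / c else 0)"
      using p by (simp add: S_def prob_edge_state_present prob_edge_state_colours[OF p Yc])
  qed
  also have "\<dots> = card EB * p + card EL * (p * card Y / c)"
    using finE by (simp add: sum.distrib sum.If_cases EB_def EL_def Int_def conj_commute cong: conj_cong)
  also have "\<dots> \<le> (card L * card B) * p + (card L * n) * (p * card Y / c)"
    using cEB cEL p by (intro add_mono mult_right_mono) (simp_all flip: of_nat_mult)
  also have "\<dots> \<le> (card L * card B) * p + card L * (p * card Y)"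
  proof (intro add_left_mono)
    have "n * (p * card Y / c) \<le> p * card Y"
    proof (cases "c = 0")
      case False
      have "n * (p * card Y) \<le> c * (p * card Y)" using c p by (intro mult_right_mono) auto
      then show ?thesis using False by (simp add: field_simps)
    qed (use p in simp)
    then have "card L * (n * (p * card Y / c)) \<le> card L * (p * card Y)"
      by (rule mult_left_mono) simp
    then show "(card L * n) * (p * card Y / c) \<le> card L * (p * card Y)"
      by (simp only: mult.assoc of_nat_mult)
  qed
  also have "\<dots> = card L * p * (real (card B) + real (card Y))" by (simp add: algebra_simps)
  also have "\<dots> \<le> card L * p * (192 * (\<gamma> * n))"
  proof (intro mult_left_mono)
    have "real (card B) + real (card Y) \<le> 192 * real (card L)" using B(2) Y(2) by linarith
    then show "real (card B) + real (card Y) \<le> 192 * (\<gamma> * n)" using L(2) by linarith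
  qed (use p in simp)
  also have "\<dots> = card L * (192 * (\<gamma> * (n * p)))" by (simp add: mult_ac)
  also have "\<dots> \<le> card L * (192 * (n * p / 100000))" using gp by (intro mult_left_mono) auto
  finally have mu: "(\<Sum>e\<in>E. measure_pmf.prob ?D (S e)) \<le> card L * (192 * (n * p / 100000))" .
  let ?P = "edge_states_pmf E c p"
  let ?X = "{H. card L * s0 < 4 * card (star_edges V H L B Y)}"
  have "measure_pmf.prob ?P ?X = measure_pmf.prob ?P (?X \<inter> set_pmf ?P)" by (simp add: measure_Int_set_pmf)
  also have "\<dots> \<le> measure_pmf.prob ?P {H. card L * s0 / 4 \<le> card {e \<in> E. H e \<in> S e}}"
  proof (rule measure_pmf.finite_measure_mono)
    show "?X \<inter> set_pmf ?P \<subseteq> {H. card L * s0 / 4 \<le> card {e \<in> E. H e \<in> S e}}"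
    proof
      fix H assume H: "H \<in> ?X \<inter> set_pmf ?P"
      then have "dom H \<subseteq> E" using set_edge_states_pmf[OF finE] by blast
      then have "star_edges V H L B Y \<subseteq> {e \<in> E. H e \<in> S e}"
        unfolding star_edges_def S_def EB_def EL_def by auto
      then have "card (star_edges V H L B Y) \<le> card {e \<in> E. H e \<in> S e}"
        using finE by (intro card_mono) simp_all
      then have "card L * s0 \<le> 4 * card {e \<in> E. H e \<in> S e}" using H by simp
      then have "real (card L * s0) \<le> real (4 * card {e \<in> E. H e \<in> S e})" by (rule of_nat_mono)
      then show "H \<in> {H. card L * s0 / 4 \<le> card {e \<in> E. H e \<in> S e}}" by simp
    qed
  qed simp
  also have "\<dots> \<le> exp (2 * (card L * (192 * (n * p / 100000))) - card L * s0 / 4)"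
    unfolding edge_states_pmf_def using finE mu by (rule chernoff_upper)
  also have "\<dots> \<le> exp (card L * (- (n * p / 256)))"
  proof -
    have "0 \<le> n * p" using p by simp
    \<comment> \<open>This is where the bound on \<open>\<gamma>\<close> is nearly tight:
      \<open>s0 / 4 \<ge> n * p / 128\<close> leaves \<open>n * p / 256\<close> for the mean term,
      and \<open>384 * 256 = 98304\<close>.\<close>
    then have "2 * (192 * (n * p / 100000)) - s0 / 4 \<le> - (n * p / 256)" using s0 by linarith
    then have "card L * (2 * (192 * (n * p / 100000)) - s0 / 4) \<le> card L * (- (n * p / 256))"
      by (intro mult_left_mono) auto
    then show ?thesis by (simp add: algebra_simps)
  qed
  finally show ?thesis by (simp only: exp_of_nat_mult)
qed

text \<open>The choices of \<open>B\<close> and \<open>Y\<close> number at most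
  \<open>((n + 1) * (c + 1)) ^ (96 * card L)\<close>, so each \<open>L\<close> contributes
  \<open>y ^ card L\<close>, where \<open>y\<close> is tiny once \<open>n * p\<close> is a large
  multiple of \<open>ln n\<close>. The sum over nonempty \<open>L\<close> is at most
  \<open>(1 + y) ^ n - 1\<close>.\<close>

lemma prob_not_star_spread:
  fixes p :: real and s0 c :: nat
  assumes p: "0 \<le> p" "p \<le> 1" and C: "C \<subseteq> {1..c}" and c: "n \<le> c" and s0: "n * p / 32 \<le> s0"
  shows "measure_pmf.prob (edge_states_pmf E c p) {H. \<not> star_spread C s0 H}
    \<le> exp (n * (((real n + 1) * (real c + 1)) ^ 96 * exp (- (n * p / 256)))) - 1"
proof -
  let ?P = "edge_states_pmf E c p"
  define y where "y = ((real n + 1) * (real c + 1)) ^ 96 * exp (- (n * p / 256))"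
  have y0: "0 \<le> y" by (simp add: y_def)
  have finC: "finite C" using C finite_subset by blast
  define SL where "SL = {L \<in> Pow V - {{}}. card L \<le> \<gamma> * n}"
  define SB where "SB L = {B \<in> Pow V. card B \<le> 96 * card L}" for L :: "'a set"
  define SY where "SY L = {Y \<in> Pow C. card Y \<le> 96 * card L}" for L :: "'a set"
  define X where "X L B Y = {H :: 'a edge_coloring. card L * s0 < 4 * card (star_edges V H L B Y)}"
    for L B :: "'a set" and Y :: "nat set"
  have fin: "finite SL" "finite (SB L)" "finite (SY L)" for L
    using finV finC by (simp_all add: SL_def SB_def SY_def)
  have cB: "real (card (SB L)) \<le> (real n + 1) ^ (96 * card L)" for L
  proof -
    have "card (SB L) \<le> (card V + 1) ^ (96 * card L)"
      unfolding SB_def using finV by (rule card_small_subsets)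
    then have "real (card (SB L)) \<le> real ((card V + 1) ^ (96 * card L))" by (rule of_nat_mono)
    then show ?thesis by (simp add: cardV add.commute)
  qed
  have cY: "real (card (SY L)) \<le> (real c + 1) ^ (96 * card L)" for L
  proof -
    have "card (SY L) \<le> (card C + 1) ^ (96 * card L)"
      unfolding SY_def using finC by (rule card_small_subsets)
    also have "\<dots> \<le> (c + 1) ^ (96 * card L)"
    proof (rule power_mono)
      have "card C \<le> card {1..c}" using C by (intro card_mono) simp_all
      then show "card C + 1 \<le> c + 1" by simp
    qed simp
    finally have "real (card (SY L)) \<le> real ((c + 1) ^ (96 * card L))" by (rule of_nat_mono)
    then show ?thesis by (simp add: add.commute)
  qed
  have "measure_pmf.prob ?P {H. \<not> star_spread C s0 H}
      \<le> measure_pmf.prob ?P (\<Union>L\<in>SL. \<Union>B\<in>SB L. \<Union>Y\<in>SY L. X L B Y)"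
  proof (rule measure_pmf.finite_measure_mono)
    show "{H. \<not> star_spread C s0 H} \<subseteq> (\<Union>L\<in>SL. \<Union>B\<in>SB L. \<Union>Y\<in>SY L. X L B Y)"
    proof
      fix H assume "H \<in> {H. \<not> star_spread C s0 H}"
      then obtain L B Y where "L \<subseteq> V" "L \<noteq> {}" "card L \<le> \<gamma> * n" "B \<subseteq> V" "Y \<subseteq> C"
        "card B \<le> 96 * card L" "card Y \<le> 96 * card L"
        "\<not> 4 * card (star_edges V H L B Y) \<le> card L * s0"
        unfolding star_spread_def by (auto simp only: mem_Collect_eq not_all not_imp)
      then have "L \<in> SL" "B \<in> SB L" "Y \<in> SY L" "H \<in> X L B Y"
        by (simp_all add: SL_def SB_def SY_def X_def)
      then show "H \<in> (\<Union>L\<in>SL. \<Union>B\<in>SB L. \<Union>Y\<in>SY L. X L B Y)" by blast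
    qed
  qed simp
  also have "\<dots> \<le> (\<Sum>L\<in>SL. measure_pmf.prob ?P (\<Union>B\<in>SB L. \<Union>Y\<in>SY L. X L B Y))"
    using fin by (intro measure_pmf.finite_measure_subadditive_finite) simp_all
  also have "\<dots> \<le> (\<Sum>L\<in>SL. y ^ card L)"
  proof (rule sum_mono)
    fix L assume L: "L \<in> SL"
    have "measure_pmf.prob ?P (\<Union>B\<in>SB L. \<Union>Y\<in>SY L. X L B Y)
        \<le> (\<Sum>B\<in>SB L. measure_pmf.prob ?P (\<Union>Y\<in>SY L. X L B Y))"
      using fin by (intro measure_pmf.finite_measure_subadditive_finite) simp_all
    also have "\<dots> \<le> (\<Sum>B\<in>SB L. \<Sum>Y\<in>SY L. measure_pmf.prob ?P (X L B Y))"
      using fin by (intro sum_mono measure_pmf.finite_measure_subadditive_finite) simp_all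
    also have "\<dots> \<le> (\<Sum>B\<in>SB L. \<Sum>Y\<in>SY L. exp (- (n * p / 256)) ^ card L)"
    proof (intro sum_mono)
      fix B Y assume "B \<in> SB L" "Y \<in> SY L"
      then show "measure_pmf.prob ?P (X L B Y) \<le> exp (- (n * p / 256)) ^ card L"
        unfolding X_def using L by (intro prob_star_concentration[OF p C c s0]) (simp_all add: SL_def SB_def SY_def)
    qed
    also have "\<dots> = real (card (SB L)) * real (card (SY L)) * exp (- (n * p / 256)) ^ card L" by simp
    also have "\<dots> \<le> (real n + 1) ^ (96 * card L) * (real c + 1) ^ (96 * card L) * exp (- (n * p / 256)) ^ card L"
      by (intro mult_right_mono mult_mono cB cY) simp_all
    also have "\<dots> = y ^ card L" by (simp add: y_def power_mult_distrib power_mult)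
    finally show "measure_pmf.prob ?P (\<Union>B\<in>SB L. \<Union>Y\<in>SY L. X L B Y) \<le> y ^ card L" .
  qed
  also have "\<dots> \<le> (\<Sum>L\<in>Pow V - {{}}. y ^ card L)"
    using finV y0 by (intro sum_mono2) (auto simp: SL_def)
  also have "\<dots> = (\<Sum>L\<in>Pow V. y ^ card L) - 1"
    using finV by (subst sum_diff1) simp_all
  also have "\<dots> = (1 + y) ^ n - 1" using finV by (simp add: sum_power_card_Pow cardV)
  also have "\<dots> \<le> exp y ^ n - 1" using y0 by (intro diff_right_mono power_mono exp_ge_add_one_self) simp
  also have "\<dots> = exp (n * y) - 1" by (simp add: exp_of_nat_mult)
  finally show ?thesis unfolding y_def .
qed

text \<open>The colours are split into the classes \<open>{1..2 * K * n}\<close>, used for the hitting steps, and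
  \<open>{2 * K * n<..4 * K * n}\<close>, reserved for the stars.\<close>
lemma prob_packing:
  fixes p \<kappa> :: real and K k1 j t :: nat
  defines "\<kappa> \<equiv> (\<gamma> * \<epsilon>)\<^sup>2 / 128"
  assumes p: "0 \<le> p" "p \<le> 1" and np: "64 \<le> n * p" and K: "K = k1 + 3 + j" "2 * K \<le> \<kappa> * n"
    and k1: "8 \<le> \<gamma> * \<epsilon> * k1" and j: "exp (- (\<gamma> * \<epsilon> * j / 16)) \<le> \<gamma> * \<epsilon> / 4"
    and t: "t \<le> \<kappa> * (n * p) / 64"
  shows "1 - (3 * exp (K * n * ln (128 / \<kappa>) - \<kappa> * n * (n * p) / 64) + n * exp (- (n * p / 16)) +
      (exp (n * (((real n + 1) * (real (4 * K * n) + 1)) ^ 96 * exp (- (n * p / 256)))) - 1))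
    \<le> measure_pmf.prob (edge_states_pmf E (4 * K * n) p) {H. has_disjoint_rainbow_hamilton_cycles V H t}"
proof -
  let ?c = "4 * K * n" and ?half = "2 * K * n" and ?k = "K * n"
  let ?P = "edge_states_pmf E ?c p"
  let ?C = "{2 * K * n<..4 * K * n}"
  define r where "r = \<kappa> * n * (n * p) / 32"
  define m where "m = \<kappa> * (real n)\<^sup>2"
  define s0 where "s0 = nat \<lceil>n * p / 32\<rceil>"
  note ge = gamma_eps
  have "(\<gamma> * \<epsilon>)\<^sup>2 \<le> 1" using ge by (simp add: power_le_one)
  then have \<kappa>: "0 < \<kappa>" "\<kappa> \<le> 1 / 128" using gam eps by (simp_all add: \<kappa>_def)
  have n0: "0 < real n" using n_pos by simp
  have s0: "n * p / 32 \<le> s0" "s0 \<le> n * p / 32 + 1" "s0 > 0"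
    using np by (simp_all add: s0_def)
  have CC: "?C \<subseteq> {1..?c}" by auto
  have Kc: "K * n > 0" using K(1) n_pos by simp
  define bad where "bad \<tau> = {H. \<not> rich ?k m r ?half H \<tau>}" for \<tau> :: "'a set set \<Rightarrow> 'a set set \<Rightarrow> 'a set set"
  let ?b = "exp (K * n * ln (128 / \<kappa>) - \<kappa> * n * (n * p) / 64)"
  have km: "2 * real ?k \<le> m"
  proof -
    have "2 * real K * n \<le> \<kappa> * n * n" using K(2) by (intro mult_right_mono) auto
    then show ?thesis by (simp add: m_def power2_eq_square mult.assoc)
  qed
  have rich: "measure_pmf.prob ?P (bad \<tau>) \<le> ?b" if "\<And>F D. \<tau> F D \<subseteq> E" for \<tau>
  proof -
    let ?z = "\<kappa> / 128"
    have "measure_pmf.prob ?P (bad \<tau>)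
      \<le> exp (?k * ln (1 / ?z) + 2 * p * ?z * card E + r - (m - ?k) * (p * (?half - ?k) / ?c) / 2)"
      unfolding bad_def
    proof (rule prob_not_rich[OF finE p _ _ _ that])
      show "real ?k \<le> m" using km by linarith
    qed (use \<kappa> Kc in auto)
    also have "\<dots> \<le> ?b"
    proof -
      have a: "2 * p * ?z * card E \<le> 2 * p * ?z * (real n)\<^sup>2"
        using card_E p \<kappa> by (intro mult_left_mono) auto
      have b: "real (?half - ?k) / ?c = 1 / 4"
      proof -
        have "?half - ?k = K * n" by simp
        then show ?thesis using Kc by simp
      qed
      have "m / 2 * (p / 4) \<le> (m - ?k) * (p * (?half - ?k) / ?c)"
      proof -
        have "m / 2 \<le> m - ?k" using km by simp
        moreover have "p * real (?half - ?k) / ?c = p / 4" using b by (simp only: times_divide_eq_right[symmetric])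
        ultimately show ?thesis using p by (simp only:) (intro mult_right_mono; simp)
      qed
      moreover have gen: "x \<le> x' \<Longrightarrow> q \<le> Q \<Longrightarrow> x' + r - q / 2 = w \<Longrightarrow> x + r - Q / 2 \<le> w"
        for x x' q Q w :: real by linarith
      moreover have "2 * p * ?z * (real n)\<^sup>2 + r - m / 2 * (p / 4) / 2 = - (\<kappa> * n * (n * p) / 64)"
        by (simp add: r_def m_def power2_eq_square field_simps)
      ultimately have "2 * p * ?z * card E + r - (m - ?k) * (p * (?half - ?k) / ?c) / 2 \<le> - (\<kappa> * n * (n * p) / 64)"
        using a gen by blast
      then show ?thesis by (simp add: mult.assoc)
    qed
    finally show ?thesis .
  qed
  define \<tau>1 where "\<tau>1 F = hitters E (\<gamma> * \<epsilon> / 4) split_pairs cross_edges" for F :: "'a set set"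
  define \<tau>2 where "\<tau>2 F = hitters E (\<gamma> * \<epsilon> / (16 * n)) (demands V E \<epsilon> F) (witnesses V E F)" for F
  define \<tau>3 where "\<tau>3 = closers V E \<epsilon>"
  have \<tau>: "\<tau>1 F D \<subseteq> E" "\<tau>2 F D \<subseteq> E" "\<tau>3 F D \<subseteq> E" for F D
    by (auto simp: \<tau>1_def \<tau>2_def \<tau>3_def hitters_def closers_def)
  define low where "low v = {H :: 'a edge_coloring. card (colour_nbrs ?C H v) \<le> n * p / 16}" for v
  have low: "measure_pmf.prob ?P (low v) \<le> exp (- (n * p / 16))" if "v \<in> V" for v
  proof -
    have "measure_pmf.prob ?P (low v) \<le> exp (n * p / 16 - n / 4 * (p * card ?C / ?c))"
      unfolding low_def by (rule prob_low_degree[OF p CC that])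
    also have "n * p / 16 - n / 4 * (p * card ?C / ?c) = - (n * p / 16)"
    proof -
      have "card ?C = 2 * K * n" by simp
      then have "p * card ?C / ?c = p / 2" using Kc by (simp add: field_simps)
      then show ?thesis by simp
    qed
    finally show ?thesis .
  qed
  have nc: "n \<le> ?c" using K(1) by simp
  let ?sp = "{H. \<not> star_spread ?C s0 H}"
  let ?G = "{H. has_disjoint_rainbow_hamilton_cycles V H t}"
  have sub: "- ?G \<inter> set_pmf ?P \<subseteq> (bad \<tau>1 \<union> bad \<tau>2 \<union> bad \<tau>3) \<union> (\<Union>v\<in>V. low v) \<union> ?sp"
  proof
    fix H assume H: "H \<in> - ?G \<inter> set_pmf ?P"
    show "H \<in> (bad \<tau>1 \<union> bad \<tau>2 \<union> bad \<tau>3) \<union> (\<Union>v\<in>V. low v) \<union> ?sp"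
    proof (rule ccontr)
      assume neg: "\<not> ?thesis"
      have "has_disjoint_rainbow_hamilton_cycles V H t"
      proof (rule rainbow_packing)
        show "progress_rich ?k r ?half H"
          unfolding progress_rich_def Let_def
          using neg unfolding bad_def \<tau>1_def \<tau>2_def \<tau>3_def m_def \<kappa>_def by simp
        show "dom H \<subseteq> E" using H set_edge_states_pmf[OF finE] by blast
        have "real t * n \<le> \<kappa> * (n * p) / 64 * n" using t by (intro mult_right_mono) auto
        also have "\<dots> < r"
        proof -
          have "0 < n * p" using np by linarith
          then have "0 < \<kappa> * n * (n * p)" by (rule mult_pos_pos[OF mult_pos_pos[OF \<kappa>(1) n0]])
          moreover have "\<kappa> * (n * p) / 64 * n = \<kappa> * n * (n * p) / 64" by simp
          ultimately show ?thesis unfolding r_def by linarith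
        qed
        finally show "real (t * n) < r" by simp
        show "exp (- (\<gamma> * \<epsilon> * real (j * n) / (16 * n))) \<le> \<gamma> * \<epsilon> / 4"
        proof -
          have "\<gamma> * \<epsilon> * real (j * n) / (16 * n) = \<gamma> * \<epsilon> * j / 16" using n0 by simp
          then show ?thesis using j by (simp only:)
        qed
        show "real (8 * n) \<le> \<gamma> * \<epsilon> * real (k1 * n)"
          using mult_right_mono[OF k1, of "real n"] by (simp add: mult.assoc)
        show "real (k1 * n + 3 * n + j * n) \<le> real ?k" by (simp add: K(1) algebra_simps)
        show "finite ?C" "?C \<inter> {1..?half} = {}" by auto
        show "s0 > 0" by (rule s0)
        show "star_spread ?C s0 H" using neg by simp
        fix v assume v: "v \<in> V"
        then have "n * p / 16 < card (colour_nbrs ?C H v)"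
          using neg unfolding low_def by auto
        \<comment> \<open>The reserved degree \<open>n * p / 16\<close> covers
          \<open>n * p / 32\<close> for \<open>s0\<close>, its rounding, which is at most
          \<open>n * p / 64\<close> because \<open>64 \<le> n * p\<close>, and the small loss
          \<open>4 * t\<close>.\<close>
        moreover have "real (s0 + 4 * t) \<le> n * p / 16"
        proof -
          have "\<kappa> * (n * p) \<le> 1 / 128 * (n * p)" using \<kappa>(2) np by (intro mult_right_mono) auto
          then show ?thesis using s0(2) t np by simp
        qed
        ultimately show "s0 + 4 * t \<le> card (colour_nbrs ?C H v)" by linarith
      qed
      then show False using H by simp
    qed
  qed
  have "measure_pmf.prob ?P (- ?G) = measure_pmf.prob ?P (- ?G \<inter> set_pmf ?P)" by (simp add: measure_Int_set_pmf)
  also have "\<dots> \<le> measure_pmf.prob ?P ((bad \<tau>1 \<union> bad \<tau>2 \<union> bad \<tau>3) \<union> (\<Union>v\<in>V. low v) \<union> ?sp)"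
    by (rule measure_pmf.finite_measure_mono[OF sub]) simp
  also have "\<dots> \<le> measure_pmf.prob ?P (bad \<tau>1) + measure_pmf.prob ?P (bad \<tau>2) + measure_pmf.prob ?P (bad \<tau>3)
      + measure_pmf.prob ?P (\<Union>v\<in>V. low v) + measure_pmf.prob ?P ?sp"
    by (intro order_trans[OF measure_Un_le] add_mono order_refl) simp_all
  finally have main: "measure_pmf.prob ?P (- ?G) \<le>
      measure_pmf.prob ?P (bad \<tau>1) + measure_pmf.prob ?P (bad \<tau>2) + measure_pmf.prob ?P (bad \<tau>3)
      + measure_pmf.prob ?P (\<Union>v\<in>V. low v) + measure_pmf.prob ?P ?sp" .
  have "measure_pmf.prob ?P (\<Union>v\<in>V. low v) \<le> (\<Sum>v\<in>V. measure_pmf.prob ?P (low v))"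
    using finV by (intro measure_pmf.finite_measure_subadditive_finite) simp_all
  also have "\<dots> \<le> (\<Sum>v\<in>V. exp (- (n * p / 16)))" by (intro sum_mono low)
  also have "\<dots> = n * exp (- (n * p / 16))" by (simp add: cardV)
  finally have lows: "measure_pmf.prob ?P (\<Union>v\<in>V. low v) \<le> n * exp (- (n * p / 16))" .
  have "measure_pmf.prob ?P (bad \<tau>1) \<le> ?b" using \<tau>(1) by (rule rich)
  moreover have "measure_pmf.prob ?P (bad \<tau>2) \<le> ?b" using \<tau>(2) by (rule rich)
  moreover have "measure_pmf.prob ?P (bad \<tau>3) \<le> ?b" using \<tau>(3) by (rule rich)
  moreover note prob_not_star_spread[OF p CC nc s0(1)]
  moreover have "measure_pmf.prob ?P (- ?G) = 1 - measure_pmf.prob ?P ?G"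
    using measure_pmf.prob_compl[of ?G ?P] by (simp add: Compl_eq_Diff_UNIV)
  ultimately show ?thesis using main lows by linarith
qed

end

section \<open>Asymptotics\<close>

lemma dirac_host_of_min_degree:
  fixes G :: "'a graph" and \<epsilon> :: real
  assumes G: "finite_simple_graph G" "card (verts G) = n" and eps: "0 < \<epsilon>" "\<epsilon> \<le> 1"
    and deg: "(1 + \<epsilon>) * n / 2 \<le> min_degree G" and n: "300000 \<le> n"
  shows "dirac_host (verts G) (edges G) n \<epsilon> (1 / 100000)"
proof
  show finV: "finite (verts G)" and E: "edges G \<subseteq> {e. e \<subseteq> verts G \<and> card e = 2}"
    using G(1) by (simp_all add: finite_simple_graph_def)
  fix v assume v: "v \<in> verts G"
  let ?E = "edges G"
  have sub: "neighbours ?E v \<subseteq> verts G" using E by (auto simp: neighbours_def)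
  then have fin: "finite (neighbours ?E v)" using finV by (rule finite_subset)
  have "min_degree G \<le> degree G v"
    unfolding min_degree_def using finV v by (intro Min_le) auto
  also have "degree G v \<le> card ((\<lambda>u. {v, u}) ` neighbours ?E v)"
    unfolding degree_def
  proof (rule card_mono)
    show "{e \<in> ?E. v \<in> e} \<subseteq> (\<lambda>u. {v, u}) ` neighbours ?E v"
    proof
      fix e assume e: "e \<in> {e \<in> ?E. v \<in> e}"
      then have "card e = 2" using E by blast
      then obtain x y where "e = {x, y}" unfolding card_2_iff by (elim exE conjE)
      then obtain u where "e = {v, u}" using e by (cases "v = x") (auto simp: insert_commute)
      then show "e \<in> (\<lambda>u. {v, u}) ` neighbours ?E v" using e by (auto simp: neighbours_def)
    qed
  qed (use fin in simp)
  also have "\<dots> \<le> card (neighbours ?E v)" using fin by (rule card_image_le)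
  finally show "(1 + \<epsilon>) * n / 2 \<le> card (neighbours ?E v)" using deg by linarith
qed (use G eps n in simp_all)

lemma error_terms_le:
  fixes n K :: nat and x \<kappa> C :: real
  assumes n: "4 * K + 2 \<le> n" and ln: "1 \<le> ln (real n)" and C: "C * ln (real n) \<le> x" "98816 \<le> C"
    and \<kappa>: "0 < \<kappa>" "64 / \<kappa> * (K * ln (128 / \<kappa>) + 1) \<le> C"
  shows "3 * exp (K * n * ln (128 / \<kappa>) - \<kappa> * n * x / 64) + n * exp (- (x / 16)) +
      (exp (n * (((real n + 1) * (real (4 * K * n) + 1)) ^ 96 * exp (- (x / 256)))) - 1)
    \<le> 3 * exp (- real n) + 1 / n + (exp (1 / n) - 1)"
proof -
  have n0: "0 < real n" using n by simp
  have sq: "exp (- 2 * ln (real n)) = 1 / (real n)\<^sup>2"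
  proof -
    have "exp (2 * ln (real n)) = (real n)\<^sup>2" using n0 exp_of_nat_mult[of 2 "ln (real n)"] by simp
    then show ?thesis by (simp add: exp_minus inverse_eq_divide)
  qed
  have Cx: "C \<le> x"
  proof -
    have "C * 1 \<le> C * ln (real n)" using ln C(2) by (intro mult_left_mono) auto
    then show ?thesis using C(1) by linarith
  qed
  have "K * n * ln (128 / \<kappa>) - \<kappa> * n * x / 64 \<le> - real n"
  proof -
    \<comment> \<open>The number of exposed sets contributes an exponent of order \<open>n\<close>,
      the gain is of order \<open>n * x\<close>; a constant lower bound on \<open>x\<close> already
      brings the total below \<open>- n\<close>.\<close>
    define A where "A = K * ln (128 / \<kappa>) + 1"
    have "64 / \<kappa> * A \<le> x" using \<kappa>(2) Cx unfolding A_def by linarith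
    then have "A \<le> \<kappa> / 64 * x" using \<kappa>(1) by (simp add: field_simps)
    then have "n * A \<le> n * (\<kappa> / 64 * x)" by (rule mult_left_mono) simp
    then show ?thesis by (simp add: A_def algebra_simps)
  qed
  then have 1: "exp (K * n * ln (128 / \<kappa>) - \<kappa> * n * x / 64) \<le> exp (- real n)" by simp
  \<comment> \<open>Here \<open>98816 = 386 * 256\<close>. The polynomial factor is at most
    \<open>n ^ 384\<close>, a 96th power of two factors that are each at most quadratic; two more
    powers of \<open>n\<close> are needed to beat the outer factor \<open>n\<close>.\<close>
  have lnx: "98816 * ln (real n) \<le> x"
  proof -
    have "98816 * ln (real n) \<le> C * ln (real n)" using C(2) ln by (intro mult_right_mono) auto
    then show ?thesis using C(1) by linarith
  qed
  have "exp (- (x / 16)) \<le> exp (- 2 * ln (real n))" using lnx ln by simp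
  then have "n * exp (- (x / 16)) \<le> n * (1 / (real n)\<^sup>2)" unfolding sq by (intro mult_left_mono) auto
  then have 2: "n * exp (- (x / 16)) \<le> 1 / n" using n0 by (simp add: power2_eq_square)
  have "(real n + 1) * (real (4 * K * n) + 1) \<le> (real n)\<^sup>2 * (real n)\<^sup>2"
  proof (rule mult_mono)
    have "n + 1 \<le> n * n"
    proof -
      have "2 * n \<le> n * n" using n by (intro mult_right_mono) auto
      then show ?thesis using n by linarith
    qed
    then have "real (n + 1) \<le> real (n * n)" by (rule of_nat_mono)
    then show "real n + 1 \<le> (real n)\<^sup>2" by (simp add: power2_eq_square)
    have "4 * K * n + 1 \<le> (4 * K + 1) * n" using n by simp
    also have "\<dots> \<le> n * n" using n by (intro mult_right_mono) auto
    finally have "real (4 * K * n + 1) \<le> real (n * n)" by (rule of_nat_mono)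
    then show "real (4 * K * n) + 1 \<le> (real n)\<^sup>2" by (simp add: power2_eq_square)
  qed simp_all
  also have "\<dots> = real n ^ 4" by (simp flip: power_add)
  finally have "((real n + 1) * (real (4 * K * n) + 1)) ^ 96 \<le> (real n ^ 4) ^ 96"
    by (rule power_mono) simp
  also have "\<dots> = exp (384 * ln (real n))"
    using n0 exp_of_nat_mult[of 384 "ln (real n)"] by (simp flip: power_mult)
  finally have "((real n + 1) * (real (4 * K * n) + 1)) ^ 96 * exp (- (x / 256))
      \<le> exp (384 * ln (real n)) * exp (- (x / 256))" by (rule mult_right_mono) simp
  also have "\<dots> = exp (384 * ln (real n) - x / 256)" by (simp flip: exp_add)
  also have "\<dots> \<le> exp (- 2 * ln (real n))" using lnx by simp
  finally have "n * (((real n + 1) * (real (4 * K * n) + 1)) ^ 96 * exp (- (x / 256))) \<le> n * (1 / (real n)\<^sup>2)"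
    unfolding sq by (rule mult_left_mono) simp
  also have "\<dots> = 1 / n" using n0 by (simp add: power2_eq_square)
  finally have 3: "exp (n * (((real n + 1) * (real (4 * K * n) + 1)) ^ 96 * exp (- (x / 256)))) \<le> exp (1 / n)"
    by simp
  show ?thesis using 1 2 3 by linarith
qed

theorem theorem1p8:
  fixes \<epsilon> :: real
  assumes "\<epsilon> > 0"
  shows
    "\<exists>c :: nat \<Rightarrow> nat.
       (\<forall>n. c n > 0) \<and> (\<lambda>n. real (c n)) \<in> O(\<lambda>n. real n) \<and>
       (\<exists>a > 0. \<exists>b > 0. \<forall>p :: nat \<Rightarrow> real.
          (\<forall>n. 0 \<le> p n \<and> p n \<le> 1) \<longrightarrow>
          filterlim (\<lambda>n. p n * real n / ln (real n)) at_top sequentially \<longrightarrow>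
          (\<exists>t :: nat \<Rightarrow> nat.
             (\<forall>\<^sub>F n in sequentially.
                a * (real n * p n) \<le> real (t n) \<and> real (t n) \<le> b * (real n * p n)) \<and>
             (\<forall>G :: nat \<Rightarrow> nat graph.
                (\<forall>n. finite_simple_graph (G n) \<and> card (verts (G n)) = n) \<longrightarrow>
                (\<forall>\<^sub>F n in sequentially. real (min_degree (G n)) \<ge> (1 + \<epsilon>) * real n / 2) \<longrightarrow>
                (\<lambda>n. measure_pmf.prob (random_colored_graph (c n) (G n) (p n))
                   {H. has_disjoint_rainbow_hamilton_cycles (verts (G n)) H (t n)})
                \<longlonglongrightarrow> 1)))"
proof -
  define \<gamma> :: real where "\<gamma> = 1 / 100000"
  \<comment> \<open>The degree condition weakens as \<open>\<epsilon>\<close> decreases, so the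
    value may be capped at 1.\<close>
  define \<epsilon>' where "\<epsilon>' = min \<epsilon> 1"
  have eps: "0 < \<epsilon>'" "\<epsilon>' \<le> 1" "\<epsilon>' \<le> \<epsilon>" using assms by (simp_all add: \<epsilon>'_def)
  define g where "g = \<gamma> * \<epsilon>'"
  have g: "0 < g" "g \<le> 1" using eps by (simp_all add: g_def \<gamma>_def)
  define \<kappa> where "\<kappa> = g\<^sup>2 / 128"
  have \<kappa>: "0 < \<kappa>" "\<kappa> \<le> 1 / 128" using g by (simp_all add: \<kappa>_def power_le_one)
  obtain k1 :: nat where "8 / g \<le> k1" using real_arch_simple by blast
  then have k1: "8 \<le> g * k1" using g by (simp add: field_simps)
  obtain j :: nat where "16 / g * ln (4 / g) \<le> j" using real_arch_simple by blast
  then have "ln (4 / g) \<le> g * j / 16" using g by (simp add: field_simps)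
  then have "exp (- (g * j / 16)) \<le> exp (- ln (4 / g))" by simp
  also have "\<dots> = g / 4" using g by (simp add: exp_minus)
  finally have j: "exp (- (g * j / 16)) \<le> g / 4" .
  \<comment> \<open>\<open>K * n\<close> bounds the exposed sets: \<open>k1 * n\<close> edges hit
    the split pairs, \<open>3 * n\<close> are for stars and boosters, \<open>j * n\<close> are
    helpers. All of these depend on \<open>\<epsilon>\<close> only, so \<open>c\<close> is fixed
    before \<open>p\<close>.\<close>
  define K where "K = k1 + 3 + j"
  \<comment> \<open>The maximum keeps the set of colours nonempty at \<open>n = 0\<close>.\<close>
  define c where "c n = max 1 (4 * K * n)" for n :: nat
  \<comment> \<open>The summands serve the star estimate, the rounding of \<open>t\<close> and the
    richness bound, in this order.\<close>
  define C where "C = 98816 + 128 / \<kappa> + 64 / \<kappa> * (K * ln (128 / \<kappa>) + 1)"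
  have "0 \<le> ln (128 / \<kappa>)" using \<kappa> by (intro ln_ge_zero) (simp add: field_simps)
  then have C: "98816 \<le> C" "128 / \<kappa> \<le> C" "64 / \<kappa> * (K * ln (128 / \<kappa>) + 1) \<le> C"
    using \<kappa> by (simp_all add: C_def)
  obtain N1 :: nat where N1: "2 * K / \<kappa> \<le> N1" using real_arch_simple by blast
  define N0 where "N0 = max 300000 (max (4 * K + 2) N1)"
  have large: "300000 \<le> n \<and> 4 * K + 2 \<le> n \<and> 2 * K \<le> \<kappa> * n \<and> 1 \<le> ln (real n)" if "N0 \<le> n" for n
  proof -
    have n: "300000 \<le> n" "4 * K + 2 \<le> n" "N1 \<le> n" using that by (simp_all add: N0_def)
    have "2 * K / \<kappa> \<le> n" using N1 n(3) by linarith
    then have "2 * K \<le> \<kappa> * n" using \<kappa> by (simp add: field_simps)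
    moreover have "exp 1 \<le> real n" using n(1) exp_le by linarith
    then have "1 \<le> ln (real n)" using n(1) by (subst ln_ge_iff) auto
    ultimately show ?thesis using n by simp
  qed
  have cO: "(\<lambda>n. real (c n)) \<in> O(\<lambda>n. real n)"
  proof (rule bigoI[of _ "4 * real K + 1"])
    show "\<forall>\<^sub>F n in sequentially. norm (real (c n)) \<le> (4 * real K + 1) * norm (real n)"
      using eventually_ge_at_top[of 1]
    proof eventually_elim
      case (elim n)
      have "c n \<le> (4 * K + 1) * n" using elim by (simp add: c_def)
      then have "real (c n) \<le> real ((4 * K + 1) * n)" by (rule of_nat_mono)
      then show ?case by (simp add: algebra_simps)
    qed
  qed
  have main: "\<exists>t :: nat \<Rightarrow> nat.
     (\<forall>\<^sub>F n in sequentially.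
        \<kappa> / 128 * (real n * p n) \<le> real (t n) \<and> real (t n) \<le> \<kappa> / 64 * (real n * p n)) \<and>
     (\<forall>G :: nat \<Rightarrow> nat graph.
        (\<forall>n. finite_simple_graph (G n) \<and> card (verts (G n)) = n) \<longrightarrow>
        (\<forall>\<^sub>F n in sequentially. real (min_degree (G n)) \<ge> (1 + \<epsilon>) * real n / 2) \<longrightarrow>
        (\<lambda>n. measure_pmf.prob (random_colored_graph (c n) (G n) (p n))
           {H. has_disjoint_rainbow_hamilton_cycles (verts (G n)) H (t n)})
        \<longlonglongrightarrow> 1)"
    if p: "\<forall>n. 0 \<le> p n \<and> p n \<le> 1"
      and lim: "filterlim (\<lambda>n. p n * real n / ln (real n)) at_top sequentially" for p :: "nat \<Rightarrow> real"
  proof -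
    define t where "t n = nat \<lfloor>\<kappa> * (n * p n) / 64\<rfloor>" for n
    have "\<forall>\<^sub>F n in sequentially. C \<le> p n * real n / ln (real n)"
      using lim by (simp add: filterlim_at_top)
    then have ev: "\<forall>\<^sub>F n in sequentially. N0 \<le> n \<and> C * ln (real n) \<le> n * p n \<and> C \<le> n * p n"
      using eventually_ge_at_top[of N0]
    proof eventually_elim
      case (elim n)
      have ln: "1 \<le> ln (real n)" using large[OF elim(2)] by simp
      then have 1: "C * ln (real n) \<le> n * p n" using elim(1) by (simp add: field_simps)
      have "C * 1 \<le> C * ln (real n)" using ln C(1) by (intro mult_left_mono) auto
      then show ?case using 1 elim(2) by simp
    qed
    have t_le: "real (t n) \<le> \<kappa> * (n * p n) / 64" for n
    proof -
      have "0 \<le> \<kappa> * (n * p n) / 64" using \<kappa> p by simp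
      then show ?thesis unfolding t_def by (rule of_nat_floor)
    qed
    have "\<forall>\<^sub>F n in sequentially.
        \<kappa> / 128 * (real n * p n) \<le> real (t n) \<and> real (t n) \<le> \<kappa> / 64 * (real n * p n)"
      using ev
    proof eventually_elim
      case (elim n)
      \<comment> \<open>The floor loses less than 1, which is now at most half of
        \<open>\<kappa> * (n * p n) / 64\<close>.\<close>
      have "128 / \<kappa> \<le> n * p n" using elim C(2) by linarith
      then have "\<kappa> * (128 / \<kappa>) \<le> \<kappa> * (n * p n)" using \<kappa> by (intro mult_left_mono) auto
      then have "128 \<le> \<kappa> * (n * p n)" using \<kappa> by simp
      moreover have "\<kappa> * (n * p n) / 64 - 1 \<le> real (t n)" unfolding t_def by linarith
      ultimately have "\<kappa> * (n * p n) / 128 \<le> real (t n)" by linarith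
      then show ?case using t_le[of n] by simp
    qed
    moreover have "(\<lambda>n. measure_pmf.prob (random_colored_graph (c n) (G n) (p n))
           {H. has_disjoint_rainbow_hamilton_cycles (verts (G n)) H (t n)}) \<longlonglongrightarrow> 1"
      if G: "\<forall>n. finite_simple_graph (G n) \<and> card (verts (G n)) = n"
        and deg: "\<forall>\<^sub>F n in sequentially. real (min_degree (G n)) \<ge> (1 + \<epsilon>) * real n / 2"
      for G :: "nat \<Rightarrow> nat graph"
    proof (rule tendsto_sandwich)
      show "(\<lambda>n. 1 - (3 * exp (- real n) + 1 / real n + (exp (1 / real n) - 1))) \<longlonglongrightarrow> 1"
        by real_asymp
      show "\<forall>\<^sub>F n in sequentially. measure_pmf.prob (random_colored_graph (c n) (G n) (p n))
           {H. has_disjoint_rainbow_hamilton_cycles (verts (G n)) H (t n)} \<le> 1" by simp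
      show "\<forall>\<^sub>F n in sequentially. 1 - (3 * exp (- real n) + 1 / real n + (exp (1 / real n) - 1))
        \<le> measure_pmf.prob (random_colored_graph (c n) (G n) (p n))
           {H. has_disjoint_rainbow_hamilton_cycles (verts (G n)) H (t n)}"
        using ev deg
      proof eventually_elim
        case (elim n)
        have N0: "N0 \<le> n" and Cl: "C * ln (real n) \<le> n * p n" and Cn: "C \<le> n * p n" using elim(1) by simp_all
        note lg = large[OF N0]
        have "(1 + \<epsilon>') * n / 2 \<le> (1 + \<epsilon>) * n / 2"
          using eps(3) by (intro divide_right_mono mult_right_mono) auto
        then have "(1 + \<epsilon>') * n / 2 \<le> min_degree (G n)" using elim(2) by linarith
        then interpret dirac_host "verts (G n)" "edges (G n)" n \<epsilon>' \<gamma>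
          unfolding \<gamma>_def using G eps lg by (intro dirac_host_of_min_degree) auto
        have c: "c n = 4 * K * n" using lg by (simp add: c_def K_def)
        have eq: "random_colored_graph (c n) (G n) (p n) = edge_states_pmf (edges (G n)) (4 * K * n) (p n)"
          unfolding c by (rule random_colored_graph_eq[OF finE])
        have pn: "0 \<le> p n" "p n \<le> 1" using p by simp_all
        have np: "64 \<le> n * p n" using Cn C(1) by linarith
        have "1 - (3 * exp (K * n * ln (128 / \<kappa>) - \<kappa> * n * (n * p n) / 64) + n * exp (- (n * p n / 16)) +
            (exp (n * (((real n + 1) * (real (4 * K * n) + 1)) ^ 96 * exp (- (n * p n / 256)))) - 1))
          \<le> measure_pmf.prob (edge_states_pmf (edges (G n)) (4 * K * n) (p n))
              {H. has_disjoint_rainbow_hamilton_cycles (verts (G n)) H (t n)}"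
          unfolding \<kappa>_def g_def
        proof (rule prob_packing[OF pn np K_def])
          show "2 * K \<le> (\<gamma> * \<epsilon>')\<^sup>2 / 128 * n" using lg by (simp add: \<kappa>_def g_def)
          show "8 \<le> \<gamma> * \<epsilon>' * k1" using k1 by (simp add: g_def)
          show "exp (- (\<gamma> * \<epsilon>' * j / 16)) \<le> \<gamma> * \<epsilon>' / 4" using j by (simp add: g_def)
          show "t n \<le> (\<gamma> * \<epsilon>')\<^sup>2 / 128 * (n * p n) / 64" using t_le[of n] by (simp add: \<kappa>_def g_def)
        qed
        moreover have "3 * exp (K * n * ln (128 / \<kappa>) - \<kappa> * n * (n * p n) / 64) + n * exp (- (n * p n / 16)) +
            (exp (n * (((real n + 1) * (real (4 * K * n) + 1)) ^ 96 * exp (- (n * p n / 256)))) - 1)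
          \<le> 3 * exp (- real n) + 1 / n + (exp (1 / n) - 1)"
          using lg Cl C(1,3) \<kappa>(1) by (intro error_terms_le[where C = C]) simp_all
        ultimately show ?case unfolding eq by linarith
      qed
    qed simp
    ultimately show ?thesis by blast
  qed
  show ?thesis
  proof (rule exI[of _ c], intro conjI)
    show "\<forall>n. 0 < c n" by (simp add: c_def less_max_iff_disj)
  qed (rule cO, rule exI[of _ "\<kappa> / 128"], rule conjI, simp add: \<kappa>(1),
      rule exI[of _ "\<kappa> / 64"], rule conjI, simp add: \<kappa>(1),
      intro allI impI, (rule main; assumption))
qed

end
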